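(* Let \begin{align*} \mathcal{R}_1&=\left\{(\lambda,\alpha)\in\mathbb{R}^2:\ \lambda>-1,\ -\frac32<\alpha\le\frac12\left(\lambda-\frac32\right)\right\}\\ &\qquad\cup\left\{(\lambda,\alpha)\in\mathbb{R}^2:\ \lambda>-\frac12,\ \frac12\left(\lambda-\frac32\right)<\alpha\le\min\left[\lambda-\frac12,\ \frac12(\lambda-1)\right]\right\}, \end{align*} and, for integers $n\ge2$, $$\mathcal{R}_n=\left\{(\lambda,\alpha)\in\mathbb{R}^2:\ \lambda>-1,\ -\frac{n+2}{2}<\alpha\le\min\left[\lambda-\frac12,\ \frac12\left(\lambda-\frac{n+1}{2}\right)\right]\right\}.$$ Let $n\ge1$ be an integer, $\delta>0$, $\rho\ge0$ and $(\lambda,\alpha)\in\mathcal{R}_n$. Then the function $$W(\mathbf{x})=\int_0^\infty\left(1-\frac{\|\mathbf{x}\|^2}{t}\right)_+^\lambda t^\alpha\left(1-t^\delta\right)_+^\rho\,dt\qquad(\mathbf{x}\in\mathbb{R}^n)$$ has a nonnegative non-vanishing Fourier transform and hence induces positive definite matrices on $\mathbb{R}^n$.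
   Context: $\|\cdot\|$ is the Euclidean norm on $\mathbb{R}^n$. For $s\in\mathbb{R}$ and a real exponent $p$, $(s)_+^p=s^p$ if $s>0$ and $(s)_+^p=0$ if $s\le0$ (in particular $(s)_+^0$ is $1$ for $s>0$ and $0$ otherwise). The Fourier transform is $\widehat W(\xi)=\int_{\mathbb{R}^n}W(\mathbf{x})e^{-i\xi\cdot\mathbf{x}}\,d\mathbf{x}$, $\xi\in\mathbb{R}^n$; "non-vanishing" is meant in the sense of not identically zero. "Induces positive definite matrices on $\mathbb{R}^n$" means that for every finite set of pairwise distinct points $\mathbf{x}_1,\dots,\mathbf{x}_N\in\mathbb{R}^n$ the matrix $\left(W(\mathbf{x}_i-\mathbf{x}_j)\right)_{i,j=1}^N$ is positive definite.
   Formalization: For α ≤ -1 one has W(0)=+∞, so the matrices have no real diagonal; there W takes values in [0,∞] and positive definiteness means the quadratic form, with diagonal entries +∞ and finite off-diagonal entries, is positive in the extended reals. *)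

theory Defs
  imports "HOL-Analysis.Analysis"
begin

(* The explicit test s > 0 is needed: powr does not vanish at negative arguments. *)
definition pos_powr :: "real \<Rightarrow> real \<Rightarrow> real" where
  "pos_powr s p = (if s > 0 then s powr p else 0)"

definition param_region :: "nat \<Rightarrow> (real \<times> real) set" where
  "param_region n =
     (if n = 1 then
        {(l, a). l > -1 \<and> - 3 / 2 < a \<and> a \<le> (l - 3 / 2) / 2} \<union>
        {(l, a). l > - 1 / 2 \<and> (l - 3 / 2) / 2 < a \<and> a \<le> min (l - 1 / 2) ((l - 1) / 2)}
      else
        {(l, a). l > -1 \<and> - (real n + 2) / 2 < a \<and>
                 a \<le> min (l - 1 / 2) ((l - (real n + 1) / 2) / 2)})"

(* The integrand is nonnegative. The value is taken in [0, \<infinity>] because the parameter regions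
   contain points with al \<le> -1, for which the integral diverges at x = 0 (and only there);
   a real-valued Bochner integral would wrongly return 0 at that point. *)
definition W_fun :: "real \<Rightarrow> real \<Rightarrow> real \<Rightarrow> real \<Rightarrow> real ^ 'n \<Rightarrow> ennreal" where
  "W_fun la al de rh x =
     (\<integral>\<^sup>+ t \<in> {0<..}. ennreal (pos_powr (1 - (norm x)\<^sup>2 / t) la * t powr al
                              * pos_powr (1 - t powr de) rh) \<partial>lborel)"

definition fourier_transform :: "(real ^ 'n \<Rightarrow> real) \<Rightarrow> real ^ 'n \<Rightarrow> complex" where
  "fourier_transform f \<xi> =
     (LINT x|lborel. complex_of_real (f x) * exp (- \<i> * complex_of_real (\<xi> \<bullet> x)))"

(* Positive definiteness of the symmetric matrix A i j, i, j < N. Diagonal entries may be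
   +\<infinity>; all others are finite, so no undetermined difference \<infinity> - \<infinity> occurs in the quadratic
   form (and 0 * \<infinity> = 0 in ereal). For real entries this is the usual notion, see
   pos_def_matrix_ereal. *)
definition pos_def_matrix :: "nat \<Rightarrow> (nat \<Rightarrow> nat \<Rightarrow> ereal) \<Rightarrow> bool" where
  "pos_def_matrix N A \<longleftrightarrow>
     (\<forall>i<N. \<forall>j<N. A i j = A j i) \<and>
     (\<forall>i<N. A i i \<noteq> -\<infinity>) \<and>
     (\<forall>i<N. \<forall>j<N. i \<noteq> j \<longrightarrow> \<bar>A i j\<bar> \<noteq> \<infinity>) \<and>
     (\<forall>c :: nat \<Rightarrow> real. (\<exists>i<N. c i \<noteq> 0) \<longrightarrow>
        0 < (\<Sum>i<N. \<Sum>j<N. ereal (c i * c j) * A i j))"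

lemma pos_def_matrix_ereal:
  "pos_def_matrix N (\<lambda>i j. ereal (A i j)) \<longleftrightarrow>
     (\<forall>i<N. \<forall>j<N. A i j = A j i) \<and>
     (\<forall>c :: nat \<Rightarrow> real. (\<exists>i<N. c i \<noteq> 0) \<longrightarrow> 0 < (\<Sum>i<N. \<Sum>j<N. c i * c j * A i j))"
  by (simp add: pos_def_matrix_def)

definition induces_pos_def_matrices :: "(real ^ 'n \<Rightarrow> ennreal) \<Rightarrow> bool" where
  "induces_pos_def_matrices W \<longleftrightarrow>
     (\<forall>N (x :: nat \<Rightarrow> real ^ 'n). inj_on x {..<N} \<longrightarrow>
        pos_def_matrix N (\<lambda>i j. enn2ereal (W (x i - x j))))"

lemma induces_pos_def_matrices_ennreal:
  assumes "\<And>x. 0 \<le> W x"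
  shows "induces_pos_def_matrices (\<lambda>x. ennreal (W x)) \<longleftrightarrow>
     (\<forall>N (x :: nat \<Rightarrow> real ^ 'n). inj_on x {..<N} \<longrightarrow>
        (\<forall>i<N. \<forall>j<N. W (x i - x j) = W (x j - x i)) \<and>
        (\<forall>c :: nat \<Rightarrow> real. (\<exists>i<N. c i \<noteq> 0) \<longrightarrow>
           0 < (\<Sum>i<N. \<Sum>j<N. c i * c j * W (x i - x j))))"
  using assms by (simp add: induces_pos_def_matrices_def enn2ereal_ennreal pos_def_matrix_ereal)

end

theory Submission
  imports Defs "HOL-Complex_Analysis.Cauchy_Integral_Formula"
begin

text \<open>
  Why the theorem holds. Write n for the dimension, \<nu> = n/2 + \<lambda>, \<kappa> = \<alpha> + n/2, and let
  f(x) = bess \<nu> x be the entire function with f(u^2) = (u/2)^(-\<nu>) J_\<nu>(u). The Fourier transform of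
  a truncated power (1 - |x|^2/t)_+^\<lambda> is C t^(n/2) f(t |\<xi>|^2) with C > 0, so by Fubini the transform
  of W at \<xi> is C times the integral over 0 < t < 1 of t^\<kappa> (1 - t^\<delta>)^\<rho> f(t |\<xi>|^2).

  Nonnegativity of this integral is a statement about one function of one variable. The parameter
  regions guarantee that \<nu> > -1/2, \<kappa> > -1 and \<kappa> \<le> k0, where k0 = (\<mu> + \<nu> - 1)/2 and
  \<mu> = max 0 (min \<nu> 1/2). Since t^(\<kappa> - k0) (1 - t^\<delta>)_+^\<rho> is nonincreasing, slicing this weight
  into indicators of initial intervals reduces everything to
    F(x) = (integral of y^k0 f(y) over 0 < y < x) \<ge> 0   for all x \<ge> 0,
  which is the positivity of the integral of u^\<mu> J_\<nu>(u) over 0 < u < r.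

  The key point is an energy argument. F solves a third order linear equation, and a suitable
  quadratic form E in F, F', F'' equals a positive multiple of (F')^2 at every zero of F, hence is
  nonnegative there (bess_energy_at_zero). On the other hand E is strictly decreasing
  (DERIV_bess_energy) up to the first zero of F, from the origin on, where it tends to 0, when
  \<nu> > 0, and from the first zero of f on, where it is negative, when -1/2 < \<nu> \<le> 0. So E would be
  negative at a first zero of F, and F has no positive zero. The argument degenerates at \<nu> = 1/2,
  where F(x) is a multiple of 1 - cos (sqrt x). The outcome is bess_int_nonneg.

  The Fourier transforms of radial functions are computed from the moments of (\<xi> \<bullet> x)^(2k): by
  scaling, the measure (\<xi> \<bullet> x)^(2k) dx has a power of t as density in the variable t = |x|^2, and
  the constant in front is found from the Gaussian, whose moment generating function is obtained
  by completing the square (radial_moment).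

  For positive definiteness, W may be infinite at the origin, and then the quadratic form is
  +\<infinity>. Otherwise W is bounded and continuous, because after t = |x|^2 + v its integrand decreases in
  |x|. Mollifying with a Gaussian turns the quadratic form into the integral of the transform of W
  against |a_1 exp(i x_1 \<bullet> \<xi>) + ... + a_N exp(i x_N \<bullet> \<xi>)|^2 and a Gaussian factor. This stays
  bounded away from 0 in the limit, since the trigonometric sum cannot vanish on a ball
  (quadratic_form_pos_of_cos_transform).
\<close>

section \<open>The entire function behind the Bessel function\<close>

definition bess_coeff :: "real \<Rightarrow> nat \<Rightarrow> real" where
  "bess_coeff nu k = (- 1 / 4) ^ k / (fact k * Gamma (nu + 1 + real k))"

text \<open>The Bessel-Clifford function C_\<nu> at -x/4, that is, bess \<nu> (u^2) = (u/2)^(-\<nu>) J_\<nu>(u). Removing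
  the power of u leaves an entire function of u^2, whose identities are identities of power series.\<close>

definition bess :: "real \<Rightarrow> real \<Rightarrow> real" where
  "bess nu x = (\<Sum>k. bess_coeff nu k * x ^ k)"

lemma bess_coeff_Suc:
  assumes "nu > -1"
  shows "bess_coeff nu (Suc k) = - bess_coeff nu k / (4 * (real k + 1) * (nu + 1 + real k))"
proof -
  have "Gamma (nu + 1 + real (Suc k)) = (nu + 1 + real k) * Gamma (nu + 1 + real k)"
    using Gamma_plus1[of "nu + 1 + real k"] assms by (simp add: add_ac nonpos_Ints_def)
  then show ?thesis by (simp add: bess_coeff_def)
qed

lemma bess_coeff_shift:
  assumes "nu > -1"
  shows "(nu + 1 + real k) * bess_coeff (nu + 1) k = bess_coeff nu k"
proof -
  have "Gamma (nu + 1 + 1 + real k) = (nu + 1 + real k) * Gamma (nu + 1 + real k)"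
    using Gamma_plus1[of "nu + 1 + real k"] assms by (simp add: add_ac nonpos_Ints_def)
  moreover have "nu + 1 + real k \<noteq> 0" using assms by auto
  ultimately show ?thesis by (simp add: bess_coeff_def)
qed

lemma diffs_bess_coeff: "diffs (bess_coeff nu) k = - bess_coeff (nu + 1) k / 4"
  by (simp add: diffs_def bess_coeff_def add_ac del: of_nat_Suc) (simp add: field_simps)

lemma summable_bess:
  assumes "nu > -1"
  shows "summable (\<lambda>k. bess_coeff nu k * x ^ k)"
proof (rule summable_ratio_test[where c = "1/2" and N = "nat \<lceil>\<bar>x\<bar>\<rceil> + 1"])
  fix k assume k: "nat \<lceil>\<bar>x\<bar>\<rceil> + 1 \<le> k"
  have kx: "\<bar>x\<bar> \<le> real k" "1 \<le> real k" using k by linarith+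
  have "2 * \<bar>x\<bar> \<le> 4 * 1 * real k" using kx by simp
  also have "\<dots> \<le> 4 * (real k + 1) * (nu + 1 + real k)"
    using kx assms by (intro mult_mono) auto
  finally have le: "\<bar>x\<bar> / (4 * (real k + 1) * (nu + 1 + real k)) \<le> 1 / 2"
    using kx assms by (simp add: divide_le_eq add_pos_pos)
  have "norm (bess_coeff nu (Suc k) * x ^ Suc k)
      = norm (bess_coeff nu k * x ^ k) * (\<bar>x\<bar> / (4 * (real k + 1) * (nu + 1 + real k)))"
    using kx assms by (simp add: bess_coeff_Suc abs_mult power_abs)
  also have "\<dots> \<le> norm (bess_coeff nu k * x ^ k) * (1 / 2)"
    by (intro mult_left_mono le) auto
  finally show "norm (bess_coeff nu (Suc k) * x ^ Suc k) \<le> 1 / 2 * norm (bess_coeff nu k * x ^ k)"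
    by simp
qed auto

text \<open>This and bess_recurrence are the two first order identities
  (u^(-\<nu>) J_\<nu>)' = - u^(-\<nu>) J_{\<nu>+1} and (u^(\<nu>+1) J_{\<nu>+1})' = u^(\<nu>+1) J_\<nu>. Together they replace
  the Bessel equation in everything that follows.\<close>

lemma DERIV_bess:
  assumes "nu > -1"
  shows "(bess nu has_field_derivative - bess (nu + 1) x / 4) (at x)"
proof -
  have "((\<lambda>x. \<Sum>k. bess_coeff nu k * x ^ k) has_field_derivative
         (\<Sum>k. diffs (bess_coeff nu) k * x ^ k)) (at x)"
    by (rule termdiffs_strong_converges_everywhere) (rule summable_bess[OF assms])
  also have "(\<Sum>k. diffs (bess_coeff nu) k * x ^ k) = (\<Sum>k. - 1 / 4 * (bess_coeff (nu + 1) k * x ^ k))"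
    by (simp add: diffs_bess_coeff)
  also have "\<dots> = - bess (nu + 1) x / 4"
    using assms by (subst suminf_mult) (auto simp: bess_def intro!: summable_bess)
  finally show ?thesis by (simp add: bess_def[abs_def])
qed

lemma bess_recurrence:
  assumes "nu > -1"
  shows "x * (- bess (nu + 2) x / 4) = bess nu x - (nu + 1) * bess (nu + 1) x"
proof -
  have s: "summable (\<lambda>k. bess_coeff (nu + 1) k * y ^ k)" for y
    using assms by (intro summable_bess) auto
  have "(\<lambda>k. real k * bess_coeff (nu + 1) k * x ^ (k - Suc 0)) sums
        (\<Sum>k. diffs (bess_coeff (nu + 1)) k * x ^ k)"
    by (intro diffs_equiv termdiff_converges_all s)
  also have "(\<Sum>k. diffs (bess_coeff (nu + 1)) k * x ^ k)
      = (\<Sum>k. - 1 / 4 * (bess_coeff (nu + 2) k * x ^ k))"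
    by (simp add: diffs_bess_coeff add.assoc)
  also have "\<dots> = - bess (nu + 2) x / 4"
    using assms by (subst suminf_mult) (auto simp: bess_def intro!: summable_bess)
  finally have "(\<lambda>k. x * (real k * bess_coeff (nu + 1) k * x ^ (k - Suc 0))) sums
      (x * (- bess (nu + 2) x / 4))" by (rule sums_mult)
  moreover have "x * (real k * bess_coeff (nu + 1) k * x ^ (k - Suc 0))
      = real k * bess_coeff (nu + 1) k * x ^ k" for k
    by (cases k) auto
  ultimately have 1: "(\<lambda>k. real k * bess_coeff (nu + 1) k * x ^ k) sums (x * (- bess (nu + 2) x / 4))"
    by simp
  have 2: "(\<lambda>k. (nu + 1) * (bess_coeff (nu + 1) k * x ^ k)) sums ((nu + 1) * bess (nu + 1) x)"
    unfolding bess_def by (intro sums_mult summable_sums s)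
  have "(\<lambda>k. bess_coeff nu k * x ^ k) sums (x * (- bess (nu + 2) x / 4) + (nu + 1) * bess (nu + 1) x)"
    using sums_add[OF 1 2] unfolding bess_coeff_shift[OF assms, symmetric] by (simp add: algebra_simps)
  then show ?thesis by (simp add: bess_def sums_iff)
qed

lemma bess_0: "bess nu 0 = 1 / Gamma (nu + 1)"
  unfolding bess_def powser_zero by (simp add: bess_coeff_def)

lemma bess_0_pos: "nu > -1 \<Longrightarrow> bess nu 0 > 0"
  by (simp add: bess_0 Gamma_real_pos)

lemma continuous_on_bess [continuous_intros]:
  assumes "nu > -1" "continuous_on S h"
  shows "continuous_on S (\<lambda>x. bess nu (h x))"
proof -
  have "continuous_on UNIV (bess nu)"
    using DERIV_bess[OF assms(1)] by (intro DERIV_continuous_on) auto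
  then show ?thesis using assms(2) by (rule continuous_on_compose2) auto
qed

lemma borel_measurable_bess:
  assumes "nu > -1"
  shows "bess nu \<in> borel_measurable borel"
  using assms by (intro borel_measurable_continuous_onI continuous_on_bess continuous_on_id)

text \<open>The function bess \<nu> ^2 + (x/4) bess (\<nu>+1) ^2 has the derivative
  - (2\<nu> + 1)/4 bess (\<nu>+1) ^2, so it does not exceed its value at 0. For \<nu> = -1/2 it is constant; this
  is cos^2 + sin^2 = 1 in disguise.\<close>

lemma abs_bess_le:
  assumes "nu \<ge> - 1 / 2" "x \<ge> 0"
  shows "\<bar>bess nu x\<bar> \<le> bess nu 0"
proof -
  define H where "H x = (bess nu x)\<^sup>2 + x / 4 * (bess (nu + 1) x)\<^sup>2" for x
  have nu: "nu > -1" using assms by simp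
  have "H x \<le> H 0"
  proof (rule DERIV_nonpos_imp_nonincreasing[OF assms(2)])
    fix y :: real assume "0 \<le> y" "y \<le> x"
    have "(H has_real_derivative
        2 * bess nu y * (- bess (nu + 1) y / 4) + ((bess (nu + 1) y)\<^sup>2 / 4
          + y / 4 * (2 * bess (nu + 1) y * (- bess (nu + 2) y / 4)))) (at y)"
      unfolding H_def using nu
      by (auto intro!: derivative_eq_intros DERIV_bess simp: add.assoc)
    also have "2 * bess nu y * (- bess (nu + 1) y / 4) + ((bess (nu + 1) y)\<^sup>2 / 4
          + y / 4 * (2 * bess (nu + 1) y * (- bess (nu + 2) y / 4)))
        = 2 * bess nu y * (- bess (nu + 1) y / 4) + (bess (nu + 1) y)\<^sup>2 / 4
          + bess (nu + 1) y / 2 * (y * (- bess (nu + 2) y / 4))" by simp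
    also have "\<dots> = - (2 * nu + 1) / 4 * (bess (nu + 1) y)\<^sup>2"
      unfolding bess_recurrence[OF nu] by (simp add: power2_eq_square algebra_simps)
    finally show "\<exists>d. (H has_real_derivative d) (at y) \<and> d \<le> 0"
      using assms by (intro exI conjI) (auto intro!: mult_nonpos_nonneg)
  qed
  moreover have "(bess nu x)\<^sup>2 \<le> H x" using assms by (simp add: H_def)
  ultimately have "(bess nu x)\<^sup>2 \<le> (bess nu 0)\<^sup>2" by (simp add: H_def)
  then show ?thesis using bess_0_pos[OF nu] by (simp add: abs_le_square_iff[symmetric])
qed

section \<open>The weighted integral of bess\<close>

lemma DERIV_powr_quotient:
  fixes x e :: real
  assumes "x > 0"
  shows "((\<lambda>x. x powr e) has_real_derivative e * x powr e / x) (at x)"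
  using has_real_derivative_powr[OF assms, of e] assms by (simp add: powr_diff field_simps)

definition bess_int :: "real \<Rightarrow> real \<Rightarrow> real \<Rightarrow> real" where
  "bess_int ka nu x = integral {0..x} (\<lambda>y. y powr ka * bess nu y)"

lemma powr_bess_absolutely_integrable:
  assumes "ka > -1" "nu \<ge> - 1 / 2"
  shows "(\<lambda>y. y powr ka * bess nu y) absolutely_integrable_on {0..x}"
proof (cases "x \<ge> 0")
  case True
  have m: "bess nu \<in> borel_measurable borel"
    using assms by (intro borel_measurable_bess) auto
  show ?thesis
  proof (rule measurable_bounded_by_integrable_imp_absolutely_integrable)
    show "(\<lambda>y. y powr ka * bess nu y) \<in> borel_measurable (lebesgue_on {0..x})"
      using m by (intro measurable_restrict_space1 measurable_completion) simp
    show "(\<lambda>y. y powr ka * bess nu 0) integrable_on {0..x}"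
      using assms True by (intro integrable_on_mult_left integrable_on_powr_from_0)
    fix y assume "y \<in> {0..x}"
    then show "norm (y powr ka * bess nu y) \<le> y powr ka * bess nu 0"
      using abs_bess_le[OF assms(2), of y] by (simp add: abs_mult mult_left_mono)
  qed auto
qed simp

lemma powr_bess_integrable:
  assumes "ka > -1" "nu \<ge> - 1 / 2"
  shows "(\<lambda>y. y powr ka * bess nu y) integrable_on {0..x}"
  using powr_bess_absolutely_integrable[OF assms] set_lebesgue_integral_eq_integral(1) by blast

lemma abs_bess_int_le:
  assumes "ka > -1" "nu \<ge> - 1 / 2" "x \<ge> 0"
  shows "\<bar>bess_int ka nu x\<bar> \<le> bess nu 0 * x powr (ka + 1) / (ka + 1)"
proof -
  have "((\<lambda>y. y powr ka * bess nu 0) has_integral x powr (ka + 1) / (ka + 1) * bess nu 0) {0..x}"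
    using assms by (intro has_integral_mult_left has_integral_powr_from_0)
  moreover have "norm (bess_int ka nu x) \<le> integral {0..x} (\<lambda>y. y powr ka * bess nu 0)"
    unfolding bess_int_def using powr_bess_integrable[OF assms(1,2)] calculation
  proof (intro integral_norm_bound_integral)
    fix y assume "y \<in> {0..x}"
    then show "norm (y powr ka * bess nu y) \<le> y powr ka * bess nu 0"
      using abs_bess_le[OF assms(2), of y] by (simp add: abs_mult mult_left_mono)
  qed auto
  ultimately have "\<bar>bess_int ka nu x\<bar> \<le> x powr (ka + 1) / (ka + 1) * bess nu 0"
    by (metis integral_unique real_norm_def)
  then show ?thesis by (simp add: mult_ac)
qed

lemma DERIV_bess_int:
  assumes "ka > -1" "nu \<ge> - 1 / 2" "x > 0"
  shows "(bess_int ka nu has_real_derivative x powr (ka + 1) * bess nu x / x) (at x)"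
proof -
  let ?h = "\<lambda>y. y powr ka * bess nu y"
  \<comment> \<open>The integrand may be unbounded at 0, so the fundamental theorem is applied on [x/2, 2x].\<close>
  have "continuous_on {x/2..2*x} ?h"
    using assms by (intro continuous_intros continuous_on_id) auto
  then have "((\<lambda>u. integral {x/2..u} ?h) has_real_derivative ?h x) (at x within {x/2..2*x})"
    using assms by (intro integral_has_real_derivative) auto
  moreover have "at x within {x/2..2*x} = at x"
    using assms by (intro at_within_interior) auto
  ultimately have "((\<lambda>u. integral {0..x/2} ?h + integral {x/2..u} ?h) has_real_derivative ?h x) (at x)"
    by (auto intro!: derivative_eq_intros)
  moreover have "\<forall>\<^sub>F u in nhds x. integral {0..x/2} ?h + integral {x/2..u} ?h = bess_int ka nu u"
  proof (rule eventually_nhds_in_open[of "{x/2<..}" x, THEN eventually_mono])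
    fix u assume "u \<in> {x/2<..}"
    then show "integral {0..x/2} ?h + integral {x/2..u} ?h = bess_int ka nu u"
      unfolding bess_int_def using assms
      by (intro Henstock_Kurzweil_Integration.integral_combine powr_bess_integrable) auto
  qed (use assms in auto)
  ultimately have "(bess_int ka nu has_real_derivative ?h x) (at x)"
    by (subst (asm) DERIV_cong_ev[OF refl _ refl]) auto
  then show ?thesis using assms by (simp add: powr_add)
qed

lemma continuous_on_bess_int:
  assumes "ka > -1" "nu \<ge> - 1 / 2"
  shows "continuous_on {0..x} (bess_int ka nu)"
  unfolding bess_int_def[abs_def]
  by (rule indefinite_integral_continuous_1[OF powr_bess_integrable[OF assms]])

lemma bess_int_0 [simp]: "bess_int ka nu 0 = 0"
  by (simp add: bess_int_def)

lemma first_zero: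
  fixes F :: "real \<Rightarrow> real"
  assumes "continuous_on {a..r} F" "F a > 0" "a < r" "F r \<le> 0"
  obtains z where "a < z" "z \<le> r" "F z = 0" "\<And>y. a \<le> y \<Longrightarrow> y < z \<Longrightarrow> F y > 0"
proof -
  define S where "S = {a..r} \<inter> F -` {..0}"
  have "closed S"
    unfolding S_def by (intro continuous_closed_preimage assms(1)) auto
  moreover have "bounded S"
    unfolding S_def by (rule bounded_subset[OF bounded_closed_interval]) auto
  ultimately have "compact S" by (simp add: compact_eq_bounded_closed)
  moreover have "r \<in> S" using assms by (auto simp: S_def)
  ultimately obtain z where z: "z \<in> S" "\<And>y. y \<in> S \<Longrightarrow> z \<le> y"
    using compact_attains_inf[of S] by auto
  have pos: "F y > 0" if "a \<le> y" "y < z" for y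
    using z that by (force simp: S_def not_le)
  have "z \<noteq> a" using z(1) assms by (auto simp: S_def)
  have "continuous_on {a..z} F" using assms(1) z(1) by (auto simp: S_def intro: continuous_on_subset)
  then obtain y where y: "a \<le> y" "y \<le> z" "F y = 0"
    using IVT2'[of F z 0 a] z(1) assms by (auto simp: S_def)
  then have "y = z" using pos[of y] by force
  then show ?thesis using that[of z] y pos z(1) \<open>z \<noteq> a\<close> by (auto simp: S_def)
qed

section \<open>Estimates up to the first zero of bess\<close>

lemma DERIV_powr_bess_Suc:
  assumes nu: "nu > -1" and "y > 0"
  shows "((\<lambda>y. y powr (nu + 1) * bess (nu + 1) y) has_real_derivative y powr (nu + 1) / y * bess nu y) (at y)"
proof -
  have "((\<lambda>y. y powr (nu + 1) * bess (nu + 1) y) has_real_derivative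
      (nu + 1) * y powr (nu + 1) / y * bess (nu + 1) y
        + y powr (nu + 1) / y * (y * (- bess (nu + 2) y / 4))) (at y)"
    using DERIV_mult[OF DERIV_powr_quotient[OF assms(2), of "nu + 1"] DERIV_bess[of "nu + 1"]] nu assms
    by (simp add: add.assoc mult_ac)
  also have "(nu + 1) * y powr (nu + 1) / y * bess (nu + 1) y
        + y powr (nu + 1) / y * (y * (- bess (nu + 2) y / 4)) = y powr (nu + 1) / y * bess nu y"
    unfolding bess_recurrence[OF nu] by (simp add: right_diff_distrib)
  finally show ?thesis .
qed

lemma continuous_on_powr_bess_Suc:
  assumes "nu > -1"
  shows "continuous_on {0..y} (\<lambda>y. y powr (nu + 1) * bess (nu + 1) y)"
  using assms by (intro continuous_intros continuous_on_powr' continuous_on_id) auto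

context
  fixes nu x1 :: real
  assumes nu: "nu > -1" and pos: "\<And>y. 0 \<le> y \<Longrightarrow> y < x1 \<Longrightarrow> bess nu y > 0"
begin

lemma bess_Suc_nonneg:
  assumes "0 \<le> y" "y \<le> x1"
  shows "bess (nu + 1) y \<ge> 0"
proof (cases "y = 0")
  case False
  then have y: "0 < y" using assms by simp
  have "0 powr (nu + 1) * bess (nu + 1) 0 \<le> y powr (nu + 1) * bess (nu + 1) y"
  proof (rule DERIV_nonneg_imp_increasing_open[where f = "\<lambda>y. y powr (nu + 1) * bess (nu + 1) y"])
    fix t assume "0 < t" "t < y"
    then show "\<exists>d. ((\<lambda>y. y powr (nu + 1) * bess (nu + 1) y) has_real_derivative d) (at t) \<and> 0 \<le> d"
      using DERIV_powr_bess_Suc[OF nu, of t] pos[of t] assms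
      by (intro exI conjI) auto
  qed (use assms nu in \<open>auto intro: continuous_on_powr_bess_Suc\<close>)
  then show ?thesis using y by (simp add: zero_le_mult_iff)
qed (use bess_0_pos[of "nu + 1"] nu in auto)

lemma bess_antimono:
  assumes "0 \<le> y" "y \<le> z" "z \<le> x1"
  shows "bess nu z \<le> bess nu y"
proof (rule DERIV_nonpos_imp_nonincreasing[OF assms(2)])
  fix t assume "y \<le> t" "t \<le> z"
  then show "\<exists>d. (bess nu has_real_derivative d) (at t) \<and> d \<le> 0"
    using DERIV_bess[OF nu, of t] bess_Suc_nonneg[of t] assms by (intro exI conjI) auto
qed

lemma bess_Suc_le:
  assumes "0 \<le> y" "y \<le> x1"
  shows "bess (nu + 1) y \<le> bess nu 0 / (nu + 1)"
proof (cases "y = 0")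
  case False
  then have y: "0 < y" using assms by simp
  let ?h = "\<lambda>y. bess nu 0 / (nu + 1) * y powr (nu + 1) - y powr (nu + 1) * bess (nu + 1) y"
  have "?h 0 \<le> ?h y"
  proof (rule DERIV_nonneg_imp_increasing_open[where f = ?h])
    fix t assume t: "0 < t" "t < y"
    have "(?h has_real_derivative bess nu 0 / (nu + 1) * ((nu + 1) * t powr (nu + 1) / t)
         - t powr (nu + 1) / t * bess nu t) (at t)"
      using t by (intro DERIV_diff DERIV_cmult DERIV_powr_quotient DERIV_powr_bess_Suc nu)
    also have "bess nu 0 / (nu + 1) * ((nu + 1) * t powr (nu + 1) / t)
         - t powr (nu + 1) / t * bess nu t = t powr (nu + 1) / t * (bess nu 0 - bess nu t)"
      using nu by (simp add: right_diff_distrib)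
    finally have D: "(?h has_real_derivative t powr (nu + 1) / t * (bess nu 0 - bess nu t)) (at t)" .
    have "0 \<le> t powr (nu + 1) / t * (bess nu 0 - bess nu t)"
      using bess_antimono[of 0 t] t assms by auto
    with D show "\<exists>d. (?h has_real_derivative d) (at t) \<and> 0 \<le> d" by blast
  next
    show "continuous_on {0..y} ?h"
      using nu by (intro continuous_on_diff continuous_on_mult continuous_on_const
          continuous_on_powr_bess_Suc continuous_on_powr' continuous_on_id) auto
  qed (use assms in auto)
  then have "0 \<le> y powr (nu + 1) * (bess nu 0 / (nu + 1) - bess (nu + 1) y)"
    by (simp add: algebra_simps)
  then show ?thesis using y by (simp add: zero_le_mult_iff)
next
  case True
  have "bess (nu + 1) 0 = bess nu 0 / (nu + 1)"
    using bess_recurrence[OF nu, of 0] nu by (simp add: field_simps)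
  then show ?thesis using True by simp
qed

text \<open>As long as bess \<nu> is positive, bess (\<nu>+1) is at most bess \<nu> 0 / (\<nu>+1), which bounds the slope
  of bess \<nu> from below. In particular the first zero is at least 4(\<nu>+1).\<close>

lemma bess_ge_linear:
  assumes "0 \<le> y" "y \<le> x1"
  shows "bess nu y \<ge> bess nu 0 * (1 - y / (4 * (nu + 1)))"
proof -
  let ?h = "\<lambda>y. bess nu y + bess nu 0 / (nu + 1) / 4 * y"
  have "?h 0 \<le> ?h y"
  proof (rule DERIV_nonneg_imp_nondecreasing[OF assms(1), where f = ?h])
    fix t assume t: "0 \<le> t" "t \<le> y"
    have D: "(?h has_real_derivative - bess (nu + 1) t / 4 + bess nu 0 / (nu + 1) / 4 * 1) (at t)"
      by (intro DERIV_add DERIV_bess[OF nu] DERIV_cmult DERIV_ident)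
    have "bess (nu + 1) t \<le> bess nu 0 / (nu + 1)"
      using bess_Suc_le[of t] t assms by simp
    then have "0 \<le> (bess nu 0 / (nu + 1) - bess (nu + 1) t) / 4" by simp
    also have "\<dots> = - bess (nu + 1) t / 4 + bess nu 0 / (nu + 1) / 4 * 1"
      by (simp only: diff_divide_distrib mult_1_right)
    finally have "0 \<le> - bess (nu + 1) t / 4 + bess nu 0 / (nu + 1) / 4 * 1" .
    with D show "\<exists>d. (?h has_real_derivative d) (at t) \<and> 0 \<le> d" by blast
  qed
  then show ?thesis by (simp add: field_simps)
qed

lemma bess_int_ge:
  assumes "ka > -1" "nu \<ge> - 1 / 2" "0 \<le> y" "y \<le> x1"
  shows "(ka + 1) * bess_int ka nu y \<ge> y powr (ka + 1) * bess nu y"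
proof (cases "y = 0")
  case False
  then have y: "0 < y" using assms by simp
  let ?h = "\<lambda>y. (ka + 1) * bess_int ka nu y - y powr (ka + 1) * bess nu y"
  have "?h 0 \<le> ?h y"
  proof (rule DERIV_nonneg_imp_increasing_open[where f = ?h])
    fix t assume t: "0 < t" "t < y"
    have "(?h has_real_derivative (ka + 1) * (t powr (ka + 1) * bess nu t / t)
         - ((ka + 1) * t powr (ka + 1) / t * bess nu t
              + (- bess (nu + 1) t / 4) * t powr (ka + 1))) (at t)"
      using t assms nu
      by (intro DERIV_diff DERIV_cmult DERIV_mult DERIV_powr_quotient DERIV_bess_int DERIV_bess)
    then have D: "(?h has_real_derivative bess (nu + 1) t / 4 * t powr (ka + 1)) (at t)"
      by simp
    have "0 \<le> bess (nu + 1) t / 4 * t powr (ka + 1)"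
      using bess_Suc_nonneg[of t] t assms by auto
    with D show "\<exists>d. (?h has_real_derivative d) (at t) \<and> 0 \<le> d" by blast
  next
    show "continuous_on {0..y} ?h"
      using assms nu by (intro continuous_on_diff continuous_on_mult continuous_on_const
          continuous_on_bess_int continuous_on_powr' continuous_on_id continuous_on_bess) auto
  qed (use assms in auto)
  then show ?thesis using assms by simp
qed simp

lemma bess_int_pos:
  assumes "ka > -1" "nu \<ge> - 1 / 2" "0 < y" "y \<le> x1"
  shows "bess_int ka nu y > 0"
proof -
  have "0 < (y / 2) powr (ka + 1) * bess nu (y / 2)"
    using assms pos[of "y / 2"] by simp
  also have "\<dots> \<le> (ka + 1) * bess_int ka nu (y / 2)"
    using assms by (intro bess_int_ge) auto
  finally have "0 < bess_int ka nu (y / 2)" using assms by (simp add: zero_less_mult_iff)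
  also have "\<dots> \<le> bess_int ka nu y"
  proof (rule DERIV_nonneg_imp_increasing_open[where f = "bess_int ka nu"])
    fix t assume t: "y / 2 < t" "t < y"
    then have "0 \<le> t powr (ka + 1) * bess nu t / t"
      using pos[of t] assms by auto
    with t DERIV_bess_int[of ka nu t] assms
    show "\<exists>d. (bess_int ka nu has_real_derivative d) (at t) \<and> 0 \<le> d"
      by (metis half_gt_zero less_trans)
  next
    show "continuous_on {y / 2..y} (bess_int ka nu)"
      by (rule continuous_on_subset[OF continuous_on_bess_int[of ka nu y]]) (use assms in auto)
  qed (use assms in auto)
  finally show ?thesis .
qed

end

section \<open>The energy argument\<close>

text \<open>Up to the first zero x1 of bess the integral increases, so a first zero z of the integral lies
  strictly beyond x1, and x1 itself is not small. The three positivity proofs below start from a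
  hypothetical pair x1, z.\<close>

lemma bess_int_first_zero:
  assumes ka: "ka > -1" and nu: "nu > - 1 / 2" and r: "r > 0" "bess_int ka nu r \<le> 0"
  obtains x1 z where "4 * (nu + 1) \<le> x1" "x1 < z" "bess nu x1 = 0" "bess_int ka nu z = 0"
    "\<And>y. 0 \<le> y \<Longrightarrow> y < x1 \<Longrightarrow> bess nu y > 0"
    "\<And>y. 0 < y \<Longrightarrow> y < z \<Longrightarrow> bess_int ka nu y > 0"
proof -
  have nu1: "nu > -1" "nu \<ge> - 1 / 2" using nu by auto
  have "\<exists>r'. 0 < r' \<and> r' \<le> r \<and> bess nu r' \<le> 0"
  proof (rule ccontr)
    assume no: "\<not> ?thesis"
    have "bess nu y > 0" if "0 \<le> y" "y < r" for y
      using that no bess_0_pos[OF nu1(1)] by (metis less_eq_real_def not_le)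
    from bess_int_pos[OF nu1(1) this ka nu1(2) r(1) order_refl] r(2) show False by simp
  qed
  then obtain r' where r': "0 < r'" "r' \<le> r" "bess nu r' \<le> 0" by blast
  have "continuous_on {0..r'} (bess nu)"
    using nu1 by (intro continuous_on_bess continuous_on_id) auto
  then obtain x1 where x1: "0 < x1" "x1 \<le> r'" "bess nu x1 = 0"
      and pos: "\<And>y. 0 \<le> y \<Longrightarrow> y < x1 \<Longrightarrow> bess nu y > 0"
    by (rule first_zero[OF _ bess_0_pos[OF nu1(1)] r'(1,3)]) blast
  have Fpos: "bess_int ka nu y > 0" if "0 < y" "y \<le> x1" for y
    using bess_int_pos[OF nu1(1) pos ka nu1(2) that] by simp
  have "x1 < r" using Fpos[of x1] x1 r r' by (cases "x1 = r") auto
  have "continuous_on {x1..r} (bess_int ka nu)"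
    by (rule continuous_on_subset[OF continuous_on_bess_int[OF ka nu1(2), of r]]) (use x1 in auto)
  from first_zero[OF this Fpos[OF x1(1) order_refl] \<open>x1 < r\<close> r(2)] obtain z
    where z: "x1 < z" "bess_int ka nu z = 0" "\<And>y. x1 \<le> y \<Longrightarrow> y < z \<Longrightarrow> bess_int ka nu y > 0"
    by blast
  have "bess nu 0 * (1 - x1 / (4 * (nu + 1))) \<le> bess nu x1"
    using x1 by (intro bess_ge_linear[where ?x1.0 = x1, OF nu1(1) pos]) auto
  then have "1 - x1 / (4 * (nu + 1)) \<le> 0"
    using x1 bess_0_pos[OF nu1(1)] by (simp add: mult_le_0_iff)
  then have "4 * (nu + 1) \<le> x1" using nu by (simp add: field_simps)
  moreover have "bess_int ka nu y > 0" if "0 < y" "y < z" for y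
    using that Fpos[of y] z(3)[of y] by linarith
  ultimately show ?thesis
    using that[of x1 z] x1(3) z(1,2) pos by blast
qed

context
  fixes ka nu :: real
  assumes ka: "ka > -1" and nu: "nu > - 1 / 2"
begin

text \<open>With \<theta> = x d/dx, P and Q are \<theta> F and \<theta> (\<theta> F). If F x is written as a
  multiple of the integral of u^\<mu> J_\<nu>(u) over 0 < u < sqrt x, then m = 1/2 - \<mu>.\<close>

private abbreviation F where "F \<equiv> bess_int ka nu"
private definition m where "m = nu - 2 * ka - 1 / 2"
private definition P where "P x = x powr (ka + 1) * bess nu x"
private definition Q where "Q x = x powr (ka + 1) * ((ka + 1) * bess nu x - x * bess (nu + 1) x / 4)"

text \<open>In the variable u this is the combination w ((F')^2 - 2 F F'') + p F F' + s F^2 with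
  w = u^m. The functions p and s are the only ones for which the terms with F F' and F F'' drop
  out of the derivative of the energy.\<close>

definition bess_energy where
  "bess_energy x = x powr ((m - 2) / 2) *
     (4 * (P x)\<^sup>2 - 8 * F x * Q x + 4 * (1 - m) * F x * P x + (nu\<^sup>2 - 1 / 4 - x) * (F x)\<^sup>2)"

private lemma nu1: "nu > -1" "nu \<ge> - 1 / 2" using nu by auto

private lemma DERIV_F: "x > 0 \<Longrightarrow> (F has_real_derivative P x / x) (at x)"
  using DERIV_bess_int[OF ka nu1(2)] by (simp add: P_def)

private lemma DERIV_P:
  assumes "x > 0"
  shows "(P has_real_derivative Q x / x) (at x)"
proof -
  have "(P has_real_derivative (ka + 1) * x powr (ka + 1) / x * bess nu x
           + (- bess (nu + 1) x / 4) * x powr (ka + 1)) (at x)"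
    unfolding P_def by (intro DERIV_mult DERIV_powr_quotient DERIV_bess nu1 assms)
  also have "(ka + 1) * x powr (ka + 1) / x * bess nu x
           + (- bess (nu + 1) x / 4) * x powr (ka + 1) = Q x / x"
    using assms by (simp add: Q_def field_simps)
  finally show ?thesis .
qed

private lemma DERIV_Q:
  assumes "x > 0"
  shows "(Q has_real_derivative
           ((3 / 2 - m) * Q x - (x / 4 + (ka + 1 - nu) * (ka + 1)) * P x) / x) (at x)"
proof -
  let ?X = "x powr (ka + 1)" and ?f = "bess nu x" and ?g = "bess (nu + 1) x"
  have "nu + 1 > -1" using nu by simp
  note D = DERIV_bess[OF this, of x, unfolded add.assoc one_add_one]
  have "(Q has_real_derivative (ka + 1) * ?X / x * ((ka + 1) * ?f - x * ?g / 4)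
      + ((ka + 1) * (- ?g / 4) - (1 * ?g + (- bess (nu + 2) x / 4) * x) / 4) * ?X) (at x)"
    unfolding Q_def
    by (intro DERIV_mult DERIV_diff DERIV_cmult DERIV_cdivide DERIV_ident DERIV_powr_quotient
        DERIV_bess nu1 assms D)
  also have "(- bess (nu + 2) x / 4) * x = ?f - (nu + 1) * ?g"
    using bess_recurrence[OF nu1(1), of x] by (simp add: mult.commute)
  also have "(ka + 1) * ?X / x * ((ka + 1) * ?f - x * ?g / 4)
      + ((ka + 1) * (- ?g / 4) - (1 * ?g + (?f - (nu + 1) * ?g)) / 4) * ?X
     = ((3 / 2 - m) * Q x - (x / 4 + (ka + 1 - nu) * (ka + 1)) * P x) / x"
  proof -
    have "(k + 1) * X / x * ((k + 1) * f - x * g / 4)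
        + ((k + 1) * (- g / 4) - (1 * g + (f - (n + 1) * g)) / 4) * X
      = ((3 / 2 - (n - 2 * k - 1 / 2)) * (X * ((k + 1) * f - x * g / 4))
          - (x / 4 + (k + 1 - n) * (k + 1)) * (X * f)) / x" for k X f g n
      using assms by (simp add: field_simps)
    then show ?thesis unfolding Q_def P_def m_def .
  qed
  finally show ?thesis .
qed

text \<open>No mixed terms remain. For |\<nu>| \<ge> 1/2 and 0 \<le> m \<le> 2 the energy therefore decreases for trivial
  reasons; for |\<nu>| < 1/2 the negative coefficient \<nu>^2 - 1/4 has to be beaten by the other two
  terms.\<close>

lemma DERIV_bess_energy:
  assumes "x > 0"
  shows "(bess_energy has_real_derivative - (x powr ((m - 2) / 2) / (2 * x)) *
      (4 * m * (P x)\<^sup>2 + (m * x + (2 - m) * (nu\<^sup>2 - 1 / 4)) * (F x)\<^sup>2)) (at x)"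
proof -
  let ?e = "(m - 2) / 2"
  let ?B = "4 * (P x)\<^sup>2 - 8 * F x * Q x + 4 * (1 - m) * F x * P x + (nu\<^sup>2 - 1 / 4 - x) * (F x)\<^sup>2"
  let ?Q' = "(3 / 2 - m) * Q x - (x / 4 + (ka + 1 - nu) * (ka + 1)) * P x"
  let ?B' = "8 * P x * Q x - 8 * (P x * Q x + F x * ?Q') + 4 * (1 - m) * (P x * P x + F x * Q x)
      + ((nu\<^sup>2 - 1 / 4 - x) * (2 * F x * P x) - x * (F x)\<^sup>2)"
  have "((\<lambda>x. 4 * (P x * P x) - 8 * (F x * Q x) + 4 * (1 - m) * (F x * P x)
        + (nu\<^sup>2 - 1 / 4 - x) * (F x * F x)) has_real_derivative
      4 * (Q x / x * P x + Q x / x * P x) - 8 * (P x / x * Q x + ?Q' / x * F x)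
      + 4 * (1 - m) * (P x / x * P x + Q x / x * F x)
      + ((0 - 0 - 1) * (F x * F x) + (P x / x * F x + P x / x * F x) * (nu\<^sup>2 - 1 / 4 - x))) (at x)"
    by (intro DERIV_add DERIV_diff DERIV_cmult DERIV_mult DERIV_const DERIV_ident
        DERIV_F DERIV_P DERIV_Q assms)
  also have "4 * (Q x / x * P x + Q x / x * P x) - 8 * (P x / x * Q x + ?Q' / x * F x)
      + 4 * (1 - m) * (P x / x * P x + Q x / x * F x)
      + ((0 - 0 - 1) * (F x * F x) + (P x / x * F x + P x / x * F x) * (nu\<^sup>2 - 1 / 4 - x)) = ?B' / x"
  proof -
    have "4 * (q / x * p + q / x * p) - 8 * (p / x * q + q' / x * f)
      + 4 * (1 - m) * (p / x * p + q / x * f) + ((0 - 0 - 1) * (f * f) + (p / x * f + p / x * f) * c)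
      = (8 * p * q - 8 * (p * q + f * q') + 4 * (1 - m) * (p * p + f * q) + (c * (2 * f * p) - x * f\<^sup>2)) / x"
      for p q f q' c using assms by (simp add: field_simps power2_eq_square)
    then show ?thesis .
  qed
  finally have dB: "((\<lambda>x. 4 * (P x)\<^sup>2 - 8 * F x * Q x + 4 * (1 - m) * F x * P x
        + (nu\<^sup>2 - 1 / 4 - x) * (F x)\<^sup>2) has_real_derivative ?B' / x) (at x)"
    by (simp only: power2_eq_square mult.assoc)
  have "(bess_energy has_real_derivative ?e * x powr ?e / x * ?B + ?B' / x * x powr ?e) (at x)"
    unfolding bess_energy_def by (intro DERIV_mult DERIV_powr_quotient dB assms)
  also have "?e * x powr ?e / x * ?B + ?B' / x * x powr ?e = x powr ?e / x * (?e * ?B + ?B')"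
  proof -
    have "e * X / x * b + b' / x * X = X / x * (e * b + b')" for e X b b' :: real
      by (simp add: algebra_simps add_divide_distrib)
    then show ?thesis .
  qed
  also have "?e * ?B + ?B' = - (1 / 2) * (4 * m * (P x)\<^sup>2 + (m * x + (2 - m) * (nu\<^sup>2 - 1 / 4)) * (F x)\<^sup>2)"
  proof -
    have c: "(ka + 1 - nu) * (ka + 1) = ((3 / 2 - m)\<^sup>2 - nu\<^sup>2) / 4"
      by (simp add: m_def field_simps power2_eq_square)
    have "(m - 2) / 2 * (4 * p\<^sup>2 - 8 * f * q + 4 * (1 - m) * f * p + (v - 1 / 4 - x) * f\<^sup>2)
       + (8 * p * q - 8 * (p * q + f * ((3 / 2 - m) * q - (x / 4 + ((3 / 2 - m)\<^sup>2 - v) / 4) * p))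
          + 4 * (1 - m) * (p * p + f * q) + ((v - 1 / 4 - x) * (2 * f * p) - x * f\<^sup>2))
       = - (1 / 2) * (4 * m * p\<^sup>2 + (m * x + (2 - m) * (v - 1 / 4)) * f\<^sup>2)" for m p q f v x :: real
      by (simp add: field_simps power2_eq_square)
    then show ?thesis unfolding c .
  qed
  also have "x powr ?e / x * (- (1 / 2) * (4 * m * (P x)\<^sup>2 + (m * x + (2 - m) * (nu\<^sup>2 - 1 / 4)) * (F x)\<^sup>2))
     = - (x powr ?e / (2 * x)) * (4 * m * (P x)\<^sup>2 + (m * x + (2 - m) * (nu\<^sup>2 - 1 / 4)) * (F x)\<^sup>2)"
    by simp
  finally show ?thesis .
qed

text \<open>Only the term 4 P^2 survives at a zero of F.\<close>

lemma bess_energy_at_zero: "F z = 0 \<Longrightarrow> bess_energy z \<ge> 0"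
  by (simp add: bess_energy_def)

lemma tendsto_bess_energy_0:
  assumes "nu / 2 + ka + 3 / 4 > 0"
  shows "(bess_energy \<longlongrightarrow> 0) (at_right 0)"
proof -
  define s where "s = (nu / 2 + ka + 3 / 4) / 2"
  have s: "s > 0" "(m - 2) / 4 + (ka + 1) = s" using assms by (simp_all add: s_def m_def field_simps)
  define w where "w x = x powr ((m - 2) / 4)" for x :: real
  have tail: "((\<lambda>x. x powr s) \<longlongrightarrow> 0) (at_right (0::real))"
  proof (rule tendsto_zero_powrI)
    show "\<forall>\<^sub>F x in at_right 0. (0::real) \<le> x"
      using eventually_at_right_less by (rule eventually_mono) auto
  qed (use s in auto)
  have lim: "(bess n \<longlongrightarrow> bess n 0) (at_right 0)" if "n > -1" for n
    using DERIV_isCont[OF DERIV_bess[OF that, of 0]] unfolding isCont_def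
    by (rule tendsto_mono[OF at_le[OF subset_UNIV]])
  have wX: "w x * x powr (ka + 1) = x powr s" for x
    unfolding w_def by (simp add: powr_add[symmetric] s)
  have "w x * P x = x powr s * bess nu x" for x
    unfolding P_def wX[symmetric] by simp
  moreover have "((\<lambda>x. x powr s * bess nu x) \<longlongrightarrow> 0) (at_right 0)"
    using tendsto_mult[OF tail lim[OF nu1(1)]] by simp
  ultimately have P: "((\<lambda>x. w x * P x) \<longlongrightarrow> 0) (at_right 0)" by simp
  have "w x * Q x = x powr s * ((ka + 1) * bess nu x - x * bess (nu + 1) x / 4)" for x
    unfolding Q_def wX[symmetric] by simp
  moreover have "((\<lambda>x. x powr s * ((ka + 1) * bess nu x - x * bess (nu + 1) x / 4)) \<longlongrightarrow> 0) (at_right 0)"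
  proof -
    have "((\<lambda>x. (ka + 1) * bess nu x - x * bess (nu + 1) x / 4) \<longlongrightarrow>
        (ka + 1) * bess nu 0 - 0 * bess (nu + 1) 0 / 4) (at_right 0)"
      using nu by (intro tendsto_intros lim) auto
    from tendsto_mult[OF tail this] show ?thesis by simp
  qed
  ultimately have Q: "((\<lambda>x. w x * Q x) \<longlongrightarrow> 0) (at_right 0)" by simp
  have F: "((\<lambda>x. w x * F x) \<longlongrightarrow> 0) (at_right 0)"
  proof (rule Lim_null_comparison)
    show "((\<lambda>x. x powr s * (bess nu 0 / (ka + 1))) \<longlongrightarrow> 0) (at_right 0)"
      by (rule tendsto_mult_left_zero[OF tail])
    show "\<forall>\<^sub>F x in at_right 0. norm (w x * F x) \<le> x powr s * (bess nu 0 / (ka + 1))"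
    proof (rule eventually_at_right_less[THEN eventually_mono])
      fix x :: real assume "0 < x"
      then have "w x * \<bar>F x\<bar> \<le> w x * (bess nu 0 * x powr (ka + 1) / (ka + 1))"
        by (intro mult_left_mono abs_bess_int_le ka nu1) (auto simp: w_def)
      then show "norm (w x * F x) \<le> x powr s * (bess nu 0 / (ka + 1))"
        unfolding wX[symmetric] by (simp add: abs_mult w_def mult_ac)
    qed
  qed
  have lim0: "((\<lambda>x. 4 * (w x * P x)\<^sup>2 - 8 * (w x * F x) * (w x * Q x) + 4 * (1 - m) * (w x * F x) * (w x * P x)
      + (nu\<^sup>2 - 1 / 4 - x) * (w x * F x)\<^sup>2) \<longlongrightarrow>
     4 * 0\<^sup>2 - 8 * 0 * 0 + 4 * (1 - m) * 0 * 0 + (nu\<^sup>2 - 1 / 4 - 0) * 0\<^sup>2) (at_right 0)"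
    by (intro tendsto_intros P Q F)
  have eq: "bess_energy x = 4 * (w x * P x)\<^sup>2 - 8 * (w x * F x) * (w x * Q x)
      + 4 * (1 - m) * (w x * F x) * (w x * P x) + (nu\<^sup>2 - 1 / 4 - x) * (w x * F x)\<^sup>2" for x
  proof -
    have "x powr ((m - 2) / 2) = (w x)\<^sup>2"
      by (simp add: w_def power2_eq_square powr_add[symmetric])
    moreover have "W\<^sup>2 * (4 * p\<^sup>2 - 8 * f * q + c * f * p + d * f\<^sup>2)
        = 4 * (W * p)\<^sup>2 - 8 * (W * f) * (W * q) + c * (W * f) * (W * p) + d * (W * f)\<^sup>2"
      for W p f q c d :: real
      by (simp add: power2_eq_square algebra_simps)
    ultimately show ?thesis unfolding bess_energy_def by simp
  qed
  show ?thesis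
    using Lim_transform_eventually[OF lim0 always_eventually[OF allI[OF eq[symmetric]]]] by simp
qed

lemma bess_energy_decreasing:
  assumes "0 < a" "a < b"
    "\<And>x. a < x \<Longrightarrow> x < b \<Longrightarrow> 4 * m * (P x)\<^sup>2 + (m * x + (2 - m) * (nu\<^sup>2 - 1 / 4)) * (F x)\<^sup>2 > 0"
  shows "bess_energy b < bess_energy a"
proof (rule DERIV_neg_imp_decreasing_open[OF assms(2)])
  fix x assume x: "a < x" "x < b"
  then have "- (x powr ((m - 2) / 2) / (2 * x)) *
      (4 * m * (P x)\<^sup>2 + (m * x + (2 - m) * (nu\<^sup>2 - 1 / 4)) * (F x)\<^sup>2) < 0"
    using assms by (intro mult_neg_pos) auto
  moreover have "x > 0" using x assms by simp
  ultimately show "\<exists>d. (bess_energy has_real_derivative d) (at x) \<and> d < 0"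
    using DERIV_bess_energy[of x] by blast
next
  show "continuous_on {a..b} bess_energy"
    using assms by (intro DERIV_continuous_on[OF has_field_derivative_at_within[OF DERIV_bess_energy]]) auto
qed

lemma bess_energy_neg:
  assumes lim: "nu / 2 + ka + 3 / 4 > 0" and "0 < z"
    "\<And>x. 0 < x \<Longrightarrow> x < z \<Longrightarrow> 4 * m * (P x)\<^sup>2 + (m * x + (2 - m) * (nu\<^sup>2 - 1 / 4)) * (F x)\<^sup>2 > 0"
  shows "bess_energy z < 0"
proof -
  have "bess_energy z < bess_energy (z / 2)"
    using assms by (intro bess_energy_decreasing) auto
  also have "\<dots> \<le> 0"
  proof (rule tendsto_lowerbound[OF tendsto_bess_energy_0[OF lim]])
    have "\<forall>\<^sub>F x in at_right 0. 0 < x \<and> x < z / 2"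
      using eventually_at_right[of 0 "z / 2"] assms by (auto intro!: exI[of _ "z / 2"])
    then show "\<forall>\<^sub>F x in at_right 0. bess_energy (z / 2) \<le> bess_energy x"
    proof (rule eventually_mono)
      fix x assume "0 < x \<and> x < z / 2"
      then show "bess_energy (z / 2) \<le> bess_energy x"
        using assms by (intro less_imp_le bess_energy_decreasing) auto
    qed
  qed auto
  finally show ?thesis .
qed

text \<open>Here m = 0, and the derivative of the energy is a negative multiple of F^2.\<close>

lemma bess_int_pos_large:
  assumes "nu > 1 / 2" "ka = nu / 2 - 1 / 4" "r > 0"
  shows "F r > 0"
proof (rule ccontr)
  assume "\<not> F r > 0"
  then have "F r \<le> 0" by simp
  with ka nu assms(3) obtain x1 z where z:
    "4 * (nu + 1) \<le> x1" "x1 < z" "bess nu x1 = 0" "F z = 0"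
    "\<And>y. 0 \<le> y \<Longrightarrow> y < x1 \<Longrightarrow> bess nu y > 0"
    "\<And>y. 0 < y \<Longrightarrow> y < z \<Longrightarrow> F y > 0"
    by (rule bess_int_first_zero) blast
  have m: "m = 0" unfolding m_def using assms by simp
  have "(1 / 2)\<^sup>2 < nu\<^sup>2" using assms by (intro power_strict_mono) auto
  then have nu2: "nu\<^sup>2 - 1 / 4 > 0" by (simp add: power2_eq_square)
  have "bess_energy z < 0"
  proof (rule bess_energy_neg)
    fix x assume "0 < x" "x < z"
    then show "4 * m * (P x)\<^sup>2 + (m * x + (2 - m) * (nu\<^sup>2 - 1 / 4)) * (F x)\<^sup>2 > 0"
      unfolding m using z(6)[of x] nu2 by simp
  qed (use assms z nu in auto)
  then show False using bess_energy_at_zero[OF z(4)] by simp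
qed

text \<open>With p = \<nu> + 1/2 and m = 1 - p the energy decreases where 4 P^2 + (x - p(p+1)) F^2 > 0. This
  is clear for x \<ge> 4(\<nu>+1). Below that bound P \<ge> p (1 - y) F with y = x / (4(\<nu>+1)), because there F
  is at most its value for a constant bess and bess lies above its linear lower bound.\<close>

lemma bess_int_pos_middle:
  assumes nu0: "0 < nu" "nu < 1 / 2" and k: "ka = nu - 1 / 2" and r: "r > 0"
  shows "F r > 0"
proof (rule ccontr)
  assume "\<not> F r > 0"
  then have "F r \<le> 0" by simp
  with ka nu r obtain x1 z where z:
    "4 * (nu + 1) \<le> x1" "x1 < z" "bess nu x1 = 0" "F z = 0"
    "\<And>y. 0 \<le> y \<Longrightarrow> y < x1 \<Longrightarrow> bess nu y > 0"
    "\<And>y. 0 < y \<Longrightarrow> y < z \<Longrightarrow> F y > 0"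
    by (rule bess_int_first_zero) blast
  define p where "p = nu + 1 / 2"
  have p: "1 / 2 < p" "p < 1" "ka + 1 = p" using assms by (simp_all add: p_def)
  have m: "m = 1 - p" unfolding m_def p_def using assms by simp
  have "bess_energy z < 0"
  proof (rule bess_energy_neg)
    fix x assume x: "0 < x" "x < z"
    have "4 * (P x)\<^sup>2 + (x - (p + 1) * p) * (F x)\<^sup>2 > 0"
    proof (cases "x < 4 * (nu + 1)")
      case False
      have "(p + 1) * p < 2 * 1" using p by (intro mult_strict_mono) auto
      then have "x - (p + 1) * p > 0" using False nu0 by simp
      then show ?thesis using z(6)[OF x] by (intro add_nonneg_pos) auto
    next
      case True
      define y where "y = x / (4 * (nu + 1))"
      have y: "0 < y" "y < 1" "x = (4 * p + 2) * y" using True x nu0 by (auto simp: y_def p_def field_simps)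
      have "p * F x \<le> p * (bess nu 0 * x powr p / p)"
        using abs_bess_int_le[OF ka nu1(2), of x] x p by (intro mult_left_mono) auto
      also have "\<dots> = x powr p * bess nu 0" using p by simp
      finally have "p * F x \<le> x powr p * bess nu 0" .
      then have "(1 - y) * (p * F x) \<le> (1 - y) * (x powr p * bess nu 0)"
        using y by (intro mult_left_mono) auto
      also have "\<dots> = x powr p * (bess nu 0 * (1 - y))" by simp
      also have "\<dots> \<le> P x"
        unfolding P_def p y_def
        using bess_ge_linear[OF nu1(1) z(5), where ?y = x and ?x1.0 = x1] True z x
        by (intro mult_left_mono) auto
      finally have "(1 - y) * p * F x \<le> P x" by simp
      then have "((1 - y) * p * F x)\<^sup>2 \<le> (P x)\<^sup>2"
        using y p z(6)[OF x] by (intro power_mono) auto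
      moreover have "4 * ((1 - y) * p)\<^sup>2 + (x - (p + 1) * p) > 0"
      proof -
        \<comment> \<open>The parabola (1 - y)^2 is replaced by its tangent at y = 1/4: with the slope -3/2 the
          coefficient of y stays nonnegative up to p = 1, where it vanishes.\<close>
        have "(y - 1 / 4)\<^sup>2 \<ge> 0" by simp
        then have "(1 - y)\<^sup>2 \<ge> 15 / 16 - 3 / 2 * y" by (simp add: power2_eq_square algebra_simps)
        then have "4 * p\<^sup>2 * (1 - y)\<^sup>2 \<ge> 4 * p\<^sup>2 * (15 / 16 - 3 / 2 * y)"
          by (intro mult_left_mono) auto
        moreover have "2 * (1 - p) * (1 + 3 * p) * y \<ge> 0" using p y by auto
        moreover have "p * (11 / 4 * p - 1) > 0" using p by auto
        ultimately show ?thesis unfolding y(3) by (simp add: power2_eq_square algebra_simps)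
      qed
      then have "(4 * ((1 - y) * p)\<^sup>2 + (x - (p + 1) * p)) * (F x)\<^sup>2 > 0"
        using z(6)[OF x] by (intro mult_pos_pos) auto
      moreover have "((1 - y) * p * F x)\<^sup>2 = ((1 - y) * p)\<^sup>2 * (F x)\<^sup>2"
        by (rule power_mult_distrib)
      ultimately show ?thesis unfolding distrib_right mult.assoc by linarith
    qed
    then have "(1 - p) * (4 * (P x)\<^sup>2 + (x - (p + 1) * p) * (F x)\<^sup>2) > 0" using p by simp
    moreover have "nu\<^sup>2 - 1 / 4 = - (1 - p) * p" by (simp add: p_def power2_eq_square field_simps)
    then have "4 * m * (P x)\<^sup>2 + (m * x + (2 - m) * (nu\<^sup>2 - 1 / 4)) * (F x)\<^sup>2
      = (1 - p) * (4 * (P x)\<^sup>2 + (x - (p + 1) * p) * (F x)\<^sup>2)"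
      by (simp only: m) (simp add: algebra_simps)
    ultimately show "4 * m * (P x)\<^sup>2 + (m * x + (2 - m) * (nu\<^sup>2 - 1 / 4)) * (F x)\<^sup>2 > 0"
      by simp
  qed (use assms z in auto)
  then show False using bess_energy_at_zero[OF z(4)] by simp
qed

text \<open>For \<nu> < -1/4 the energy tends to +\<infinity> at the origin, so the argument starts at the first zero x1
  of bess instead. There P = 0, and the energy is negative because \<nu>^2 < 1/4 and
  2 x1^(\<kappa>+1) bess (\<nu>+1) x1 \<le> F x1. The last inequality compares two integrals of the positive decreasing
  function bess whose kernels have the same total mass on (0, x1), one being concentrated nearer
  to 0; the function D below turns it into a monotonicity statement. Beyond x1 \<ge> 4(\<nu>+1) > 2 the energy
  decreases because x/2 > 3/8.\<close>

lemma bess_int_pos_small: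
  assumes nu0: "nu \<le> 0" and k: "ka = (nu - 1) / 2" and r: "r > 0"
  shows "F r > 0"
proof (rule ccontr)
  assume "\<not> F r > 0"
  then have "F r \<le> 0" by simp
  with ka nu r obtain x1 z where z:
    "4 * (nu + 1) \<le> x1" "x1 < z" "bess nu x1 = 0" "F z = 0"
    "\<And>y. 0 \<le> y \<Longrightarrow> y < x1 \<Longrightarrow> bess nu y > 0"
    "\<And>y. 0 < y \<Longrightarrow> y < z \<Longrightarrow> F y > 0"
    by (rule bess_int_first_zero) blast
  have x1: "x1 > 2" "0 < x1" using z(1) nu by auto
  have m: "m = 1 / 2" unfolding m_def using k by (simp add: field_simps)
  have nu4: "nu\<^sup>2 < 1 / 4"
    using power_strict_mono[of "- nu" "1 / 2" 2] nu nu0 by (simp add: power2_eq_square)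
  let ?D = "\<lambda>x. x powr (ka + 1) * F x - 2 * (x powr (nu + 1) * bess (nu + 1) x)"
  have "?D 0 \<le> ?D x1"
  proof (rule DERIV_nonneg_imp_increasing_open[where f = ?D])
    fix t assume t: "0 < t" "t < x1"
    have D: "(?D has_real_derivative ((ka + 1) * t powr (ka + 1) / t * F t + P t / t * t powr (ka + 1))
        - 2 * (t powr (nu + 1) / t * bess nu t)) (at t)"
      using t z(5) by (intro DERIV_diff DERIV_mult DERIV_cmult DERIV_powr_quotient DERIV_F
          DERIV_powr_bess_Suc nu1) auto
    have tt: "t powr (nu + 1) = t powr (ka + 1) * t powr (ka + 1)"
      unfolding powr_add[symmetric] by (rule arg_cong2[of _ _ _ _ "(powr)"]) (simp_all add: k field_simps)
    have "((ka + 1) * t powr (ka + 1) / t * F t + P t / t * t powr (ka + 1))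
        - 2 * (t powr (nu + 1) / t * bess nu t) = t powr (ka + 1) / t * ((ka + 1) * F t - t powr (ka + 1) * bess nu t)"
    proof -
      have "(k1 * X / t * f + X * b / t * X) - 2 * (X * X / t * b) = X / t * (k1 * f - X * b)"
        for k1 X f b :: real using t by (simp add: field_simps)
      then show ?thesis unfolding tt P_def .
    qed
    also have "\<dots> \<ge> 0"
      using bess_int_ge[OF nu1(1) z(5) ka nu1(2), where ?y = t and ?x1.0 = x1] t by simp
    finally show "\<exists>d. (?D has_real_derivative d) (at t) \<and> 0 \<le> d"
      using D by blast
  next
    show "continuous_on {0..x1} ?D"
      using ka nu1 by (intro continuous_on_diff continuous_on_mult continuous_on_const
          continuous_on_bess_int continuous_on_powr' continuous_on_id
          continuous_on_powr_bess_Suc[OF nu1(1)]) auto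
  qed (use x1 in auto)
  then have D: "2 * (x1 powr (nu + 1) * bess (nu + 1) x1) \<le> x1 powr (ka + 1) * F x1" by simp
  have g: "2 * x1 powr (ka + 1) * bess (nu + 1) x1 \<le> F x1"
  proof -
    have "x1 powr (nu + 1) = x1 powr (ka + 1) * x1 powr (ka + 1)"
      unfolding powr_add[symmetric] by (rule arg_cong2[of _ _ _ _ "(powr)"]) (simp_all add: k field_simps)
    with D have "x1 powr (ka + 1) * (2 * x1 powr (ka + 1) * bess (nu + 1) x1) \<le> x1 powr (ka + 1) * F x1"
      by (simp add: mult_ac)
    then show ?thesis using x1 by simp
  qed
  have Fx1: "F x1 > 0" using z x1 by auto
  have "bess_energy x1 = x1 powr ((m - 2) / 2) * (F x1 *
      (x1 * (2 * x1 powr (ka + 1) * bess (nu + 1) x1 - F x1) + (nu\<^sup>2 - 1 / 4) * F x1))"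
  proof -
    have P0: "P x1 = 0" by (simp add: P_def z)
    have Q0: "Q x1 = - (x1 * (x1 powr (ka + 1) * bess (nu + 1) x1) / 4)" by (simp add: Q_def z)
    have "W * (4 * 0\<^sup>2 - 8 * f * - (x1 * (X * g) / 4) + c * f * 0 + (v - x1) * f\<^sup>2)
        = W * (f * (x1 * (2 * X * g - f) + v * f))" for W f X g v c :: real
      by (simp add: power2_eq_square algebra_simps)
    then show ?thesis unfolding bess_energy_def P0 Q0 .
  qed
  also have "\<dots> < 0"
    using g x1 Fx1 nu4 by (intro mult_pos_neg add_nonpos_neg mult_nonneg_nonpos mult_neg_pos) auto
  finally have "bess_energy x1 < 0" .
  moreover have "bess_energy z < bess_energy x1"
  proof (rule bess_energy_decreasing)
    fix x assume x: "x1 < x" "x < z"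
    have "m * x + (2 - m) * (nu\<^sup>2 - 1 / 4) > 0" 
    proof -
      have "m * x + (2 - m) * (nu\<^sup>2 - 1 / 4) = x / 2 + 3 / 2 * nu\<^sup>2 - 3 / 8"
        by (simp add: m algebra_simps)
      then show ?thesis using x x1 zero_le_power2[of nu] by linarith
    qed
    then have "(m * x + (2 - m) * (nu\<^sup>2 - 1 / 4)) * (F x)\<^sup>2 > 0"
      using z(6)[of x] x x1 by (intro mult_pos_pos) auto
    moreover have "4 * m * (P x)\<^sup>2 \<ge> 0" by (simp add: m)
    ultimately show "4 * m * (P x)\<^sup>2 + (m * x + (2 - m) * (nu\<^sup>2 - 1 / 4)) * (F x)\<^sup>2 > 0"
      by linarith
  qed (use z x1 in auto)
  ultimately show False using bess_energy_at_zero[OF z(4)] by simp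
qed

end

text \<open>For \<nu> = 1/2 the energy vanishes identically. But bess (1/2) is up to the factor -4 the
  derivative of bess (-1/2), and bess (-1/2) is largest at 0.\<close>

lemma bess_int_nonneg_half: "x \<ge> 0 \<Longrightarrow> bess_int 0 (1 / 2) x \<ge> 0"
proof -
  assume x: "x \<ge> 0"
  have "((\<lambda>y. bess (1 / 2) y) has_integral (- 4 * bess (- 1 / 2) x) - (- 4 * bess (- 1 / 2) 0)) {0..x}"
  proof (rule fundamental_theorem_of_calculus[OF x])
    fix y assume "y \<in> {0..x}"
    have "((\<lambda>y. - 4 * bess (- 1 / 2) y) has_real_derivative - 4 * (- bess (- 1 / 2 + 1) y / 4)) (at y)"
      by (intro DERIV_cmult DERIV_bess) auto
    then show "((\<lambda>y. - 4 * bess (- 1 / 2) y) has_vector_derivative bess (1 / 2) y) (at y within {0..x})"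
      by (simp add: has_real_derivative_iff_has_vector_derivative has_vector_derivative_at_within)
  qed
  then have "((\<lambda>y. y powr 0 * bess (1 / 2) y) has_integral
      (- 4 * bess (- 1 / 2) x) - (- 4 * bess (- 1 / 2) 0)) {0..x}"
    using has_integral_spike_finite[of "{0}" "{0..x}" "\<lambda>y. y powr 0 * bess (1 / 2) y" "bess (1 / 2)"] by auto
  then have "bess_int 0 (1 / 2) x = (- 4 * bess (- 1 / 2) x) - (- 4 * bess (- 1 / 2) 0)"
    unfolding bess_int_def by (rule integral_unique)
  then show ?thesis using abs_bess_le[of "- 1 / 2" x] x by simp
qed

text \<open>In terms of Bessel functions: the integral of u^\<mu> J_\<nu>(u) over (0, r) is nonnegative for
  \<nu> > -1/2 and \<mu> = max 0 (min \<nu> 1/2).\<close>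

lemma bess_int_nonneg:
  assumes nu: "nu > - 1 / 2" and k: "ka = (max 0 (min nu (1 / 2)) + nu - 1) / 2" and x: "x \<ge> 0"
  shows "bess_int ka nu x \<ge> 0"
proof (cases "x = 0")
  case False
  then have x: "x > 0" using x by simp
  have ka: "ka > -1" using nu k by (auto simp: max_def min_def split: if_splits)
  consider "nu \<le> 0" | "0 < nu" "nu < 1 / 2" | "nu = 1 / 2" | "nu > 1 / 2" by linarith
  then show ?thesis
  proof cases
    case 1
    then have "ka = (nu - 1) / 2" using k by simp
    with 1 show ?thesis using bess_int_pos_small[OF ka nu] x by (simp add: less_imp_le)
  next
    case 2
    then have "ka = nu - 1 / 2" using k by (simp add: field_simps)
    with 2 show ?thesis using bess_int_pos_middle[OF ka nu] x by (simp add: less_imp_le)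
  next
    case 3
    then have "ka = 0" using k by simp
    then show ?thesis unfolding 3 using bess_int_nonneg_half x by simp
  next
    case 4
    then have "ka = nu / 2 - 1 / 4" using k by (simp add: field_simps)
    with 4 show ?thesis using bess_int_pos_large[OF ka nu] x by (simp add: less_imp_le)
  qed
qed simp

section \<open>Moments of radial functions\<close>

lemma nn_integral_lborel_affine:
  fixes h :: "'a::euclidean_space \<Rightarrow> ennreal"
  assumes [measurable]: "h \<in> borel_measurable borel" and "c > 0"
  shows "(\<integral>\<^sup>+x. h x \<partial>lborel) = ennreal (c ^ DIM('a)) * (\<integral>\<^sup>+x. h (a + c *\<^sub>R x) \<partial>lborel)"
proof -
  have "(\<integral>\<^sup>+x. h x \<partial>lborel)
      = (\<integral>\<^sup>+x. h x \<partial>density (distr lborel borel (\<lambda>x. a + c *\<^sub>R x)) (\<lambda>_. ennreal (\<bar>c\<bar> ^ DIM('a))))"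
    by (subst lborel_affine[symmetric]) (use assms(2) in auto)
  also have "\<dots> = (\<integral>\<^sup>+x. ennreal (c ^ DIM('a)) * h x \<partial>distr lborel borel (\<lambda>x. a + c *\<^sub>R x))"
    using assms(2) by (subst nn_integral_density) auto
  also have "\<dots> = (\<integral>\<^sup>+x. ennreal (c ^ DIM('a)) * h (a + c *\<^sub>R x) \<partial>lborel)"
    by (subst nn_integral_distr) auto
  also have "\<dots> = ennreal (c ^ DIM('a)) * (\<integral>\<^sup>+x. h (a + c *\<^sub>R x) \<partial>lborel)"
    by (rule nn_integral_cmult) measurable
  finally show ?thesis .
qed

lemma nn_integral_powr_from_0:
  fixes a c :: real
  assumes "a > -1" "c \<ge> 0"
  shows "(\<integral>\<^sup>+t. ennreal (t powr a) * indicator {0<..<c} t \<partial>lborel) = ennreal (c powr (a + 1) / (a + 1))"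
proof -
  have "(\<integral>\<^sup>+t. ennreal (t powr a) * indicator {0<..<c} t \<partial>lborel)
      = (\<integral>\<^sup>+t. ennreal (t powr a) * indicator {0..c} t \<partial>lborel)"
    by (rule nn_integral_cong_AE, rule eventually_mono[OF AE_lborel_singleton[of c]])
       (auto simp: indicator_def)
  also have "\<dots> = ennreal (c powr (a + 1) / (a + 1))"
    by (rule nn_integral_has_integral_lebesgue'[OF _ has_integral_powr_from_0]) (use assms in auto)
  finally show ?thesis .
qed

text \<open>The integral of (e \<bullet> x)^(2k) over the ball |x|^2 < s is a constant times s^(n/2+k) by scaling, so
  the image of the measure (e \<bullet> x)^(2k) dx under |x|^2 is known up to a constant. Finite measures on
  the line are determined by their values on {b<..}; the image under - |x|^2 is used to make these
  finite.\<close>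

lemma radial_moment_density:
  fixes e :: "'a::euclidean_space" and k :: nat
  obtains A where "A \<ge> 0" "\<And>H. H \<in> borel_measurable borel \<Longrightarrow>
    (\<integral>\<^sup>+x. H ((norm x)\<^sup>2) * ennreal ((e \<bullet> x) ^ (2 * k)) \<partial>lborel) =
    ennreal A * (\<integral>\<^sup>+t. H t * ennreal (t powr (real DIM('a) / 2 + real k - 1)) * indicator {0<..} t \<partial>lborel)"
proof -
  define q where "q x = ennreal ((e \<bullet> x) ^ (2 * k))" for x :: 'a
  define y where "y = real DIM('a) / 2 + real k"
  define B where "B s = (\<integral>\<^sup>+x. q x * indicator {x. (norm x)\<^sup>2 < s} x \<partial>lborel)" for s :: real
  have [measurable]: "q \<in> borel_measurable borel" unfolding q_def by measurable
  have y: "y > 0" by (simp add: y_def add_pos_nonneg)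
  have "B 1 \<le> (\<integral>\<^sup>+x. ennreal (norm e ^ (2 * k)) * indicator (ball 0 1) x \<partial>(lborel :: 'a measure))"
    unfolding B_def
  proof (intro nn_integral_mono)
    fix x :: 'a
    show "q x * indicator {x. (norm x)\<^sup>2 < 1} x \<le> ennreal (norm e ^ (2 * k)) * indicator (ball 0 1) x"
    proof (cases "norm x < 1")
      case True
      have "\<bar>e \<bullet> x\<bar> \<le> norm e * norm x" by (rule Cauchy_Schwarz_ineq2)
      also have "\<dots> \<le> norm e" using True by (simp add: mult_left_le)
      finally have "\<bar>e \<bullet> x\<bar> ^ (2 * k) \<le> norm e ^ (2 * k)" by (intro power_mono) auto
      then have "(e \<bullet> x) ^ (2 * k) \<le> norm e ^ (2 * k)" by (simp add: power_even_abs)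
      then show ?thesis using True by (simp add: q_def indicator_def ennreal_leI)
    next
      case False
      then have "1 \<le> (norm x)\<^sup>2" by (simp add: one_le_power)
      then show ?thesis by (simp add: indicator_def)
    qed
  qed
  also have "\<dots> < \<infinity>"
    using emeasure_lborel_ball_finite[of "0::'a" 1]
    by (subst nn_integral_cmult_indicator) (auto simp: ennreal_mult_less_top)
  finally have fin1: "B 1 < \<infinity>" .
  define a where "a = enn2real (B 1)"
  have a: "B 1 = ennreal a" "a \<ge> 0" using fin1 by (auto simp: a_def)
  have B: "B s = ennreal (a * s powr y)" if "s > 0" for s
  proof -
    have "B s = ennreal (sqrt s ^ DIM('a)) *
        (\<integral>\<^sup>+x. q (sqrt s *\<^sub>R x) * indicator {x. (norm x)\<^sup>2 < s} (sqrt s *\<^sub>R x) \<partial>(lborel :: 'a measure))"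
      unfolding B_def using that by (subst nn_integral_lborel_affine[of _ "sqrt s" 0]) auto
    also have "(\<integral>\<^sup>+x. q (sqrt s *\<^sub>R x) * indicator {x. (norm x)\<^sup>2 < s} (sqrt s *\<^sub>R x) \<partial>(lborel :: 'a measure))
        = (\<integral>\<^sup>+x. ennreal (sqrt s ^ (2 * k)) * (q x * indicator {x. (norm x)\<^sup>2 < 1} x) \<partial>lborel)"
    proof (intro nn_integral_cong)
      fix x :: 'a
      have "(norm (sqrt s *\<^sub>R x))\<^sup>2 < s \<longleftrightarrow> (norm x)\<^sup>2 < 1"
        using that by (simp add: power_mult_distrib)
      moreover have "q (sqrt s *\<^sub>R x) = ennreal (sqrt s ^ (2 * k)) * q x"
        using that by (simp add: q_def power_mult_distrib ennreal_mult'[symmetric])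
      ultimately show "q (sqrt s *\<^sub>R x) * indicator {x. (norm x)\<^sup>2 < s} (sqrt s *\<^sub>R x)
          = ennreal (sqrt s ^ (2 * k)) * (q x * indicator {x. (norm x)\<^sup>2 < 1} x)"
        by (simp add: indicator_def)
    qed
    also have "\<dots> = ennreal (sqrt s ^ (2 * k)) * B 1"
      unfolding B_def by (intro nn_integral_cmult) measurable
    also have "ennreal (sqrt s ^ DIM('a)) * (ennreal (sqrt s ^ (2 * k)) * B 1)
        = ennreal (a * (sqrt s ^ DIM('a) * sqrt s ^ (2 * k)))"
      unfolding a(1) using that a(2) by (simp add: ennreal_mult mult_ac)
    also have "sqrt s ^ DIM('a) * sqrt s ^ (2 * k) = s powr y"
    proof -
      have "sqrt s ^ j = s powr (real j / 2)" for j
        using that by (simp add: powr_realpow[symmetric] powr_half_sqrt[symmetric] powr_powr)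
      then show ?thesis unfolding y_def powr_add by simp
    qed
    finally show ?thesis .
  qed
  define M where "M = distr (density lborel q) borel (\<lambda>x. - (norm x)\<^sup>2)"
  define N where "N = density lborel (\<lambda>t. ennreal (a * y) * (ennreal ((- t) powr (y - 1)) * indicator {0<..} (- t)))"
  have eM: "emeasure M {b<..} = B (- b)" for b
  proof -
    have "(\<lambda>x::'a. - (norm x)\<^sup>2) -` {b<..} \<in> sets borel"
      by (rule measurable_sets_borel[of _ borel]) auto
    then show ?thesis
      unfolding M_def B_def
      by (subst emeasure_distr) (auto simp: emeasure_density intro!: nn_integral_cong simp: indicator_def)
  qed
  have B0: "B s = 0" if "s \<le> 0" for s
  proof -
    have "\<not> (norm x)\<^sup>2 < s" for x :: 'a
      using that zero_le_power2[of "norm x"] by linarith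
    then have "B s = (\<integral>\<^sup>+x. 0 \<partial>(lborel :: 'a measure))"
      unfolding B_def by (intro nn_integral_cong) (simp add: indicator_def)
    then show ?thesis by simp
  qed
  have MN: "M = N"
  proof (rule measure_eqI_lessThan)
    show "sets M = sets borel" "sets N = sets borel" by (simp_all add: M_def N_def)
    fix b :: real
    show "emeasure M {b<..} < \<infinity>" unfolding eM by (cases "b < 0") (auto simp: B B0)
    have "emeasure N {b<..} = (\<integral>\<^sup>+t. ennreal (a * y) * (ennreal ((- t) powr (y - 1)) * indicator {0<..} (- t))
        * indicator {b<..} t \<partial>lborel)"
      unfolding N_def by (subst emeasure_density) auto
    also have "\<dots> = (\<integral>\<^sup>+t. ennreal (a * y) * (ennreal (t powr (y - 1)) * indicator {0<..<- b} t) \<partial>lborel)"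
      by (subst nn_integral_real_affine[of _ "-1" 0]) (auto intro!: nn_integral_cong simp: indicator_def)
    also have "\<dots> = ennreal (a * y) * (\<integral>\<^sup>+t. ennreal (t powr (y - 1)) * indicator {0<..<- b} t \<partial>lborel)"
      by (rule nn_integral_cmult) measurable
    also have "\<dots> = B (- b)"
    proof (cases "b < 0")
      case True
      then show ?thesis using y a by (subst nn_integral_powr_from_0) (auto simp: B ennreal_mult'[symmetric])
    next
      case False
      then show ?thesis by (simp add: B0)
    qed
    finally show "emeasure M {b<..} = emeasure N {b<..}" by (simp add: eM)
  qed
  show ?thesis
  proof (rule that[of "a * y"])
    show "a * y \<ge> 0" using a y by simp
    fix H :: "real \<Rightarrow> ennreal" assume [measurable]: "H \<in> borel_measurable borel"
    have "(\<integral>\<^sup>+x. H ((norm x)\<^sup>2) * ennreal ((e \<bullet> x) ^ (2 * k)) \<partial>lborel) = (\<integral>\<^sup>+t. H (- t) \<partial>M)"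
      unfolding M_def
      by (subst nn_integral_distr) (auto simp: nn_integral_density q_def mult.commute)
    also have "\<dots> = (\<integral>\<^sup>+t. ennreal (a * y) * (ennreal ((- t) powr (y - 1)) * indicator {0<..} (- t)) * H (- t) \<partial>lborel)"
      unfolding MN N_def by (subst nn_integral_density) auto
    also have "\<dots> = (\<integral>\<^sup>+t. ennreal (a * y) * (ennreal (t powr (y - 1)) * indicator {0<..} t) * H t \<partial>lborel)"
      by (subst nn_integral_real_affine[of _ "-1" 0]) auto
    also have "\<dots> = (\<integral>\<^sup>+t. ennreal (a * y) * (H t * ennreal (t powr (y - 1)) * indicator {0<..} t) \<partial>lborel)"
      by (simp add: mult_ac)
    also have "\<dots> = ennreal (a * y) * (\<integral>\<^sup>+t. H t * ennreal (t powr (y - 1)) * indicator {0<..} t \<partial>lborel)"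
      by (rule nn_integral_cmult) measurable
    finally show "(\<integral>\<^sup>+x. H ((norm x)\<^sup>2) * ennreal ((e \<bullet> x) ^ (2 * k)) \<partial>lborel) =
      ennreal (a * y) * (\<integral>\<^sup>+t. H t * ennreal (t powr (real DIM('a) / 2 + real k - 1)) * indicator {0<..} t \<partial>lborel)"
      by (simp add: y_def)
  qed
qed

lemma nn_integral_gaussian_powr:
  assumes "s > 0" "y > (0::real)"
  shows "(\<integral>\<^sup>+t. ennreal (exp (- s * t)) * ennreal (t powr (y - 1)) * indicator {0<..} t \<partial>lborel)
     = ennreal (Gamma y / s powr y)"
proof -
  have "ennreal (Gamma y) = (\<integral>\<^sup>+t. ennreal (indicator {0..} t * t powr (y - 1) / exp t) \<partial>lborel)"
    by (rule Gamma_conv_nn_integral_real[OF assms(2)])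
  also have "\<dots> = ennreal s * (\<integral>\<^sup>+t. ennreal (indicator {0..} (s * t) * (s * t) powr (y - 1) / exp (s * t)) \<partial>lborel)"
    using assms by (subst nn_integral_real_affine[of _ s 0]) auto
  also have "(\<integral>\<^sup>+t. ennreal (indicator {0..} (s * t) * (s * t) powr (y - 1) / exp (s * t)) \<partial>lborel)
     = (\<integral>\<^sup>+t. ennreal (s powr (y - 1)) * (ennreal (exp (- s * t)) * ennreal (t powr (y - 1)) * indicator {0<..} t) \<partial>lborel)"
    using assms by (intro nn_integral_cong)
      (auto simp: indicator_def zero_le_mult_iff powr_mult exp_minus field_simps ennreal_mult'[symmetric])
  also have "\<dots> = ennreal (s powr (y - 1)) *
      (\<integral>\<^sup>+t. ennreal (exp (- s * t)) * ennreal (t powr (y - 1)) * indicator {0<..} t \<partial>lborel)"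
    by (rule nn_integral_cmult) measurable
  also have "ennreal s * \<dots> = ennreal (s powr y) *
      (\<integral>\<^sup>+t. ennreal (exp (- s * t)) * ennreal (t powr (y - 1)) * indicator {0<..} t \<partial>lborel)"
    using assms by (simp add: mult.assoc[symmetric] ennreal_mult'[symmetric] powr_diff)
  finally have eq: "ennreal (Gamma y) = ennreal (s powr y) *
      (\<integral>\<^sup>+t. ennreal (exp (- s * t)) * ennreal (t powr (y - 1)) * indicator {0<..} t \<partial>lborel)" .
  have "ennreal (Gamma y / s powr y) = ennreal (inverse (s powr y)) * ennreal (Gamma y)"
    using assms by (simp add: ennreal_mult'[symmetric] divide_inverse mult.commute)
  also have "\<dots> = ennreal (inverse (s powr y) * s powr y) *
      (\<integral>\<^sup>+t. ennreal (exp (- s * t)) * ennreal (t powr (y - 1)) * indicator {0<..} t \<partial>lborel)"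
    using assms by (simp only: eq ennreal_mult' mult.assoc[symmetric]) (simp add: ennreal_mult'[symmetric])
  also have "inverse (s powr y) * s powr y = 1" using assms by simp
  finally show ?thesis by simp
qed

text \<open>The identity theorem is needed on a one-sided neighbourhood of 0 only, because the power series
  below are series in a square.\<close>

lemma power_series_coeffs_unique:
  fixes a b :: "nat \<Rightarrow> real"
  assumes "\<And>z. z \<ge> 0 \<Longrightarrow> (\<lambda>k. a k * z ^ k) sums f z" "\<And>z. z \<ge> 0 \<Longrightarrow> (\<lambda>k. b k * z ^ k) sums h z"
    and r: "r > 0" and eq: "\<And>z. 0 \<le> z \<Longrightarrow> z < r \<Longrightarrow> f z = h z"
  shows "a k = b k"
proof -
  define c where "c k = a k - b k" for k
  have c: "(\<lambda>k. c k * z ^ k) sums (f z - h z)" if "z \<ge> 0" for z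
    using sums_diff[OF assms(1)[OF that] assms(2)[OF that]] by (simp add: c_def algebra_simps)
  have sm: "summable (\<lambda>k. c k * z ^ k)" for z
  proof -
    have "summable (\<lambda>k. c k * (\<bar>z\<bar> + 1) ^ k)" using c[of "\<bar>z\<bar> + 1"] by (auto simp: sums_iff)
    then show ?thesis by (rule powser_inside[of c "\<bar>z\<bar> + 1" z, OF _ ]) auto
  qed
  define g where "g z = (\<Sum>k. c k * z ^ k)" for z
  have g0: "g z = 0" if "z \<ge> 0" "z < r" for z using c[of z] eq[of z] that by (simp add: g_def sums_iff)
  have c0: "c 0 = 0" using g0[of 0] r by (simp add: g_def powser_zero)
  have "c k = 0"
  proof (rule ccontr)
    assume k: "c k \<noteq> 0"
    then have "k > 0" using c0 by (cases k) auto
    obtain s where s: "0 < s" "\<And>z. z \<in> cball 0 s - {0} \<Longrightarrow> g z \<noteq> 0"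
      by (rule powser_0_nonzero[of 1 0 c g k])
         (use k c0 \<open>k > 0\<close> sm in \<open>auto simp: g_def intro: summable_sums\<close>)
    have "min s (r / 2) \<in> cball 0 s - {0}" using s(1) r by (auto simp: dist_norm)
    then show False using s(2)[of "min s (r / 2)"] s(1) r g0[of "min s (r / 2)"] by auto
  qed
  then show ?thesis by (simp add: c_def)
qed

lemma cosh_paired: "(\<lambda>k. x ^ (2 * k) / fact (2 * k)) sums cosh (x :: real)"
proof -
  have "(\<lambda>n. if even n then x ^ n /\<^sub>R fact n else 0) sums cosh x" by (rule cosh_converges)
  then have "(\<lambda>k. (\<lambda>n. if even n then x ^ n /\<^sub>R fact n else 0) (2 * k)) sums cosh x"
    by (subst sums_mono_reindex) (auto simp: strict_mono_def elim!: evenE)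
  then show ?thesis by (simp add: divide_inverse mult.commute)
qed

text \<open>Completing the square, followed by a translation.\<close>

lemma gaussian_mgf:
  fixes a :: "'a::euclidean_space"
  shows "(\<integral>\<^sup>+x. ennreal (exp (- (norm x)\<^sup>2 / 2) * exp (a \<bullet> x)) \<partial>lborel)
    = ennreal (exp ((norm a)\<^sup>2 / 2)) * (\<integral>\<^sup>+x. ennreal (exp (- (norm x)\<^sup>2 / 2)) \<partial>(lborel :: 'a measure))"
proof -
  have "(\<integral>\<^sup>+x. ennreal (exp (- (norm x)\<^sup>2 / 2) * exp (a \<bullet> x)) \<partial>lborel)
      = (\<integral>\<^sup>+x. ennreal (exp ((norm a)\<^sup>2 / 2)) * ennreal (exp (- (norm (- a + 1 *\<^sub>R x))\<^sup>2 / 2)) \<partial>lborel)"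
  proof (intro nn_integral_cong)
    fix x :: 'a
    have "(norm (- a + 1 *\<^sub>R x))\<^sup>2 = (norm a)\<^sup>2 + (norm x)\<^sup>2 - 2 * (a \<bullet> x)"
      by (simp add: power2_norm_eq_inner inner_simps inner_commute)
    then show "ennreal (exp (- (norm x)\<^sup>2 / 2) * exp (a \<bullet> x))
        = ennreal (exp ((norm a)\<^sup>2 / 2)) * ennreal (exp (- (norm (- a + 1 *\<^sub>R x))\<^sup>2 / 2))"
      by (simp add: ennreal_mult'[symmetric] exp_add[symmetric] field_simps)
  qed
  also have "\<dots> = ennreal (exp ((norm a)\<^sup>2 / 2)) * (\<integral>\<^sup>+x. ennreal (exp (- (norm (- a + 1 *\<^sub>R x))\<^sup>2 / 2)) \<partial>lborel)"
    by (rule nn_integral_cmult) measurable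
  also have "(\<integral>\<^sup>+x. ennreal (exp (- (norm (- a + 1 *\<^sub>R x))\<^sup>2 / 2)) \<partial>lborel)
      = (\<integral>\<^sup>+x. ennreal (exp (- (norm x)\<^sup>2 / 2)) \<partial>(lborel :: 'a measure))"
    using nn_integral_lborel_affine[of "\<lambda>x::'a. ennreal (exp (- (norm x)\<^sup>2 / 2))" 1 "- a"] by simp
  finally show ?thesis .
qed

text \<open>The constants of radial_moment_density are determined by one test function. For the Gaussian,
  the integral of exp(-|x|^2/2) cosh(s (e \<bullet> x)) is Z exp(s^2 |e|^2/2), and comparing coefficients of
  s^(2k) gives all moments of exp(-|x|^2/2).\<close>

lemma radial_moment:
  obtains c where "c > 0" "\<And>(e :: 'a::euclidean_space) k H. H \<in> borel_measurable borel \<Longrightarrow>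
    (\<integral>\<^sup>+x. H ((norm x)\<^sup>2) * ennreal ((e \<bullet> x) ^ (2 * k)) \<partial>lborel) =
    ennreal (c * (fact (2 * k) * ((norm e)\<^sup>2 / 4) ^ k / (fact k * Gamma (real DIM('a) / 2 + real k)))) *
    (\<integral>\<^sup>+t. H t * ennreal (t powr (real DIM('a) / 2 + real k - 1)) * indicator {0<..} t \<partial>lborel)"
proof -
  define y where "y k = real DIM('a) / 2 + real k" for k
  have y: "y k > 0" for k by (simp add: y_def add_pos_nonneg)
  define A_spec where "A_spec e k A \<longleftrightarrow> A \<ge> 0 \<and> (\<forall>H. H \<in> borel_measurable borel \<longrightarrow>
      (\<integral>\<^sup>+x. H ((norm x)\<^sup>2) * ennreal ((e \<bullet> x) ^ (2 * k)) \<partial>lborel) =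
      ennreal A * (\<integral>\<^sup>+t. H t * ennreal (t powr (y k - 1)) * indicator {0<..} t \<partial>lborel))"
    for e :: 'a and k A
  define A where "A e k = (SOME A. A_spec e k A)" for e k
  have "A_spec e k (A e k)" for e k
    unfolding A_def
  proof (rule someI_ex)
    show "\<exists>A. A_spec e k A"
      by (rule radial_moment_density[of e k]) (auto simp: A_spec_def y_def)
  qed
  then have A0: "\<And>e k. A e k \<ge> 0" and A: "\<And>(e::'a) k H. H \<in> borel_measurable borel \<Longrightarrow>
      (\<integral>\<^sup>+x. H ((norm x)\<^sup>2) * ennreal ((e \<bullet> x) ^ (2 * k)) \<partial>lborel) =
      ennreal (A e k) * (\<integral>\<^sup>+t. H t * ennreal (t powr (y k - 1)) * indicator {0<..} t \<partial>lborel)"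
    by (simp_all add: A_spec_def)
  let ?g = "\<lambda>x::'a. exp (- (norm x)\<^sup>2 / 2)"
  define G where "G e k = A e k * (Gamma (y k) * 2 powr y k)" for e k
  have G0: "G e k \<ge> 0" for e k unfolding G_def using A0[of e k] y[of k] by (simp add: Gamma_real_pos less_imp_le)
  have G: "(\<integral>\<^sup>+x. ennreal (?g x) * ennreal ((e \<bullet> x) ^ (2 * k)) \<partial>lborel) = ennreal (G e k)" for e k
  proof -
    have "(\<integral>\<^sup>+x. ennreal (?g x) * ennreal ((e \<bullet> x) ^ (2 * k)) \<partial>lborel)
        = (\<integral>\<^sup>+x. ennreal (exp (- (1 / 2) * (norm x)\<^sup>2)) * ennreal ((e \<bullet> x) ^ (2 * k)) \<partial>lborel)" by simp
    also have "\<dots> = ennreal (A e k) *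
        (\<integral>\<^sup>+t. ennreal (exp (- (1 / 2) * t)) * ennreal (t powr (y k - 1)) * indicator {0<..} t \<partial>lborel)"
      by (rule A) measurable
    also have "\<dots> = ennreal (A e k) * ennreal (Gamma (y k) / (1 / 2) powr y k)"
      by (subst nn_integral_gaussian_powr) (use y in auto)
    also have "\<dots> = ennreal (G e k)"
      unfolding G_def using A0[of e k] y[of k]
      by (simp add: ennreal_mult'[symmetric] powr_divide)
    finally show ?thesis .
  qed
  define z0 where "z0 = G 0 0"
  have z0: "(\<integral>\<^sup>+x. ennreal (?g x) \<partial>lborel) = ennreal z0"
    using G[of 0 0] by (simp add: z0_def)
  have z0_pos: "z0 > 0"
  proof (rule ccontr)
    assume "\<not> z0 > 0"
    then have "(\<integral>\<^sup>+x. ennreal (?g x) \<partial>lborel) = 0" using z0 by (simp add: ennreal_neg)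
    then have "AE x in (lborel :: 'a measure). ennreal (?g x) = 0"
      by (subst (asm) nn_integral_0_iff_AE) auto
    then have "AE x in (lborel :: 'a measure). False" by simp
    then have "emeasure (lborel :: 'a measure) UNIV = 0"
      by (subst (asm) AE_iff_measurable[of UNIV]) auto
    then show False by simp
  qed
  have Geq: "G e k / fact (2 * k) = z0 * ((norm e)\<^sup>2 / 2) ^ k / fact k" for e :: 'a and k
  proof (rule power_series_coeffs_unique[where r = 1])
    fix z :: real assume z: "z \<ge> 0"
    have "(\<lambda>k. z0 * ((((norm e)\<^sup>2 / 2) * z) ^ k /\<^sub>R fact k)) sums (z0 * exp (((norm e)\<^sup>2 / 2) * z))"
      by (intro sums_mult exp_converges)
    moreover have "z0 * ((b * z) ^ k /\<^sub>R fact k) = z0 * b ^ k / fact k * z ^ k" for b k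
      by (simp add: power_mult_distrib divide_inverse)
    ultimately show "(\<lambda>k. z0 * ((norm e)\<^sup>2 / 2) ^ k / fact k * z ^ k) sums (z0 * exp (((norm e)\<^sup>2 / 2) * z))"
      by (simp only:)
    have cosh: "(\<integral>\<^sup>+x. ennreal (?g x * cosh (sqrt z * (e \<bullet> x))) \<partial>lborel) = ennreal (z0 * exp (((norm e)\<^sup>2 / 2) * z))"
    proof -
      have "(\<integral>\<^sup>+x. ennreal (?g x * cosh (sqrt z * (e \<bullet> x))) \<partial>lborel)
        = (\<integral>\<^sup>+x. ennreal (1 / 2) * (ennreal (?g x * exp ((sqrt z *\<^sub>R e) \<bullet> x)) + ennreal (?g x * exp ((- sqrt z *\<^sub>R e) \<bullet> x))) \<partial>lborel)"
      proof (intro nn_integral_cong)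
        fix x :: 'a
        have half: "ennreal (g * ((p + q) / 2)) = ennreal (1 / 2) * (ennreal (g * p) + ennreal (g * q))"
          if "g \<ge> 0" "p \<ge> 0" "q \<ge> 0" for g p q :: real
        proof -
          have "ennreal (g * p) + ennreal (g * q) = ennreal (g * p + g * q)"
            using that by (simp add: ennreal_plus)
          also have "ennreal (1 / 2) * \<dots> = ennreal (1 / 2 * (g * p + g * q))"
            using that by (subst ennreal_mult') auto
          also have "1 / 2 * (g * p + g * q) = g * ((p + q) / 2)" by (simp add: field_simps)
          finally show ?thesis by (rule sym)
        qed
        have "cosh (sqrt z * (e \<bullet> x)) = (exp ((sqrt z *\<^sub>R e) \<bullet> x) + exp ((- sqrt z *\<^sub>R e) \<bullet> x)) / 2"
          by (simp add: cosh_def)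
        then show "ennreal (?g x * cosh (sqrt z * (e \<bullet> x))) = ennreal (1 / 2) *
            (ennreal (?g x * exp ((sqrt z *\<^sub>R e) \<bullet> x)) + ennreal (?g x * exp ((- sqrt z *\<^sub>R e) \<bullet> x)))"
          using half[of "?g x" "exp ((sqrt z *\<^sub>R e) \<bullet> x)" "exp ((- sqrt z *\<^sub>R e) \<bullet> x)"]
          by (simp only:) auto
      qed
      also have "\<dots> = ennreal (1 / 2) * ((\<integral>\<^sup>+x. ennreal (?g x * exp ((sqrt z *\<^sub>R e) \<bullet> x)) \<partial>lborel)
          + (\<integral>\<^sup>+x. ennreal (?g x * exp ((- sqrt z *\<^sub>R e) \<bullet> x)) \<partial>lborel))"
        by (subst nn_integral_cmult) (simp_all add: nn_integral_add)
      also have "\<dots> = ennreal (1 / 2) * (ennreal (exp (z * (norm e)\<^sup>2 / 2)) * ennreal z0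
          + ennreal (exp (z * (norm e)\<^sup>2 / 2)) * ennreal z0)"
      proof -
        have "(norm (sqrt z *\<^sub>R e))\<^sup>2 = z * (norm e)\<^sup>2" "(norm (- sqrt z *\<^sub>R e))\<^sup>2 = z * (norm e)\<^sup>2"
          using z by (simp_all add: power_mult_distrib)
        then show ?thesis unfolding gaussian_mgf z0 by (simp only:)
      qed
      also have "\<dots> = ennreal (z0 * exp (((norm e)\<^sup>2 / 2) * z))"
      proof -
        have *: "ennreal (1 / 2) * (ennreal p * ennreal z0 + ennreal p * ennreal z0) = ennreal (z0 * p)"
          if "p \<ge> 0" for p
        proof -
          have "ennreal p * ennreal z0 + ennreal p * ennreal z0 = ennreal (p * z0 + p * z0)"
          proof -
            have "ennreal p * ennreal z0 = ennreal (p * z0)"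
              using that z0_pos by (simp add: ennreal_mult)
            then show ?thesis using that z0_pos by (simp only: ennreal_plus[symmetric] mult_nonneg_nonneg less_imp_le)
          qed
          also have "ennreal (1 / 2) * \<dots> = ennreal (1 / 2 * (p * z0 + p * z0))"
            using that z0_pos by (subst ennreal_mult') auto
          finally show ?thesis by (simp add: mult.commute)
        qed
        have "(norm e)\<^sup>2 / 2 * z = z * (norm e)\<^sup>2 / 2" by simp
        then show ?thesis by (simp only: *[OF exp_ge_zero])
      qed
      finally show ?thesis .
    qed
    have "(\<integral>\<^sup>+x. ennreal (?g x * cosh (sqrt z * (e \<bullet> x))) \<partial>lborel)
        = (\<integral>\<^sup>+x. (\<Sum>k. ennreal (z ^ k / fact (2 * k)) * (ennreal (?g x) * ennreal ((e \<bullet> x) ^ (2 * k)))) \<partial>lborel)"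
    proof (intro nn_integral_cong)
      fix x :: 'a
      have "(\<lambda>k. ?g x * ((sqrt z * (e \<bullet> x)) ^ (2 * k) / fact (2 * k))) sums (?g x * cosh (sqrt z * (e \<bullet> x)))"
        by (intro sums_mult cosh_paired)
      then have "ennreal (?g x * cosh (sqrt z * (e \<bullet> x)))
          = (\<Sum>k. ennreal (?g x * ((sqrt z * (e \<bullet> x)) ^ (2 * k) / fact (2 * k))))"
        by (intro suminf_ennreal_eq[symmetric]) auto
      also have "(\<lambda>k. ennreal (?g x * ((sqrt z * (e \<bullet> x)) ^ (2 * k) / fact (2 * k))))
          = (\<lambda>k. ennreal (z ^ k / fact (2 * k)) * (ennreal (?g x) * ennreal ((e \<bullet> x) ^ (2 * k))))"
      proof (intro ext)
        fix k
        have "(sqrt z * (e \<bullet> x)) ^ (2 * k) = z ^ k * (e \<bullet> x) ^ (2 * k)"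
          using z by (simp add: power_mult_distrib power_mult)
        then have "?g x * ((sqrt z * (e \<bullet> x)) ^ (2 * k) / fact (2 * k))
            = z ^ k / fact (2 * k) * (?g x * (e \<bullet> x) ^ (2 * k))" by simp
        then show "ennreal (?g x * ((sqrt z * (e \<bullet> x)) ^ (2 * k) / fact (2 * k)))
            = ennreal (z ^ k / fact (2 * k)) * (ennreal (?g x) * ennreal ((e \<bullet> x) ^ (2 * k)))"
          using z by (simp only: ennreal_mult[symmetric] zero_le_even_power' zero_le_power exp_ge_zero
              divide_nonneg_nonneg mult_nonneg_nonneg fact_ge_zero)
      qed
      finally show "ennreal (?g x * cosh (sqrt z * (e \<bullet> x)))
          = (\<Sum>k. ennreal (z ^ k / fact (2 * k)) * (ennreal (?g x) * ennreal ((e \<bullet> x) ^ (2 * k))))" .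
    qed
    also have "\<dots> = (\<Sum>k. ennreal (z ^ k / fact (2 * k)) * (\<integral>\<^sup>+x. (ennreal (?g x) * ennreal ((e \<bullet> x) ^ (2 * k))) \<partial>lborel))"
      by (subst nn_integral_suminf) (simp_all add: nn_integral_cmult)
    also have "\<dots> = (\<Sum>k. ennreal (G e k / fact (2 * k) * z ^ k))"
    proof -
      have "ennreal (z ^ k / fact (2 * k)) * ennreal (G e k) = ennreal (G e k / fact (2 * k) * z ^ k)" for k
        using z G0[of e k] by (subst ennreal_mult[symmetric]) (auto simp: mult.commute)
      then show ?thesis unfolding G by (simp only:)
    qed
    finally have sum: "(\<Sum>k. ennreal (G e k / fact (2 * k) * z ^ k)) = ennreal (z0 * exp (((norm e)\<^sup>2 / 2) * z))"
      using cosh by simp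
    have nn: "0 \<le> G e k / fact (2 * k) * z ^ k" for k using z G0[of e k] by simp
    have sm: "summable (\<lambda>k. G e k / fact (2 * k) * z ^ k)"
      by (rule summable_suminf_not_top[OF nn]) (unfold sum, simp)
    then have "ennreal (\<Sum>k. G e k / fact (2 * k) * z ^ k) = ennreal (z0 * exp (((norm e)\<^sup>2 / 2) * z))"
      using suminf_ennreal2[OF nn] sum by simp
    then have "(\<Sum>k. G e k / fact (2 * k) * z ^ k) = z0 * exp (((norm e)\<^sup>2 / 2) * z)"
      using suminf_nonneg[OF sm nn] z0_pos by (simp only: ennreal_inj mult_nonneg_nonneg less_imp_le exp_ge_zero)
    then show "(\<lambda>k. G e k / fact (2 * k) * z ^ k) sums (z0 * exp (((norm e)\<^sup>2 / 2) * z))"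
      using sm by (simp add: sums_iff)
  qed auto
  define c where "c = z0 / 2 powr (real DIM('a) / 2)"
  have "A e k = c * (fact (2 * k) * ((norm e)\<^sup>2 / 4) ^ k / (fact k * Gamma (y k)))" for e :: 'a and k
  proof -
    have Gp: "Gamma (y k) > 0" using y[of k] by (rule Gamma_real_pos)
    have "2 powr y k = 2 powr (real DIM('a) / 2) * 2 ^ k"
      by (simp add: y_def powr_add powr_realpow)
    moreover have "A e k * (Gamma (y k) * 2 powr y k) = z0 * ((norm e)\<^sup>2 / 2) ^ k / fact k * fact (2 * k)"
      using Geq[of e k] by (simp add: G_def field_simps)
    moreover have "((norm e)\<^sup>2 / 2) ^ k = ((norm e)\<^sup>2 / 4) ^ k * 2 ^ k"
      by (simp add: power_mult_distrib[symmetric])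
    ultimately have "(A e k * Gamma (y k) * 2 powr (real DIM('a) / 2)) * 2 ^ k
        = (z0 * ((norm e)\<^sup>2 / 4) ^ k / fact k * fact (2 * k)) * 2 ^ k" by (simp add: mult_ac)
    then have "A e k * Gamma (y k) * 2 powr (real DIM('a) / 2) = z0 * ((norm e)\<^sup>2 / 4) ^ k / fact k * fact (2 * k)"
      by (subst (asm) mult_right_cancel) auto
    then show ?thesis using Gp by (simp add: c_def field_simps)
  qed
  note Ac = this[unfolded y_def]
  show ?thesis
  proof (rule that[of c])
    show "c > 0" using z0_pos by (simp add: c_def)
    fix e :: 'a and k and H :: "real \<Rightarrow> ennreal" assume "H \<in> borel_measurable borel"
    from A[OF this, of e k, unfolded y_def Ac] show "(\<integral>\<^sup>+x. H ((norm x)\<^sup>2) * ennreal ((e \<bullet> x) ^ (2 * k)) \<partial>lborel) =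
    ennreal (c * (fact (2 * k) * ((norm e)\<^sup>2 / 4) ^ k / (fact k * Gamma (real DIM('a) / 2 + real k)))) *
    (\<integral>\<^sup>+t. H t * ennreal (t powr (real DIM('a) / 2 + real k - 1)) * indicator {0<..} t \<partial>lborel)" .
  qed
qed

section \<open>Fourier transforms of radial functions\<close>

text \<open>Integrate the cosine series term by term; the hypothesis on m prescribes the radial moments of
  h. The constant C depends on the dimension only.\<close>

lemma fourier_radial_series:
  obtains C where "C > 0" "\<And>(\<xi> :: 'a::euclidean_space) h m. h \<in> borel_measurable borel \<Longrightarrow> (\<And>t. h t \<ge> 0) \<Longrightarrow>
     (\<And>k. m k \<ge> 0) \<Longrightarrow>
     (\<And>k. (\<integral>\<^sup>+t. ennreal (h t) * ennreal (t powr (real DIM('a) / 2 + real k - 1)) * indicator {0<..} t \<partial>lborel)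
        = ennreal (m k * Gamma (real DIM('a) / 2 + real k))) \<Longrightarrow>
     summable (\<lambda>k. m k * ((norm \<xi>)\<^sup>2 / 4) ^ k / fact k) \<Longrightarrow>
     integrable lborel (\<lambda>x::'a. h ((norm x)\<^sup>2)) \<and>
     (LINT x|lborel. h ((norm x)\<^sup>2) * cos (\<xi> \<bullet> x)) = C * (\<Sum>k. (- 1) ^ k * (m k * ((norm \<xi>)\<^sup>2 / 4) ^ k / fact k))"
proof -
  obtain c where c: "c > 0" and mom: "\<And>(e :: 'a) k H. H \<in> borel_measurable borel \<Longrightarrow>
    (\<integral>\<^sup>+x. H ((norm x)\<^sup>2) * ennreal ((e \<bullet> x) ^ (2 * k)) \<partial>lborel) =
    ennreal (c * (fact (2 * k) * ((norm e)\<^sup>2 / 4) ^ k / (fact k * Gamma (real DIM('a) / 2 + real k)))) *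
    (\<integral>\<^sup>+t. H t * ennreal (t powr (real DIM('a) / 2 + real k - 1)) * indicator {0<..} t \<partial>lborel)"
    by (rule radial_moment) blast
  show ?thesis
  proof (rule that[OF c])
    fix \<xi> :: 'a and h :: "real \<Rightarrow> real" and m :: "nat \<Rightarrow> real"
    assume h[measurable]: "h \<in> borel_measurable borel" and h0: "\<And>t. h t \<ge> 0" and m0: "\<And>k. m k \<ge> 0"
      and hm: "\<And>k. (\<integral>\<^sup>+t. ennreal (h t) * ennreal (t powr (real DIM('a) / 2 + real k - 1)) * indicator {0<..} t \<partial>lborel)
        = ennreal (m k * Gamma (real DIM('a) / 2 + real k))"
      and sm: "summable (\<lambda>k. m k * ((norm \<xi>)\<^sup>2 / 4) ^ k / fact k)"
    have G: "Gamma (real DIM('a) / 2 + real k) > 0" for k by (intro Gamma_real_pos add_pos_nonneg) auto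
    define b where "b k = c * (m k * ((norm \<xi>)\<^sup>2 / 4) ^ k / fact k)" for k
    have b0: "b k \<ge> 0" for k using c m0[of k] by (simp add: b_def)
    define f where "f k x = h ((norm x)\<^sup>2) * ((\<xi> \<bullet> x) ^ (2 * k) / fact (2 * k))" for k and x :: 'a
    have f0: "f k x \<ge> 0" for k x using h0 by (simp add: f_def)
    have [measurable]: "f k \<in> borel_measurable lborel" for k unfolding f_def by measurable
    have nn: "(\<integral>\<^sup>+x. ennreal (f k x) \<partial>lborel) = ennreal (b k)" for k
    proof -
      have "(\<integral>\<^sup>+x. ennreal (f k x) \<partial>lborel)
         = (\<integral>\<^sup>+x. ennreal (1 / fact (2 * k)) * (ennreal (h ((norm x)\<^sup>2)) * ennreal ((\<xi> \<bullet> x) ^ (2 * k))) \<partial>lborel)"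
        using h0 by (intro nn_integral_cong) (simp add: f_def ennreal_mult[symmetric])
      also have "\<dots> = ennreal (1 / fact (2 * k)) * (\<integral>\<^sup>+x. ennreal (h ((norm x)\<^sup>2)) * ennreal ((\<xi> \<bullet> x) ^ (2 * k)) \<partial>lborel)"
        by (rule nn_integral_cmult) measurable
      also have "\<dots> = ennreal (1 / fact (2 * k)) *
          (ennreal (c * (fact (2 * k) * ((norm \<xi>)\<^sup>2 / 4) ^ k / (fact k * Gamma (real DIM('a) / 2 + real k)))) *
           ennreal (m k * Gamma (real DIM('a) / 2 + real k)))"
        by (subst mom[of "\<lambda>t. ennreal (h t)"]) (simp_all only: hm, measurable)
      also have "\<dots> = ennreal (b k)"
      proof -
        have "c * (fact (2 * k) * ((norm \<xi>)\<^sup>2 / 4) ^ k / (fact k * Gamma (real DIM('a) / 2 + real k))) \<ge> 0"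
          using c G[of k] by simp
        moreover have "m k * Gamma (real DIM('a) / 2 + real k) \<ge> 0" using m0[of k] G[of k] by simp
        moreover have "1 / fact (2 * k) * ((c * (fact (2 * k) * ((norm \<xi>)\<^sup>2 / 4) ^ k / (fact k * Gamma (real DIM('a) / 2 + real k))))
            * (m k * Gamma (real DIM('a) / 2 + real k))) = b k"
          using G[of k] by (simp add: b_def)
        moreover have "ennreal (1 / F) * (ennreal p * ennreal q) = ennreal (1 / F * (p * q))"
          if "p \<ge> 0" "q \<ge> 0" "F > 0" for p q F :: real
        proof -
          have "ennreal (1 / F) * (ennreal p * ennreal q) = ennreal (1 / F) * ennreal (p * q)"
            using that by (simp only: ennreal_mult)
          also have "\<dots> = ennreal (1 / F * (p * q))" using that by (intro ennreal_mult[symmetric]) auto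
          finally show ?thesis .
        qed
        ultimately show ?thesis by (simp only: fact_gt_zero)
      qed
      finally show ?thesis .
    qed
    have int: "integrable lborel (f k)" "(LINT x|lborel. f k x) = b k" for k
      using nn_integral_eq_integrable[of "f k" lborel "b k"] nn b0 f0 by auto
    have "f 0 = (\<lambda>x. h ((norm x)\<^sup>2))" by (rule ext) (simp add: f_def)
    then have A: "integrable lborel (\<lambda>x::'a. h ((norm x)\<^sup>2))" using int(1)[of 0] by simp
    let ?g = "\<lambda>k x. (- 1) ^ k * f k x"
    have g: "(\<lambda>k. ?g k x) sums (h ((norm x)\<^sup>2) * cos (\<xi> \<bullet> x))" for x
    proof -
      have "(\<lambda>k. h ((norm x)\<^sup>2) * ((- 1) ^ k / fact (2 * k) * (\<xi> \<bullet> x) ^ (2 * k))) sums (h ((norm x)\<^sup>2) * cos (\<xi> \<bullet> x))"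
        by (intro sums_mult cos_paired)
      then show ?thesis by (simp add: f_def mult_ac)
    qed
    have "(\<lambda>k. LINT x|lborel. ?g k x) sums (LINT x|lborel. (\<Sum>k. ?g k x))"
    proof (rule sums_integral)
      show "integrable lborel (?g k)" for k using int(1) by simp
      show "AE x in lborel. summable (\<lambda>k. norm (?g k x))"
      proof (rule AE_I2)
        fix x :: 'a
        have "summable (\<lambda>k. h ((norm x)\<^sup>2) * ((\<xi> \<bullet> x) ^ (2 * k) / fact (2 * k)))"
          by (intro summable_mult sums_summable[OF cosh_paired])
        then show "summable (\<lambda>k. norm (?g k x))"
          using f0 by (simp add: abs_mult power_abs) (simp add: f_def)
      qed
      show "summable (\<lambda>k. LINT x|lborel. norm (?g k x))"
        using f0 summable_mult[OF sm, of c] by (simp add: abs_mult power_abs int b_def)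
    qed
    then have "(\<lambda>k. (- 1) ^ k * b k) sums (LINT x|lborel. h ((norm x)\<^sup>2) * cos (\<xi> \<bullet> x))"
      using g by (simp add: int sums_iff)
    then have "(LINT x|lborel. h ((norm x)\<^sup>2) * cos (\<xi> \<bullet> x)) = (\<Sum>k. (- 1) ^ k * b k)" by (simp add: sums_iff)
    also have "\<dots> = (\<Sum>k. c * ((- 1) ^ k * (m k * ((norm \<xi>)\<^sup>2 / 4) ^ k / fact k)))"
      by (simp add: b_def mult_ac)
    also have "\<dots> = c * (\<Sum>k. (- 1) ^ k * (m k * ((norm \<xi>)\<^sup>2 / 4) ^ k / fact k))"
    proof (rule suminf_mult)
      have "summable (\<lambda>k. norm ((- 1) ^ k * (m k * ((norm \<xi>)\<^sup>2 / 4) ^ k / fact k)))"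
        using sm m0 by (simp add: abs_mult power_abs)
      then show "summable (\<lambda>k. (- 1) ^ k * (m k * ((norm \<xi>)\<^sup>2 / 4) ^ k / fact k))"
        by (rule summable_norm_cancel)
    qed
    finally show "integrable lborel (\<lambda>x::'a. h ((norm x)\<^sup>2)) \<and>
       (LINT x|lborel. h ((norm x)\<^sup>2) * cos (\<xi> \<bullet> x)) = c * (\<Sum>k. (- 1) ^ k * (m k * ((norm \<xi>)\<^sup>2 / 4) ^ k / fact k))"
      using A by simp
  qed
qed

lemma fourier_gaussian:
  obtains C where "C > 0" "\<And>(\<xi> :: 'a::euclidean_space) \<epsilon>. \<epsilon> > 0 \<Longrightarrow>
     integrable lborel (\<lambda>x::'a. exp (- \<epsilon> * (norm x)\<^sup>2)) \<and>
     (LINT x|lborel. exp (- \<epsilon> * (norm x)\<^sup>2) * cos (\<xi> \<bullet> x)) = C / \<epsilon> powr (real DIM('a) / 2) * exp (- (norm \<xi>)\<^sup>2 / (4 * \<epsilon>))"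
proof -
  let ?n = "real DIM('a) / 2"
  obtain C where C: "C > 0" and ft: "\<And>(\<xi> :: 'a::euclidean_space) h m. h \<in> borel_measurable borel \<Longrightarrow> (\<And>t. h t \<ge> 0) \<Longrightarrow>
     (\<And>k. m k \<ge> 0) \<Longrightarrow>
     (\<And>k. (\<integral>\<^sup>+t. ennreal (h t) * ennreal (t powr (?n + real k - 1)) * indicator {0<..} t \<partial>lborel)
        = ennreal (m k * Gamma (?n + real k))) \<Longrightarrow>
     summable (\<lambda>k. m k * ((norm \<xi>)\<^sup>2 / 4) ^ k / fact k) \<Longrightarrow>
     integrable lborel (\<lambda>x::'a. h ((norm x)\<^sup>2)) \<and>
     (LINT x|lborel. h ((norm x)\<^sup>2) * cos (\<xi> \<bullet> x)) = C * (\<Sum>k. (- 1) ^ k * (m k * ((norm \<xi>)\<^sup>2 / 4) ^ k / fact k))"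
    by (rule fourier_radial_series) blast
  show ?thesis
  proof (rule that[OF C])
    fix \<xi> :: 'a and \<epsilon> :: real assume e: "\<epsilon> > 0"
    define m where "m k = 1 / \<epsilon> powr (?n + real k)" for k
    have y: "?n + real k > 0" for k by (simp add: add_pos_nonneg)
    have m: "m k * ((norm \<xi>)\<^sup>2 / 4) ^ k / fact k = 1 / \<epsilon> powr ?n * (((norm \<xi>)\<^sup>2 / (4 * \<epsilon>)) ^ k /\<^sub>R fact k)" for k
      by (simp only: m_def powr_add powr_realpow[OF e] power_mult_distrib divide_inverse
          inverse_mult_distrib power_inverse real_scaleR_def mult_1_left mult_ac)
    have sums: "(\<lambda>k. (- 1) ^ k * (m k * ((norm \<xi>)\<^sup>2 / 4) ^ k / fact k)) sums (1 / \<epsilon> powr ?n * exp (- (norm \<xi>)\<^sup>2 / (4 * \<epsilon>)))"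
    proof -
      have "(\<lambda>k. 1 / \<epsilon> powr ?n * ((- ((norm \<xi>)\<^sup>2 / (4 * \<epsilon>))) ^ k /\<^sub>R fact k)) sums (1 / \<epsilon> powr ?n * exp (- ((norm \<xi>)\<^sup>2 / (4 * \<epsilon>))))"
        by (intro sums_mult exp_converges)
      moreover have "(- 1) ^ k * (m k * ((norm \<xi>)\<^sup>2 / 4) ^ k / fact k) = 1 / \<epsilon> powr ?n * ((- ((norm \<xi>)\<^sup>2 / (4 * \<epsilon>))) ^ k /\<^sub>R fact k)" for k
        unfolding m power_minus[of "(norm \<xi>)\<^sup>2 / (4 * \<epsilon>)"] by simp
      ultimately show ?thesis by simp
    qed
    have "integrable lborel (\<lambda>x::'a. exp (- \<epsilon> * (norm x)\<^sup>2)) \<and>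
      (LINT x|lborel. exp (- \<epsilon> * (norm x)\<^sup>2) * cos (\<xi> \<bullet> x)) = C * (\<Sum>k. (- 1) ^ k * (m k * ((norm \<xi>)\<^sup>2 / 4) ^ k / fact k))"
    proof (rule ft)
      show "summable (\<lambda>k. m k * ((norm \<xi>)\<^sup>2 / 4) ^ k / fact k)"
        unfolding m by (intro summable_mult sums_summable[OF exp_converges])
      fix k
      show "(\<integral>\<^sup>+t. ennreal (exp (- \<epsilon> * t)) * ennreal (t powr (?n + real k - 1)) * indicator {0<..} t \<partial>lborel)
        = ennreal (m k * Gamma (?n + real k))"
        using nn_integral_gaussian_powr[OF e y[of k]] by (simp add: m_def)
    qed (auto simp: m_def)
    then show "integrable lborel (\<lambda>x::'a. exp (- \<epsilon> * (norm x)\<^sup>2)) \<and>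
     (LINT x|lborel. exp (- \<epsilon> * (norm x)\<^sup>2) * cos (\<xi> \<bullet> x)) = C / \<epsilon> powr ?n * exp (- (norm \<xi>)\<^sup>2 / (4 * \<epsilon>))"
      using sums by (simp add: sums_iff)
  qed
qed

lemma pos_powr_nonneg [simp]: "pos_powr s p \<ge> 0"
  by (simp add: pos_powr_def)

lemma borel_measurable_pos_powr [measurable]:
  assumes [measurable]: "f \<in> borel_measurable M"
  shows "(\<lambda>x. pos_powr (f x) p) \<in> borel_measurable M"
  unfolding pos_powr_def by measurable

lemma nn_integral_truncated_power:
  assumes la: "la > -1" and t: "t > 0" and y: "y > 0"
  shows "(\<integral>\<^sup>+s. ennreal (pos_powr (1 - s / t) la) * ennreal (s powr (y - 1)) * indicator {0<..} s \<partial>lborel)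
    = ennreal (t powr y * Gamma (la + 1) / Gamma (y + la + 1) * Gamma y)"
proof -
  have "(\<integral>\<^sup>+s. ennreal (pos_powr (1 - s / t) la) * ennreal (s powr (y - 1)) * indicator {0<..} s \<partial>lborel)
    = ennreal t * (\<integral>\<^sup>+s. ennreal (pos_powr (1 - (t * s) / t) la) * ennreal ((t * s) powr (y - 1)) * indicator {0<..} (t * s) \<partial>lborel)"
    using t by (subst nn_integral_real_affine[of _ t 0]) auto
  also have "(\<integral>\<^sup>+s. ennreal (pos_powr (1 - (t * s) / t) la) * ennreal ((t * s) powr (y - 1)) * indicator {0<..} (t * s) \<partial>lborel)
    = (\<integral>\<^sup>+s. ennreal (t powr (y - 1)) * (ennreal (s powr (y - 1) * (1 - s) powr (la + 1 - 1)) * indicator {0..1} s) \<partial>lborel)"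
  proof (intro nn_integral_cong)
    fix s :: real
    consider "s \<le> 0" | "0 < s" "s < 1" | "s \<ge> 1" by linarith
    then show "ennreal (pos_powr (1 - (t * s) / t) la) * ennreal ((t * s) powr (y - 1)) * indicator {0<..} (t * s)
      = ennreal (t powr (y - 1)) * (ennreal (s powr (y - 1) * (1 - s) powr (la + 1 - 1)) * indicator {0..1} s)"
    proof cases
      case 1
      then show ?thesis using t by (auto simp: indicator_def zero_less_mult_iff)
    next
      case 2
      then show ?thesis using t
        by (simp add: pos_powr_def powr_mult ennreal_mult[symmetric] mult_ac)
    next
      case 3
      then show ?thesis using t by (auto simp: pos_powr_def indicator_def)
    qed
  qed
  also have "\<dots> = ennreal (t powr (y - 1)) * (\<integral>\<^sup>+s. ennreal (s powr (y - 1) * (1 - s) powr (la + 1 - 1)) * indicator {0..1} s \<partial>lborel)"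
    by (rule nn_integral_cmult) measurable
  also have "(\<integral>\<^sup>+s. ennreal (s powr (y - 1) * (1 - s) powr (la + 1 - 1)) * indicator {0..1} s \<partial>lborel) = ennreal (Beta y (la + 1))"
    by (rule nn_integral_has_integral_lebesgue'[OF _ has_integral_Beta_real]) (use la y in auto)
  also have "ennreal t * (ennreal (t powr (y - 1)) * ennreal (Beta y (la + 1)))
    = ennreal (t * (t powr (y - 1) * Beta y (la + 1)))"
  proof -
    have "Beta y (la + 1) \<ge> 0" using la y by (simp add: Beta_def Gamma_real_pos less_imp_le)
    then show ?thesis using t by (simp add: ennreal_mult)
  qed
  also have "t * (t powr (y - 1) * Beta y (la + 1)) = t powr y * Gamma (la + 1) / Gamma (y + la + 1) * Gamma y"
    using t by (simp add: Beta_def powr_diff add.assoc)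
  finally show ?thesis .
qed

text \<open>For t = 1 this is the classical formula: the transform of (1 - |x|^2)_+^\<lambda> is a multiple of
  |\<xi>|^(-\<nu>) J_\<nu>(|\<xi>|) with \<nu> = n/2 + \<lambda>.\<close>

lemma fourier_truncated_power:
  assumes la: "la > -1"
  obtains C where "C > 0" "\<And>(\<xi> :: 'a::euclidean_space) t. t > 0 \<Longrightarrow>
     integrable lborel (\<lambda>x::'a. pos_powr (1 - (norm x)\<^sup>2 / t) la) \<and>
     (LINT x|lborel. pos_powr (1 - (norm x)\<^sup>2 / t) la * cos (\<xi> \<bullet> x))
        = C * t powr (real DIM('a) / 2) * bess (real DIM('a) / 2 + la) (t * (norm \<xi>)\<^sup>2)"
proof -
  let ?n = "real DIM('a) / 2"
  obtain C where C: "C > 0" and ft: "\<And>(\<xi> :: 'a::euclidean_space) h m. h \<in> borel_measurable borel \<Longrightarrow> (\<And>t. h t \<ge> 0) \<Longrightarrow>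
     (\<And>k. m k \<ge> 0) \<Longrightarrow>
     (\<And>k. (\<integral>\<^sup>+t. ennreal (h t) * ennreal (t powr (?n + real k - 1)) * indicator {0<..} t \<partial>lborel)
        = ennreal (m k * Gamma (?n + real k))) \<Longrightarrow>
     summable (\<lambda>k. m k * ((norm \<xi>)\<^sup>2 / 4) ^ k / fact k) \<Longrightarrow>
     integrable lborel (\<lambda>x::'a. h ((norm x)\<^sup>2)) \<and>
     (LINT x|lborel. h ((norm x)\<^sup>2) * cos (\<xi> \<bullet> x)) = C * (\<Sum>k. (- 1) ^ k * (m k * ((norm \<xi>)\<^sup>2 / 4) ^ k / fact k))"
    by (rule fourier_radial_series) blast
  have Gla: "Gamma (la + 1) > 0" using la by (intro Gamma_real_pos) auto
  have nu: "?n + la > -1" using la by (simp add: add.commute add_strict_increasing2)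
  show ?thesis
  proof (rule that[of "C * Gamma (la + 1)"])
    show "C * Gamma (la + 1) > 0" using C Gla by simp
    fix \<xi> :: 'a and t :: real assume t: "t > 0"
    define m where "m k = t powr (?n + real k) * Gamma (la + 1) / Gamma (?n + real k + la + 1)" for k
    have y: "?n + real k > 0" for k by (simp add: add_pos_nonneg)
    have G: "Gamma (?n + real k + la + 1) > 0" for k using y[of k] la by (intro Gamma_real_pos) auto
    have m: "(- 1) ^ k * (m k * ((norm \<xi>)\<^sup>2 / 4) ^ k / fact k)
        = Gamma (la + 1) * t powr ?n * (bess_coeff (?n + la) k * (t * (norm \<xi>)\<^sup>2) ^ k)" for k
    proof -
      have "((norm \<xi>)\<^sup>2 / 4) ^ k = (1 / 4) ^ k * ((norm \<xi>)\<^sup>2) ^ k" by (simp add: power_divide)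
      moreover have "(- 1 / 4) ^ k = (- 1) ^ k * (1 / 4 :: real) ^ k" by (simp add: power_mult_distrib[symmetric])
      moreover have "?n + real k + la + 1 = ?n + la + 1 + real k" by simp
      ultimately show ?thesis
        using t by (simp only: m_def bess_coeff_def powr_add powr_realpow power_mult_distrib)
          (simp only: divide_inverse inverse_mult_distrib mult_ac)
    qed
    have sum: "(\<Sum>k. (- 1) ^ k * (m k * ((norm \<xi>)\<^sup>2 / 4) ^ k / fact k))
        = Gamma (la + 1) * t powr ?n * bess (?n + la) (t * (norm \<xi>)\<^sup>2)"
      unfolding m bess_def by (intro suminf_mult summable_bess nu)
    have "integrable lborel (\<lambda>x::'a. pos_powr (1 - (norm x)\<^sup>2 / t) la) \<and>
     (LINT x|lborel. pos_powr (1 - (norm x)\<^sup>2 / t) la * cos (\<xi> \<bullet> x))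
        = C * (\<Sum>k. (- 1) ^ k * (m k * ((norm \<xi>)\<^sup>2 / 4) ^ k / fact k))"
    proof (rule ft)
      show "summable (\<lambda>k. m k * ((norm \<xi>)\<^sup>2 / 4) ^ k / fact k)"
      proof -
        have "m k * ((norm \<xi>)\<^sup>2 / 4) ^ k / fact k
           = Gamma (la + 1) * t powr ?n * (bess_coeff (?n + la) k * (- (t * (norm \<xi>)\<^sup>2)) ^ k)" for k
        proof -
          have "m k * ((norm \<xi>)\<^sup>2 / 4) ^ k / fact k = (- 1) ^ k * ((- 1) ^ k * (m k * ((norm \<xi>)\<^sup>2 / 4) ^ k / fact k))"
            by (simp add: power_mult_distrib[symmetric] mult.assoc[symmetric])
          then show ?thesis unfolding m power_minus[of "t * (norm \<xi>)\<^sup>2"] by simp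
        qed
        then show ?thesis by (simp only:) (intro summable_mult summable_bess nu)
      qed
      show "m k \<ge> 0" for k using t G[of k] Gla by (simp add: m_def)
      show "(\<integral>\<^sup>+s. ennreal (pos_powr (1 - s / t) la) * ennreal (s powr (?n + real k - 1)) * indicator {0<..} s \<partial>lborel)
        = ennreal (m k * Gamma (?n + real k))" for k
        using nn_integral_truncated_power[OF la t y[of k]] by (simp add: m_def)
    qed (auto simp: m_def)
    then show "integrable lborel (\<lambda>x::'a. pos_powr (1 - (norm x)\<^sup>2 / t) la) \<and>
     (LINT x|lborel. pos_powr (1 - (norm x)\<^sup>2 / t) la * cos (\<xi> \<bullet> x))
        = C * Gamma (la + 1) * t powr ?n * bess (?n + la) (t * (norm \<xi>)\<^sup>2)"
      unfolding sum by (simp add: mult.assoc)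
  qed
qed

section \<open>Decreasing weights\<close>

lemma fubini_lborel:
  fixes f :: "'a::euclidean_space \<Rightarrow> 'b::euclidean_space \<Rightarrow> real"
  assumes [measurable]: "(\<lambda>(x, y). f x y) \<in> borel_measurable (lborel \<Otimes>\<^sub>M lborel)"
    and fin: "(\<integral>\<^sup>+y. \<integral>\<^sup>+x. ennreal \<bar>f x y\<bar> \<partial>lborel \<partial>lborel) < \<infinity>"
  shows "(LINT x|lborel. LINT y|lborel. f x y) = (LINT y|lborel. LINT x|lborel. f x y)"
proof -
  have "(\<integral>\<^sup>+y. \<integral>\<^sup>+x. ennreal (norm (f x y)) \<partial>lborel \<partial>lborel)
      = (\<integral>\<^sup>+p. ennreal (norm (case_prod f p)) \<partial>(lborel \<Otimes>\<^sub>M lborel))"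
    by (subst lborel_pair.nn_integral_snd[symmetric]) (auto simp: case_prod_beta)
  then have "integrable (lborel \<Otimes>\<^sub>M lborel) (case_prod f)"
    using fin by (intro integrableI_bounded) auto
  then show ?thesis by (rule lborel_pair.Fubini_integral[symmetric])
qed

lemma initial_segment_AE:
  fixes S :: "real set"
  assumes "\<And>u. u \<in> S \<Longrightarrow> 0 < u \<and> u < b" "\<And>t u. u \<in> S \<Longrightarrow> 0 < t \<Longrightarrow> t < u \<Longrightarrow> t \<in> S"
  obtains \<tau> where "\<tau> \<ge> 0" "\<And>t. t \<noteq> \<tau> \<Longrightarrow> t \<in> S \<longleftrightarrow> 0 < t \<and> t < \<tau>"
proof (cases "S = {}")
  case True
  then show ?thesis by (intro that[of 0]) auto
next
  case False
  then obtain u0 where u0: "u0 \<in> S" by auto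
  have bdd: "bdd_above S" using assms(1) by (intro bdd_aboveI[of _ b]) (auto intro: less_imp_le)
  show ?thesis
  proof (rule that[of "Sup S"])
    show "Sup S \<ge> 0" using cSup_upper[OF u0 bdd] assms(1)[OF u0] by linarith
    fix t assume t: "t \<noteq> Sup S"
    show "t \<in> S \<longleftrightarrow> 0 < t \<and> t < Sup S"
    proof
      assume "t \<in> S"
      then show "0 < t \<and> t < Sup S" using cSup_upper[OF _ bdd, of t] t assms(1)[of t] by auto
    next
      assume "0 < t \<and> t < Sup S"
      then obtain u where "u \<in> S" "t < u" using less_cSup_iff[OF False bdd] by auto
      then show "t \<in> S" using assms(2) \<open>0 < t \<and> t < Sup S\<close> by blast
    qed
  qed
qed

text \<open>Slicing: w(t) is the length of {s. 0 < s < w(t)}, so the integral of p w is an integral over s of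
  the integrals of p over the sets {t. s < w(t)}, which are initial intervals.\<close>

lemma integral_antimono_weight_nonneg:
  fixes p w :: "real \<Rightarrow> real"
  assumes [measurable]: "p \<in> borel_measurable borel" "w \<in> borel_measurable borel"
    and w0: "\<And>t. w t \<ge> 0" and supp: "\<And>t. t \<le> 0 \<or> t \<ge> b \<Longrightarrow> w t = 0"
    and anti: "\<And>t u. 0 < t \<Longrightarrow> t < u \<Longrightarrow> w u \<le> w t"
    and fin: "integrable lborel (\<lambda>t. p t * w t)"
    and p: "\<And>\<tau>. \<tau> \<ge> 0 \<Longrightarrow> (LINT t|lborel. p t * indicator {0<..<\<tau>} t) \<ge> 0"
  shows "(LINT t|lborel. p t * w t) \<ge> 0"
proof -
  let ?f = "\<lambda>s t. p t * indicator {0<..<w t} s :: real"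
  have len: "measure lborel {0<..<w t} = w t" for t
    using w0[of t] by (simp add: measure_def)
  have "(LINT t|lborel. p t * w t) = (LINT t|lborel. LINT s|lborel. ?f s t)"
    by (simp add: len)
  also have "\<dots> = (LINT s|lborel. LINT t|lborel. ?f s t)"
  proof (rule fubini_lborel[symmetric])
    have "(\<lambda>(s, t). p t * (if 0 < s \<and> s < w t then 1 else 0)) \<in> borel_measurable (lborel \<Otimes>\<^sub>M lborel)"
      by measurable
    then show "(\<lambda>(s, t). ?f s t) \<in> borel_measurable (lborel \<Otimes>\<^sub>M lborel)"
      by (simp add: indicator_def of_bool_def)
    have "(\<integral>\<^sup>+s. ennreal \<bar>?f s t\<bar> \<partial>lborel) = ennreal (norm (p t * w t))" for t
    proof -
      have "(\<integral>\<^sup>+s. ennreal \<bar>?f s t\<bar> \<partial>lborel) = (\<integral>\<^sup>+s. ennreal \<bar>p t\<bar> * indicator {0<..<w t} s \<partial>lborel)"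
        by (intro nn_integral_cong) (simp add: indicator_def)
      then show ?thesis using w0[of t] by (simp add: nn_integral_cmult_indicator ennreal_mult[symmetric] abs_mult)
    qed
    then show "(\<integral>\<^sup>+t. \<integral>\<^sup>+s. ennreal \<bar>?f s t\<bar> \<partial>lborel \<partial>lborel) < \<infinity>"
      using fin by (simp add: integrable_iff_bounded)
  qed
  also have "\<dots> \<ge> 0"
  proof (rule Bochner_Integration.integral_nonneg)
    fix s :: real
    show "0 \<le> (LINT t|lborel. ?f s t)"
    proof (cases "s > 0")
      case True
      define S where "S = {t. s < w t}"
      have S1: "0 < u \<and> u < b" if "u \<in> S" for u
      proof -
        have "w u \<noteq> 0" using True that by (auto simp: S_def)
        then show ?thesis using supp[of u] by (meson not_le)
      qed
      have S2: "t \<in> S" if "u \<in> S" "0 < t" "t < u" for t u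
        using anti[of t u] that by (auto simp: S_def)
      obtain \<tau> where \<tau>: "\<tau> \<ge> 0" "\<And>t. t \<noteq> \<tau> \<Longrightarrow> t \<in> S \<longleftrightarrow> 0 < t \<and> t < \<tau>"
        by (rule initial_segment_AE[OF S1 S2]) blast+
      have "(LINT t|lborel. ?f s t) = (LINT t|lborel. p t * indicator {0<..<\<tau>} t)"
      proof (rule integral_cong_AE)
        show "AE t in lborel. ?f s t = p t * indicator {0<..<\<tau>} t"
        proof (rule eventually_mono[OF AE_lborel_singleton[of \<tau>]])
          fix t assume "t \<noteq> \<tau>"
          then have "s < w t \<longleftrightarrow> 0 < t \<and> t < \<tau>" using \<tau>(2)[of t] by (simp add: S_def)
          then show "?f s t = p t * indicator {0<..<\<tau>} t" using True by (simp add: indicator_def)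
        qed
        have "(\<lambda>t. p t * (if 0 < s \<and> s < w t then 1 else 0)) \<in> borel_measurable lborel" by measurable
        then show "(\<lambda>t. ?f s t) \<in> borel_measurable lborel" by (simp add: indicator_def of_bool_def)
      qed measurable
      then show ?thesis using p[OF \<tau>(1)] by simp
    qed (simp add: indicator_def)
  qed
  finally show ?thesis .
qed

text \<open>Substitute y = t R in bess_int_nonneg.\<close>

lemma integral_powr_bess_nonneg:
  assumes nu: "nu > - 1 / 2" and k: "k0 = (max 0 (min nu (1 / 2)) + nu - 1) / 2"
    and R: "R \<ge> 0" and \<tau>: "\<tau> \<ge> 0"
  shows "(LINT t|lborel. t powr k0 * bess nu (t * R) * indicator {0<..<\<tau>} t) \<ge> 0"
proof (cases "R = 0")
  case True
  have "bess nu 0 > 0" using nu by (intro bess_0_pos) auto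
  then show ?thesis using True by (intro Bochner_Integration.integral_nonneg) (auto simp: indicator_def)
next
  case False
  then have R: "R > 0" using R by simp
  have nu1: "nu > -1" "nu \<ge> - 1 / 2" using nu by auto
  have k0: "k0 > -1" using nu k by (auto simp: max_def min_def split: if_splits)
  let ?h = "\<lambda>y. y powr k0 * bess nu y"
  have [measurable]: "bess nu \<in> borel_measurable borel"
    using nu1 by (intro borel_measurable_bess) auto
  have "integrable lebesgue (\<lambda>y. indicator {0..\<tau> * R} y *\<^sub>R ?h y)"
    using powr_bess_absolutely_integrable[OF k0 nu1(2), of "\<tau> * R"] by (simp add: set_integrable_def)
  then have "integrable lborel (\<lambda>y. indicator {0..\<tau> * R} y *\<^sub>R ?h y)"
    by (subst (asm) integrable_completion) auto
  then have "set_integrable lborel {0..\<tau> * R} ?h" by (simp add: set_integrable_def)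
  then have eq: "(LINT y:{0..\<tau> * R}|lborel. ?h y) = bess_int k0 nu (\<tau> * R)"
    unfolding bess_int_def by (rule set_borel_integral_eq_integral)
  have "(LINT y:{0..\<tau> * R}|lborel. ?h y) = (LINT y|lborel. ?h y * indicator {0<..<\<tau> * R} y)"
    unfolding set_lebesgue_integral_def
    by (rule integral_cong_AE, simp, simp, rule eventually_mono[OF AE_lborel_singleton[of "\<tau> * R"]])
       (auto simp: indicator_def)
  also have "\<dots> = R * (LINT t|lborel. ?h (R * t) * indicator {0<..<\<tau> * R} (R * t))"
    using R by (subst lborel_integral_real_affine[of R _ 0]) auto
  also have "(LINT t|lborel. ?h (R * t) * indicator {0<..<\<tau> * R} (R * t))
     = (LINT t|lborel. R powr k0 * (t powr k0 * bess nu (t * R) * indicator {0<..<\<tau>} t))"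
  proof (rule Bochner_Integration.integral_cong[OF refl])
    fix t
    have "R * t \<in> {0<..<\<tau> * R} \<longleftrightarrow> t \<in> {0<..<\<tau>}" using R by (simp add: zero_less_mult_iff mult.commute)
    moreover have "(R * t) powr k0 = R powr k0 * t powr k0" if "t > 0" using that R by (simp add: powr_mult)
    ultimately show "?h (R * t) * indicator {0<..<\<tau> * R} (R * t)
        = R powr k0 * (t powr k0 * bess nu (t * R) * indicator {0<..<\<tau>} t)"
      by (auto simp: indicator_def mult.commute)
  qed
  finally have "bess_int k0 nu (\<tau> * R) = R * R powr k0 * (LINT t|lborel. t powr k0 * bess nu (t * R) * indicator {0<..<\<tau>} t)"
    using eq by simp
  moreover have "bess_int k0 nu (\<tau> * R) \<ge> 0"
    using R \<tau> by (intro bess_int_nonneg[OF nu k]) auto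
  moreover have "R * R powr k0 > 0" using R by simp
  ultimately show ?thesis using mult_pos_neg[of "R * R powr k0"] by (metis not_le)
qed

definition cutoff :: "real \<Rightarrow> real \<Rightarrow> real \<Rightarrow> real" where
  "cutoff de rh t = pos_powr (1 - t powr de) rh"

lemma cutoff_nonneg [simp]: "cutoff de rh t \<ge> 0"
  by (simp add: cutoff_def)

lemma borel_measurable_cutoff [measurable]: "cutoff de rh \<in> borel_measurable borel"
  unfolding cutoff_def[abs_def] by measurable

lemma cutoff_eq_0: "de > 0 \<Longrightarrow> t \<ge> 1 \<Longrightarrow> cutoff de rh t = 0"
  using ge_one_powr_ge_zero[of t de] by (simp add: cutoff_def pos_powr_def)

lemma cutoff_antimono:
  assumes "de > 0" "rh \<ge> 0" "0 < t" "t \<le> u"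
  shows "cutoff de rh u \<le> cutoff de rh t"
proof -
  have "t powr de \<le> u powr de" using assms by (intro powr_mono2) auto
  then show ?thesis using assms by (auto simp: cutoff_def pos_powr_def intro!: powr_mono2)
qed

lemma cutoff_le_1: "rh \<ge> 0 \<Longrightarrow> t \<ge> 0 \<Longrightarrow> cutoff de rh t \<le> 1"
  using powr_mono2[of rh "1 - t powr de" 1] by (simp add: cutoff_def pos_powr_def)

lemma cutoff_pos: "de > 0 \<Longrightarrow> 0 \<le> t \<Longrightarrow> t < 1 \<Longrightarrow> cutoff de rh t > 0"
  using powr_less_mono2[of de t 1] by (simp add: cutoff_def pos_powr_def)

lemma weighted_bess_integrable:
  assumes "de > 0" "rh \<ge> 0" "ka > -1" "nu \<ge> - 1 / 2" "R \<ge> 0"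
  shows "integrable lborel (\<lambda>t. t powr ka * cutoff de rh t * indicator {0<..} t * bess nu (t * R))"
proof (rule Bochner_Integration.integrable_bound)
  have "(\<integral>\<^sup>+t. ennreal (t powr ka) * indicator {0<..<1} t \<partial>lborel) < \<infinity>"
    using assms by (subst nn_integral_powr_from_0) auto
  also have "(\<lambda>t. ennreal (t powr ka) * indicator {0<..<1} t) = (\<lambda>t. ennreal (norm (t powr ka * indicator {0<..<1} t)))"
    by (auto simp: indicator_def)
  finally have "integrable lborel (\<lambda>t. t powr ka * indicator {0<..<1::real} t)"
    by (intro integrableI_bounded) auto
  then show "integrable lborel (\<lambda>t. bess nu 0 * (t powr ka * indicator {0<..<1::real} t))" by simp
  have [measurable]: "bess nu \<in> borel_measurable borel"
    using assms by (intro borel_measurable_bess) auto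
  show "(\<lambda>t. t powr ka * cutoff de rh t * indicator {0<..} t * bess nu (t * R)) \<in> borel_measurable lborel"
    by measurable
  have b0: "bess nu 0 > 0" using assms by (intro bess_0_pos) auto
  show "AE t in lborel. norm (t powr ka * cutoff de rh t * indicator {0<..} t * bess nu (t * R))
      \<le> norm (bess nu 0 * (t powr ka * indicator {0<..<1::real} t))"
  proof (rule AE_I2)
    fix t :: real
    consider "t \<le> 0 \<or> t \<ge> 1" | "0 < t" "t < 1" by linarith
    then show "norm (t powr ka * cutoff de rh t * indicator {0<..} t * bess nu (t * R))
      \<le> norm (bess nu 0 * (t powr ka * indicator {0<..<1::real} t))"
    proof cases
      case 1
      then show ?thesis using cutoff_eq_0[OF assms(1), of t rh] by (auto simp: indicator_def)
    next
      case 2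
      have "\<bar>bess nu (t * R)\<bar> \<le> bess nu 0" using 2 assms by (intro abs_bess_le) auto
      moreover have "cutoff de rh t \<le> 1" using 2 assms by (intro cutoff_le_1) auto
      ultimately have "cutoff de rh t * \<bar>bess nu (t * R)\<bar> \<le> 1 * bess nu 0"
        by (intro mult_mono) auto
      then have "t powr ka * (cutoff de rh t * \<bar>bess nu (t * R)\<bar>) \<le> t powr ka * bess nu 0"
        by (intro mult_left_mono) auto
      then show ?thesis using 2 b0 by (simp add: abs_mult mult_ac)
    qed
  qed
qed

text \<open>The factor t^(ka - k0) with ka \<le> k0 joins the cutoff in a single nonincreasing weight.\<close>

lemma weighted_bess_integral_nonneg:
  assumes de: "de > 0" and rh: "rh \<ge> 0" and ka: "ka > -1" and nu: "nu > - 1 / 2"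
    and le: "ka \<le> (max 0 (min nu (1 / 2)) + nu - 1) / 2" and R: "R \<ge> 0"
  shows "(LINT t|lborel. t powr ka * cutoff de rh t * indicator {0<..} t * bess nu (t * R)) \<ge> 0"
proof -
  define k0 where "k0 = (max 0 (min nu (1 / 2)) + nu - 1) / 2"
  define w where "w t = t powr (ka - k0) * cutoff de rh t * indicator {0<..} t" for t :: real
  have eq: "t powr ka * cutoff de rh t * indicator {0<..} t * bess nu (t * R)
      = (t powr k0 * bess nu (t * R)) * w t" for t
  proof -
    have "t powr ka = t powr k0 * t powr (ka - k0)" by (simp add: powr_add[symmetric])
    then show ?thesis by (simp add: w_def)
  qed
  have [measurable]: "bess nu \<in> borel_measurable borel"
    using nu by (intro borel_measurable_bess) auto
  show ?thesis unfolding eq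
  proof (rule integral_antimono_weight_nonneg[where b = 1])
    show "w \<in> borel_measurable borel" unfolding w_def[abs_def] by measurable
    show "w t \<ge> 0" for t by (simp add: w_def)
    show "w t = 0" if "t \<le> 0 \<or> t \<ge> 1" for t
      using that cutoff_eq_0[OF de, of t rh] by (auto simp: w_def indicator_def)
    show "w u \<le> w t" if t: "0 < t" "t < u" for t u
    proof -
      have "u powr (ka - k0) \<le> t powr (ka - k0)"
        using t le by (intro powr_mono2') (auto simp: k0_def)
      moreover have "cutoff de rh u \<le> cutoff de rh t" using t by (intro cutoff_antimono de rh) auto
      ultimately show ?thesis using t by (simp add: w_def mult_mono)
    qed
    show "integrable lborel (\<lambda>t. (t powr k0 * bess nu (t * R)) * w t)"
      unfolding eq[symmetric] using nu by (intro weighted_bess_integrable de rh ka R) auto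
    show "(LINT t|lborel. t powr k0 * bess nu (t * R) * indicator {0<..<\<tau>} t) \<ge> 0" if "\<tau> \<ge> 0" for \<tau>
      by (rule integral_powr_bess_nonneg[OF nu k0_def R that])
  qed measurable
qed

section \<open>The function W\<close>

lemma W_fun_cutoff:
  "W_fun la al de rh x = (\<integral>\<^sup>+t. ennreal (pos_powr (1 - (norm x)\<^sup>2 / t) la * t powr al * cutoff de rh t * indicator {0<..} t) \<partial>lborel)"
  unfolding W_fun_def cutoff_def by (intro nn_integral_cong) (simp add: indicator_def)

lemma borel_measurable_W_fun [measurable]: "W_fun la al de rh \<in> borel_measurable borel"
  unfolding W_fun_cutoff[abs_def] by measurable

text \<open>The integrand of W after the substitution t = r + v with r = |x|^2, in which
  (1 - r/t)^\<lambda> t^\<alpha> = v^\<lambda> (r + v)^(\<alpha> - \<lambda>). The singular factor no longer depends on r, and since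
  \<alpha> \<le> \<lambda> the rest decreases in r.\<close>

definition W_profile :: "real \<Rightarrow> real \<Rightarrow> real \<Rightarrow> real \<Rightarrow> real \<Rightarrow> real \<Rightarrow> real" where
  "W_profile la al de rh r v = v powr la * (r + v) powr (al - la) * cutoff de rh (r + v) * indicator {0<..} v"

lemma borel_measurable_W_profile [measurable]: "W_profile la al de rh r \<in> borel_measurable borel"
  unfolding W_profile_def[abs_def] by measurable

lemma W_fun_profile: "W_fun la al de rh x = (\<integral>\<^sup>+v. ennreal (W_profile la al de rh ((norm x)\<^sup>2) v) \<partial>lborel)"
proof -
  let ?r = "(norm x)\<^sup>2"
  let ?g = "\<lambda>t. pos_powr (1 - ?r / t) la * t powr al * cutoff de rh t * indicator {0<..} t"
  have eq: "?g (?r + v) = W_profile la al de rh ?r v" for v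
  proof -
    consider "v \<le> 0" "?r + v > 0" | "?r + v \<le> 0" | "v > 0" "?r + v > 0" by linarith
    then show ?thesis
    proof cases
      case 1
      then have "\<not> 1 - ?r / (?r + v) > 0" by (simp add: field_simps)
      then show ?thesis using 1 by (simp add: pos_powr_def W_profile_def)
    next
      case 2
      then have "v \<le> 0" using zero_le_power2[of "norm x"] by linarith
      then show ?thesis using 2 by (simp add: W_profile_def)
    next
      case 3
      have "1 - ?r / (?r + v) = v / (?r + v)" using 3 by (simp add: field_simps)
      then show ?thesis using 3 by (simp add: pos_powr_def W_profile_def powr_divide powr_diff)
    qed
  qed
  have "W_fun la al de rh x = ennreal \<bar>1\<bar> * (\<integral>\<^sup>+v. ennreal (?g (?r + 1 * v)) \<partial>lborel)"
    unfolding W_fun_cutoff by (rule nn_integral_real_affine) auto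
  also have "\<dots> = (\<integral>\<^sup>+v. ennreal (?g (?r + v)) \<partial>lborel)" by simp
  also have "\<dots> = (\<integral>\<^sup>+v. ennreal (W_profile la al de rh ?r v) \<partial>lborel)"
    by (simp only: eq)
  finally show ?thesis .
qed

lemma W_profile_nonneg [simp]: "W_profile la al de rh r v \<ge> 0"
  by (simp add: W_profile_def)

lemma W_profile_antimono:
  assumes "de > 0" "rh \<ge> 0" "al \<le> la" "0 \<le> r" "r \<le> s"
  shows "W_profile la al de rh s v \<le> W_profile la al de rh r v"
proof (cases "v > 0")
  case True
  have "(s + v) powr (al - la) \<le> (r + v) powr (al - la)" using True assms by (intro powr_mono2') auto
  moreover have "cutoff de rh (s + v) \<le> cutoff de rh (r + v)" using True assms by (intro cutoff_antimono) auto
  ultimately have "(s + v) powr (al - la) * cutoff de rh (s + v) \<le> (r + v) powr (al - la) * cutoff de rh (r + v)"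
    by (intro mult_mono) auto
  then show ?thesis using True by (simp add: W_profile_def mult.assoc mult_left_mono)
qed (simp add: W_profile_def)

lemma W_profile_tendsto:
  assumes de: "de > 0" and rs: "\<And>i. rs i \<ge> 0" "rs \<longlonglongrightarrow> r" and v: "v \<noteq> 1 - r"
  shows "(\<lambda>i. W_profile la al de rh (rs i) v) \<longlonglongrightarrow> W_profile la al de rh r v"
proof (cases "v > 0")
  case True
  have r: "r \<ge> 0" using rs LIMSEQ_le_const by blast
  have lim: "(\<lambda>i. rs i + v) \<longlonglongrightarrow> r + v" using rs(2) by (intro tendsto_intros)
  \<comment> \<open>For \<rho> = 0 the cutoff jumps at 1; the hypothesis on v avoids this point.\<close>
  have "(\<lambda>i. cutoff de rh (rs i + v)) \<longlonglongrightarrow> cutoff de rh (r + v)"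
  proof (cases "r + v < 1")
    case lt: True
    have pos: "1 - (r + v) powr de > 0" using powr_less_mono2[of de "r + v" 1] de r True lt by simp
    have l: "(\<lambda>i. 1 - (rs i + v) powr de) \<longlonglongrightarrow> 1 - (r + v) powr de"
      by (intro tendsto_diff tendsto_const tendsto_powr lim) (use r True in auto)
    have "(\<lambda>i. (1 - (rs i + v) powr de) powr rh) \<longlonglongrightarrow> (1 - (r + v) powr de) powr rh"
      by (intro tendsto_powr l tendsto_const) (use pos in auto)
    moreover have "\<forall>\<^sub>F i in sequentially. (1 - (rs i + v) powr de) powr rh = cutoff de rh (rs i + v)"
      using order_tendstoD(1)[OF l pos] by (rule eventually_mono) (simp add: cutoff_def pos_powr_def)
    ultimately have "(\<lambda>i. cutoff de rh (rs i + v)) \<longlonglongrightarrow> (1 - (r + v) powr de) powr rh"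
      by (rule Lim_transform_eventually)
    then show ?thesis using pos by (simp add: cutoff_def pos_powr_def)
  next
    case False
    then have gt: "r + v > 1" using v by linarith
    have "\<forall>\<^sub>F i in sequentially. 0 = cutoff de rh (rs i + v)"
      using order_tendstoD(1)[OF lim gt] by (rule eventually_mono) (simp add: cutoff_eq_0[OF de])
    then have "(\<lambda>i. cutoff de rh (rs i + v)) \<longlonglongrightarrow> 0"
      using tendsto_const by (rule Lim_transform_eventually[rotated])
    then show ?thesis using gt by (simp add: cutoff_eq_0[OF de])
  qed
  moreover have "(\<lambda>i. (rs i + v) powr (al - la)) \<longlonglongrightarrow> (r + v) powr (al - la)"
    by (intro tendsto_const tendsto_powr lim) (use r True in auto)
  ultimately show ?thesis unfolding W_profile_def by (intro tendsto_mult tendsto_const)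
qed (simp add: W_profile_def)

lemma W_fun_finite:
  assumes "de > 0" "rh \<ge> 0" "la > -1" "al \<le> la" "x \<noteq> 0"
  shows "W_fun la al de rh x < \<infinity>"
proof -
  let ?r = "(norm x)\<^sup>2"
  have r: "?r > 0" using assms by simp
  have "W_fun la al de rh x \<le> (\<integral>\<^sup>+v. ennreal (?r powr (al - la)) * (ennreal (v powr la) * indicator {0<..<1} v) \<partial>lborel)"
    unfolding W_fun_profile
  proof (rule nn_integral_mono)
    fix v :: real
    consider "v \<le> 0 \<or> v \<ge> 1" | "0 < v" "v < 1" by linarith
    then show "ennreal (W_profile la al de rh ?r v) \<le> ennreal (?r powr (al - la)) * (ennreal (v powr la) * indicator {0<..<1} v)"
    proof cases
      case 1
      then have "W_profile la al de rh ?r v = 0"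
        using cutoff_eq_0[OF assms(1), of "?r + v" rh] r
        by (cases "v \<le> 0") (auto simp: W_profile_def simp del: zero_less_power2)
      then show ?thesis by simp
    next
      case 2
      have "(?r + v) powr (al - la) \<le> ?r powr (al - la)" using 2 r assms by (intro powr_mono2') auto
      moreover have "cutoff de rh (?r + v) \<le> 1" using 2 r assms by (intro cutoff_le_1) auto
      ultimately have "(?r + v) powr (al - la) * cutoff de rh (?r + v) \<le> ?r powr (al - la) * 1" by (intro mult_mono) auto
      then have "v powr la * ((?r + v) powr (al - la) * cutoff de rh (?r + v)) \<le> v powr la * (?r powr (al - la) * 1)"
        by (intro mult_left_mono) auto
      then show ?thesis using 2 by (simp add: W_profile_def ennreal_mult[symmetric] mult_ac ennreal_leI)
    qed
  qed
  also have "\<dots> = ennreal (?r powr (al - la)) * (\<integral>\<^sup>+v. ennreal (v powr la) * indicator {0<..<1} v \<partial>lborel)"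
    by (rule nn_integral_cmult) measurable
  also have "\<dots> < \<infinity>" using assms by (subst nn_integral_powr_from_0) (auto simp: ennreal_mult_less_top)
  finally show ?thesis .
qed

lemma W_fun_le_0:
  assumes "de > 0" "rh \<ge> 0" "al \<le> la"
  shows "W_fun la al de rh x \<le> W_fun la al de rh 0"
  unfolding W_fun_profile using W_profile_antimono[OF assms, of 0 "(norm x)\<^sup>2"]
  by (intro nn_integral_mono ennreal_leI) auto

text \<open>The integrand at r = 0 dominates all others.\<close>

lemma W_fun_tendsto:
  assumes "de > 0" "rh \<ge> 0" "al \<le> la" and fin: "W_fun la al de rh (0 :: real ^ 'n) < \<infinity>"
    and xs: "xs \<longlonglongrightarrow> (x :: real ^ 'n)"
  shows "(\<lambda>i. W_fun la al de rh (xs i)) \<longlonglongrightarrow> W_fun la al de rh x"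
  unfolding W_fun_profile
proof (rule nn_integral_dominated_convergence)
  show "(\<integral>\<^sup>+v. ennreal (W_profile la al de rh ((norm (0 :: real ^ 'n))\<^sup>2) v) \<partial>lborel) < \<infinity>"
    using fin unfolding W_fun_profile .
  show "AE v in lborel. ennreal (W_profile la al de rh ((norm (xs i))\<^sup>2) v)
      \<le> ennreal (W_profile la al de rh ((norm (0 :: real ^ 'n))\<^sup>2) v)" for i
    using W_profile_antimono[OF assms(1-3), of 0 "(norm (xs i))\<^sup>2"] by (intro AE_I2 ennreal_leI) auto
  show "AE v in lborel. (\<lambda>i. ennreal (W_profile la al de rh ((norm (xs i))\<^sup>2) v))
      \<longlonglongrightarrow> ennreal (W_profile la al de rh ((norm x)\<^sup>2) v)"
  proof (rule eventually_mono[OF AE_lborel_singleton[of "1 - (norm x)\<^sup>2"]])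
    fix v assume v: "v \<noteq> 1 - (norm x)\<^sup>2"
    have "(\<lambda>i. (norm (xs i))\<^sup>2) \<longlonglongrightarrow> (norm x)\<^sup>2" using xs by (intro tendsto_intros)
    then show "(\<lambda>i. ennreal (W_profile la al de rh ((norm (xs i))\<^sup>2) v))
      \<longlonglongrightarrow> ennreal (W_profile la al de rh ((norm x)\<^sup>2) v)"
      using v assms(1) by (intro tendsto_ennrealI W_profile_tendsto) auto
  qed
qed measurable

text \<open>Fubini, with fourier_truncated_power for the inner integral. Integrability on the product is
  the case \<xi> = 0 of the same computation.\<close>

lemma W_fun_cos_transform:
  assumes de: "de > 0" and rh: "rh \<ge> 0" and la: "la > -1"
    and ka: "al + real CARD('n) / 2 > -1" and nu: "real CARD('n) / 2 + la \<ge> - 1 / 2"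
  obtains C where "C > 0"
    "(\<integral>\<^sup>+x. W_fun la al de rh (x :: real ^ 'n) \<partial>lborel) < \<infinity>"
    "\<And>\<xi> :: real ^ 'n. (LINT x|lborel. enn2real (W_fun la al de rh x) * cos (\<xi> \<bullet> x))
       = C * (LINT t|lborel. t powr (al + real CARD('n) / 2) * cutoff de rh t * indicator {0<..} t
                * bess (real CARD('n) / 2 + la) (t * (norm \<xi>)\<^sup>2))"
proof -
  let ?n = "real CARD('n) / 2"
  let ?nu = "?n + la"
  obtain C where C: "C > 0" and ft0: "\<And>(\<xi> :: real ^ 'n) t. t > 0 \<Longrightarrow>
     integrable lborel (\<lambda>x::real ^ 'n. pos_powr (1 - (norm x)\<^sup>2 / t) la) \<and>
     (LINT x|lborel. pos_powr (1 - (norm x)\<^sup>2 / t) la * cos (\<xi> \<bullet> x))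
        = C * t powr (real DIM(real ^ 'n) / 2) * bess (real DIM(real ^ 'n) / 2 + la) (t * (norm \<xi>)\<^sup>2)"
    by (rule fourier_truncated_power[OF la]) blast
  have ft: "integrable lborel (\<lambda>x::real ^ 'n. pos_powr (1 - (norm x)\<^sup>2 / t) la)"
     "(LINT x|lborel. pos_powr (1 - (norm x)\<^sup>2 / t) la * cos (\<xi> \<bullet> x)) = C * t powr ?n * bess ?nu (t * (norm \<xi>)\<^sup>2)"
    if "t > 0" for \<xi> :: "real ^ 'n" and t
    using ft0[OF that, of \<xi>] by simp_all
  define q where "q t = t powr al * cutoff de rh t * indicator {0<..} t" for t :: real
  have [measurable]: "q \<in> borel_measurable borel" unfolding q_def[abs_def] by measurable
  have q0: "q t \<ge> 0" for t by (simp add: q_def)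
  define k where "k x t = pos_powr (1 - (norm x)\<^sup>2 / t) la * q t" for x :: "real ^ 'n" and t
  have k0: "k x t \<ge> 0" for x t by (simp add: k_def q0)
  have k_meas [measurable]: "(\<lambda>(x, t). k x t) \<in> borel_measurable (lborel \<Otimes>\<^sub>M lborel)"
    unfolding k_def by measurable
  have W: "W_fun la al de rh x = (\<integral>\<^sup>+t. ennreal (k x t) \<partial>lborel)" for x
    unfolding W_fun_cutoff k_def q_def by (simp add: mult.assoc)
  let ?J = "\<lambda>R t. t powr (al + ?n) * cutoff de rh t * indicator {0<..} t * bess ?nu (t * R)"
  have inner: "(LINT x|lborel. k x t * cos (\<xi> \<bullet> x)) = C * ?J ((norm \<xi>)\<^sup>2) t" for \<xi> t
  proof (cases "t > 0")
    case True
    have "(LINT x|lborel. k x t * cos (\<xi> \<bullet> x)) = (LINT x|lborel. q t * (pos_powr (1 - (norm x)\<^sup>2 / t) la * cos (\<xi> \<bullet> x)))"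
      by (simp add: k_def mult_ac)
    also have "\<dots> = q t * (C * t powr ?n * bess ?nu (t * (norm \<xi>)\<^sup>2))"
      by (subst Bochner_Integration.integral_mult_right_zero) (simp only: ft(2)[OF True])
    finally show ?thesis using True by (simp add: q_def powr_add mult_ac)
  qed (simp add: k_def q_def)
  have Jint: "integrable lborel (?J R)" if "R \<ge> 0" for R
    by (intro weighted_bess_integrable de rh ka nu that)
  have nuinner: "(\<integral>\<^sup>+x. ennreal (k x t) \<partial>lborel) = ennreal (C * ?J 0 t)" for t
  proof -
    have "integrable lborel (\<lambda>x. k x t)"
      using ft(1)[of t] by (cases "t > 0") (simp_all add: k_def q_def)
    then have "(\<integral>\<^sup>+x. ennreal (k x t) \<partial>lborel) = ennreal (LINT x|lborel. k x t)"
      using k0 by (intro nn_integral_eq_integral) auto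
    then show ?thesis using inner[of t 0] by simp
  qed
  have b0: "bess ?nu 0 > 0" using nu by (intro bess_0_pos) auto
  have fin: "(\<integral>\<^sup>+t. \<integral>\<^sup>+x. ennreal (k x t) \<partial>lborel \<partial>lborel) < \<infinity>"
  proof -
    have "integrable lborel (\<lambda>t. C * ?J 0 t)" using Jint[of 0] by (intro integrable_mult_right) auto
    then have "(\<integral>\<^sup>+t. ennreal (norm (C * ?J 0 t)) \<partial>lborel) < \<infinity>" by (simp only: integrable_iff_bounded)
    moreover have "norm (C * ?J 0 t) = C * ?J 0 t" for t
      using C b0 by (simp add: indicator_def)
    ultimately show ?thesis by (simp only: nuinner)
  qed
  show ?thesis
  proof (rule that[OF C])
    have "(\<integral>\<^sup>+x. W_fun la al de rh (x :: real ^ 'n) \<partial>lborel) = (\<integral>\<^sup>+t. \<integral>\<^sup>+x. ennreal (k x t) \<partial>lborel \<partial>lborel)"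
      unfolding W by (rule lborel_pair.Fubini'[symmetric]) measurable
    with fin show "(\<integral>\<^sup>+x. W_fun la al de rh (x :: real ^ 'n) \<partial>lborel) < \<infinity>" by simp
    fix \<xi> :: "real ^ 'n"
    have "enn2real (W_fun la al de rh x) = (LINT t|lborel. k x t)" for x
      unfolding W using k0 by (intro integral_eq_nn_integral[symmetric]) auto
    then have "(LINT x|lborel. enn2real (W_fun la al de rh x) * cos (\<xi> \<bullet> x))
        = (LINT x|lborel. LINT t|lborel. k x t * cos (\<xi> \<bullet> x))" by simp
    also have "\<dots> = (LINT t|lborel. LINT x|lborel. k x t * cos (\<xi> \<bullet> x))"
    proof (rule fubini_lborel)
      have "(\<lambda>(x, t). k x t * cos (\<xi> \<bullet> x)) = (\<lambda>p. (case p of (x, t) \<Rightarrow> k x t) * cos (\<xi> \<bullet> fst p))" by auto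
      also have "\<dots> \<in> borel_measurable (lborel \<Otimes>\<^sub>M lborel)" by measurable
      finally show "(\<lambda>(x, t). k x t * cos (\<xi> \<bullet> x)) \<in> borel_measurable (lborel \<Otimes>\<^sub>M lborel)" .
      have "ennreal \<bar>k x t * cos (\<xi> \<bullet> x)\<bar> \<le> ennreal (k x t)" for x t
        using k0[of x t] by (intro ennreal_leI) (simp add: abs_mult mult_left_le)
      then have "(\<integral>\<^sup>+t. \<integral>\<^sup>+x. ennreal \<bar>k x t * cos (\<xi> \<bullet> x)\<bar> \<partial>lborel \<partial>lborel) \<le> (\<integral>\<^sup>+t. \<integral>\<^sup>+x. ennreal (k x t) \<partial>lborel \<partial>lborel)"
        by (intro nn_integral_mono)
      with fin show "(\<integral>\<^sup>+t. \<integral>\<^sup>+x. ennreal \<bar>k x t * cos (\<xi> \<bullet> x)\<bar> \<partial>lborel \<partial>lborel) < \<infinity>" by simp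
    qed
    also have "\<dots> = C * (LINT t|lborel. ?J ((norm \<xi>)\<^sup>2) t)"
      unfolding inner by (rule Bochner_Integration.integral_mult_right_zero)
    finally show "(LINT x|lborel. enn2real (W_fun la al de rh x) * cos (\<xi> \<bullet> x)) = C * (LINT t|lborel. ?J ((norm \<xi>)\<^sup>2) t)" .
  qed
qed

section \<open>Positive definiteness from a nonnegative cosine transform\<close>

lemma lborel_integral_affine:
  fixes f :: "'a::euclidean_space \<Rightarrow> real"
  assumes [measurable]: "f \<in> borel_measurable borel" and c: "c \<noteq> 0"
  shows "(LINT x|lborel. f x) = \<bar>c\<bar> ^ DIM('a) * (LINT x|lborel. f (a + c *\<^sub>R x))"
proof -
  have "(LINT x|lborel. f x)
      = (LINT x|density (distr lborel borel (\<lambda>x. a + c *\<^sub>R x)) (\<lambda>_. ennreal (\<bar>c\<bar> ^ DIM('a))). f x)"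
    by (subst lborel_affine[symmetric]) (use c in auto)
  also have "\<dots> = (LINT x|distr lborel borel (\<lambda>x. a + c *\<^sub>R x). \<bar>c\<bar> ^ DIM('a) *\<^sub>R f x)"
    by (subst integral_density) auto
  also have "\<dots> = (LINT x|lborel. \<bar>c\<bar> ^ DIM('a) *\<^sub>R f (a + c *\<^sub>R x))"
    by (subst integral_distr) auto
  also have "\<dots> = \<bar>c\<bar> ^ DIM('a) * (LINT x|lborel. f (a + c *\<^sub>R x))" by simp
  finally show ?thesis .
qed

lemma integral_odd_eq_0:
  fixes f :: "'a::euclidean_space \<Rightarrow> real"
  assumes "f \<in> borel_measurable borel" "\<And>x. f (- x) = - f x"
  shows "(LINT x|lborel. f x) = 0"
  using lborel_integral_affine[OF assms(1), of "-1" 0] by (simp add: assms(2))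

definition trig_form :: "nat \<Rightarrow> (nat \<Rightarrow> real) \<Rightarrow> (nat \<Rightarrow> 'a::euclidean_space) \<Rightarrow> 'a \<Rightarrow> real" where
  "trig_form N a x \<xi> = (\<Sum>i<N. \<Sum>j<N. a i * a j * cos ((x i - x j) \<bullet> \<xi>))"

text \<open>The form is |a_1 exp(i x_1 \<bullet> \<xi>) + ... + a_N exp(i x_N \<bullet> \<xi>)|^2.\<close>

lemma trig_form_nonneg: "trig_form N a x \<xi> \<ge> 0"
proof -
  have "trig_form N a x \<xi> = (\<Sum>i<N. a i * cos (x i \<bullet> \<xi>))\<^sup>2 + (\<Sum>i<N. a i * sin (x i \<bullet> \<xi>))\<^sup>2"
    unfolding trig_form_def power2_eq_square sum_product sum.distrib[symmetric]
    by (intro sum.cong refl) (simp add: inner_diff_left cos_diff algebra_simps)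
  then show ?thesis by simp
qed

lemma continuous_on_trig_form: "continuous_on S (trig_form N a x)"
  unfolding trig_form_def by (intro continuous_intros)

lemma borel_measurable_trig_form [measurable]: "trig_form N a x \<in> borel_measurable borel"
  by (intro borel_measurable_continuous_onI continuous_on_trig_form)

text \<open>On each ray the form is an entire function of the squared distance from the origin.\<close>

lemma trig_form_eq_0:
  assumes r: "r > 0" and zero: "\<And>\<xi>. norm \<xi> < r \<Longrightarrow> trig_form N a x \<xi> = 0"
  shows "trig_form N a x \<xi> = 0"
proof -
  define d where "d k = (\<Sum>i<N. \<Sum>j<N. a i * a j * ((- 1) ^ k / fact (2 * k) * ((x i - x j) \<bullet> \<xi>) ^ (2 * k)))" for k
  have sums: "(\<lambda>k. d k * z ^ k) sums trig_form N a x (sqrt z *\<^sub>R \<xi>)" if "z \<ge> 0" for z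
  proof -
    have "(\<lambda>k. \<Sum>i<N. \<Sum>j<N. a i * a j * ((- 1) ^ k / fact (2 * k) * ((x i - x j) \<bullet> (sqrt z *\<^sub>R \<xi>)) ^ (2 * k)))
        sums trig_form N a x (sqrt z *\<^sub>R \<xi>)"
      unfolding trig_form_def by (intro sums_sum sums_mult cos_paired)
    moreover have "((x i - x j) \<bullet> (sqrt z *\<^sub>R \<xi>)) ^ (2 * k) = ((x i - x j) \<bullet> \<xi>) ^ (2 * k) * z ^ k" for i j k
      using that by (simp add: power_mult_distrib power_mult)
    ultimately show ?thesis by (simp add: d_def sum_distrib_right mult.assoc)
  qed
  have "d k = 0" for k
  proof (rule power_series_coeffs_unique[where b = "\<lambda>_. 0" and h = "\<lambda>_. 0"])
    show "(\<lambda>k. d k * z ^ k) sums trig_form N a x (sqrt z *\<^sub>R \<xi>)" if "z \<ge> 0" for z by (rule sums[OF that])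
    show "(r / (norm \<xi> + 1))\<^sup>2 > 0" using r by (simp add: add_nonneg_eq_0_iff add_nonneg_pos)
    fix z :: real assume z: "0 \<le> z" "z < (r / (norm \<xi> + 1))\<^sup>2"
    have pos: "norm \<xi> + 1 > 0" by (simp add: add_nonneg_pos)
    have "sqrt z < r / (norm \<xi> + 1)" using z r pos by (intro real_less_lsqrt) auto
    then have "sqrt z * (norm \<xi> + 1) < r" using pos by (simp add: field_simps)
    moreover have "sqrt z * norm \<xi> \<le> sqrt z * (norm \<xi> + 1)" using z by (intro mult_left_mono) auto
    ultimately have "norm (sqrt z *\<^sub>R \<xi>) < r" using z by simp
    then show "trig_form N a x (sqrt z *\<^sub>R \<xi>) = 0" by (rule zero)
  qed auto
  then have "trig_form N a x (sqrt 1 *\<^sub>R \<xi>) = 0"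
    using sums[of 1] by (simp add: sums_iff)
  then show ?thesis by simp
qed

text \<open>Integrating the form against Gaussians gives the quadratic form with the entries
  exp(-|x_i - x_j|^2/(4\<epsilon>)), which tends to the sum of the squares of the coefficients as \<epsilon> tends
  to 0.\<close>

lemma trig_form_not_identically_0:
  fixes x :: "nat \<Rightarrow> 'a::euclidean_space"
  assumes inj: "inj_on x {..<N}" and zero: "\<And>\<xi>. trig_form N a x \<xi> = 0" and i: "i < N"
  shows "a i = 0"
proof -
  obtain C where C: "C > 0" and ft: "\<And>(\<xi> :: 'a) \<epsilon>. \<epsilon> > 0 \<Longrightarrow>
     integrable lborel (\<lambda>x::'a. exp (- \<epsilon> * (norm x)\<^sup>2)) \<and>
     (LINT x|lborel. exp (- \<epsilon> * (norm x)\<^sup>2) * cos (\<xi> \<bullet> x)) = C / \<epsilon> powr (real DIM('a) / 2) * exp (- (norm \<xi>)\<^sup>2 / (4 * \<epsilon>))"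
    by (rule fourier_gaussian) blast
  let ?d = "\<lambda>i j. (norm (x i - x j))\<^sup>2"
  have eq: "(\<Sum>i<N. \<Sum>j<N. a i * a j * exp (- ?d i j / (4 * \<epsilon>))) = 0" if e: "\<epsilon> > 0" for \<epsilon>
  proof -
    let ?K = "C / \<epsilon> powr (real DIM('a) / 2)"
    have int: "integrable lborel (\<lambda>\<xi>. exp (- \<epsilon> * (norm \<xi>)\<^sup>2) * cos (z \<bullet> \<xi>))" for z :: 'a
    proof (rule Bochner_Integration.integrable_bound)
      show "integrable lborel (\<lambda>x::'a. exp (- \<epsilon> * (norm x)\<^sup>2))" using ft[OF e] by blast
    qed (auto simp: abs_mult mult_left_le)
    have "0 = (LINT \<xi>|lborel. exp (- \<epsilon> * (norm \<xi>)\<^sup>2) * trig_form N a x \<xi>)" by (simp add: zero)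
    also have "\<dots> = (LINT \<xi>|lborel. (\<Sum>i<N. \<Sum>j<N. a i * a j * (exp (- \<epsilon> * (norm \<xi>)\<^sup>2) * cos ((x i - x j) \<bullet> \<xi>))))"
      unfolding trig_form_def by (simp add: sum_distrib_left mult_ac)
    also have "\<dots> = (\<Sum>i<N. \<Sum>j<N. a i * a j * (LINT \<xi>|lborel. exp (- \<epsilon> * (norm \<xi>)\<^sup>2) * cos ((x i - x j) \<bullet> \<xi>)))"
      using int by (simp add: Bochner_Integration.integral_sum)
    also have "\<dots> = (\<Sum>i<N. \<Sum>j<N. a i * a j * (?K * exp (- ?d i j / (4 * \<epsilon>))))"
      using ft[OF e] by (simp only:)
    also have "\<dots> = ?K * (\<Sum>i<N. \<Sum>j<N. a i * a j * exp (- ?d i j / (4 * \<epsilon>)))"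
      unfolding sum_distrib_left by (intro sum.cong refl) (simp only: mult_ac)
    finally show ?thesis using C e by simp
  qed
  have "(\<lambda>m. \<Sum>i<N. \<Sum>j<N. a i * a j * exp (- ?d i j / (4 * (1 / real (Suc m))))) \<longlonglongrightarrow>
      (\<Sum>i<N. \<Sum>j<N. a i * a j * (if i = j then 1 else 0))"
  proof (intro tendsto_sum tendsto_mult tendsto_const)
    fix i j assume ij: "i \<in> {..<N}" "j \<in> {..<N}"
    show "(\<lambda>m. exp (- ?d i j / (4 * (1 / real (Suc m))))) \<longlonglongrightarrow> (if i = j then 1 else 0)"
    proof (cases "i = j")
      case False
      then have "x i \<noteq> x j" using inj ij by (auto dest: inj_onD)
      then have d: "- ?d i j / 4 < 0" by simp
      have "norm (exp (- ?d i j / 4)) < 1" using d by simp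
      then have "(\<lambda>m. exp (- ?d i j / 4) ^ Suc m) \<longlonglongrightarrow> 0"
        by (intro LIMSEQ_Suc LIMSEQ_power_zero)
      moreover have "exp (- ?d i j / 4) ^ Suc m = exp (- ?d i j / (4 * (1 / real (Suc m))))" for m
        unfolding exp_of_nat_mult[symmetric] by (simp only: divide_divide_eq_right times_divide_eq_right mult_1_right mult_1_left mult.commute)
      ultimately show ?thesis using False by (simp only: if_False)
    qed simp
  qed
  moreover have "(\<Sum>i<N. \<Sum>j<N. a i * a j * exp (- ?d i j / (4 * (1 / real (Suc m))))) = 0" for m
    by (rule eq) simp
  ultimately have "(\<lambda>m::nat. 0) \<longlonglongrightarrow> (\<Sum>i<N. \<Sum>j<N. a i * a j * (if i = j then 1 else 0))"
    by (simp only:)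
  then have "(\<Sum>i<N. \<Sum>j<N. a i * a j * (if i = j then 1 else 0)) = 0"
    using LIMSEQ_unique tendsto_const by blast
  moreover have "(\<Sum>j<N. a i * a j * (if i = j then 1 else 0)) = (a i)\<^sup>2" if "i < N" for i
    using that by (simp add: power2_eq_square sum.delta' if_distrib[of "\<lambda>u. _ * u"] cong: if_cong)
  ultimately have "(\<Sum>i<N. (a i)\<^sup>2) = 0" by simp
  then show ?thesis using i by (simp add: sum_nonneg_eq_0_iff)
qed

lemma open_AE_imp:
  fixes U :: "'a::euclidean_space set"
  assumes "open U" "AE x in lborel. x \<notin> U"
  shows "U = {}"
proof (rule ccontr)
  assume "U \<noteq> {}"
  then have "\<not> negligible U" using open_not_negligible assms(1) by blast
  moreover have "U \<in> null_sets lborel" using assms by (subst AE_iff_null_sets) auto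
  then have "negligible U" by (simp add: negligible_iff_null_sets null_sets_completionI)
  ultimately show False by simp
qed

text \<open>The easy half of Bochner's theorem, with strictness. For V mollified by a Gaussian of
  width proportional to sqrt \<epsilon>, the quadratic form is up to a constant factor S \<epsilon>, the integral of
  c T against exp(-\<epsilon> |\<xi>|^2), where c is the cosine transform of V and T the trigonometric form. As
  c T is nonnegative, S \<epsilon> increases when \<epsilon> decreases, and S 1 > 0 because c is positive near 0 while
  T does not vanish on a ball.\<close>

lemma quadratic_form_pos_of_cos_transform:
  fixes V :: "'a::euclidean_space \<Rightarrow> real" and x :: "nat \<Rightarrow> 'a"
  assumes V_meas [measurable]: "V \<in> borel_measurable borel" and Vint: "integrable lborel V"
    and even: "\<And>y. V (- y) = V y" and bdd: "\<And>y. \<bar>V y\<bar> \<le> M"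
    and cont: "\<And>ys y. ys \<longlonglongrightarrow> y \<Longrightarrow> (\<lambda>i. V (ys i)) \<longlonglongrightarrow> V y"
    and nonneg: "\<And>\<xi>. (LINT y|lborel. V y * cos (\<xi> \<bullet> y)) \<ge> 0"
    and pos: "(LINT y|lborel. V y) > 0"
    and inj: "inj_on x {..<N}" and a: "\<exists>i<N. a i \<noteq> 0"
  shows "(\<Sum>i<N. \<Sum>j<N. a i * a j * V (x i - x j)) > 0"
proof -
  obtain C where C: "C > 0" and ft: "\<And>(\<xi> :: 'a) \<epsilon>. \<epsilon> > 0 \<Longrightarrow>
     integrable lborel (\<lambda>x::'a. exp (- \<epsilon> * (norm x)\<^sup>2)) \<and>
     (LINT x|lborel. exp (- \<epsilon> * (norm x)\<^sup>2) * cos (\<xi> \<bullet> x)) = C / \<epsilon> powr (real DIM('a) / 2) * exp (- (norm \<xi>)\<^sup>2 / (4 * \<epsilon>))"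
    by (rule fourier_gaussian) blast
  have gint: "integrable lborel (\<lambda>x::'a. exp (- \<epsilon> * (norm x)\<^sup>2))" if "\<epsilon> > 0" for \<epsilon>
    using ft[OF that] by blast
  define c where "c \<xi> = (LINT y|lborel. V y * cos (\<xi> \<bullet> y))" for \<xi>
  have c0: "c \<xi> \<ge> 0" for \<xi> using nonneg by (simp add: c_def)
  have Vcos: "integrable lborel (\<lambda>y. V y * cos (\<xi> \<bullet> y))" for \<xi>
    by (rule Bochner_Integration.integrable_bound[OF Vint]) (auto simp: abs_mult mult_left_le)
  have Vsin: "integrable lborel (\<lambda>y. V y * sin (\<xi> \<bullet> y))" for \<xi>
    by (rule Bochner_Integration.integrable_bound[OF Vint]) (auto simp: abs_mult mult_left_le)
  have c_meas [measurable]: "c \<in> borel_measurable borel"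
    unfolding c_def[abs_def] by measurable
  define L where "L = (LINT y|lborel. \<bar>V y\<bar>)"
  have c_le: "\<bar>c \<xi>\<bar> \<le> L" for \<xi>
  proof -
    have "\<bar>c \<xi>\<bar> \<le> (LINT y|lborel. \<bar>V y * cos (\<xi> \<bullet> y)\<bar>)" unfolding c_def by (rule integral_abs_bound)
    also have "\<dots> \<le> L" unfolding L_def
      using Vint Vcos by (intro integral_mono integrable_abs) (auto simp: abs_mult mult_left_le)
    finally show ?thesis .
  qed
  have c_cont: "continuous (at 0) c"
    unfolding continuous_at_sequentially
  proof (intro allI impI)
    fix \<xi>s :: "nat \<Rightarrow> 'a" assume "\<xi>s \<longlonglongrightarrow> 0"
    then have "(\<lambda>i. V y * cos (\<xi>s i \<bullet> y)) \<longlonglongrightarrow> V y * cos (0 \<bullet> y)" for y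
      by (intro tendsto_intros)
    then show "(c \<circ> \<xi>s) \<longlonglongrightarrow> c 0"
      unfolding c_def comp_def
      by (intro integral_dominated_convergence[where w = "\<lambda>y. \<bar>V y\<bar>"])
         (use Vint in \<open>auto simp: abs_mult mult_left_le\<close>)
  qed
  have "c 0 > 0" using pos by (simp add: c_def)
  then have "\<forall>\<^sub>F \<xi> in at 0. c \<xi> > 0"
    using c_cont by (intro order_tendstoD(1)) (auto simp: continuous_at)
  then obtain r where r0: "r > 0" "\<And>\<xi>. \<xi> \<noteq> 0 \<Longrightarrow> norm \<xi> < r \<Longrightarrow> c \<xi> > 0"
    unfolding eventually_at by auto
  have r: "r > 0" "\<And>\<xi>. norm \<xi> < r \<Longrightarrow> c \<xi> > 0"
    using r0 \<open>c 0 > 0\<close> by (force, metis)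
  let ?T = "trig_form N a x"
  define S where "S \<epsilon> = (LINT \<xi>|lborel. exp (- \<epsilon> * (norm \<xi>)\<^sup>2) * (c \<xi> * ?T \<xi>))" for \<epsilon>
  have gc: "integrable lborel (\<lambda>\<xi>. exp (- \<epsilon> * (norm \<xi>)\<^sup>2) * (c \<xi> * cos (z \<bullet> \<xi>)))" if "\<epsilon> > 0" for \<epsilon> z
  proof (rule Bochner_Integration.integrable_bound)
    show "integrable lborel (\<lambda>\<xi>::'a. L * exp (- \<epsilon> * (norm \<xi>)\<^sup>2))" using gint[OF that] by simp
    have "\<bar>c \<xi> * cos (z \<bullet> \<xi>)\<bar> \<le> L * 1" for \<xi>
      unfolding abs_mult using c_le[of \<xi>] by (intro mult_mono) auto
    then have "exp (- \<epsilon> * (norm \<xi>)\<^sup>2) * \<bar>c \<xi> * cos (z \<bullet> \<xi>)\<bar> \<le> exp (- \<epsilon> * (norm \<xi>)\<^sup>2) * (L * 1)" for \<xi>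
      by (intro mult_left_mono) auto
    then have "norm (exp (- \<epsilon> * (norm \<xi>)\<^sup>2) * (c \<xi> * cos (z \<bullet> \<xi>))) \<le> norm (L * exp (- \<epsilon> * (norm \<xi>)\<^sup>2))" for \<xi>
      using c_le[of 0] by (simp add: abs_mult mult_ac)
    then show "AE \<xi> in lborel. norm (exp (- \<epsilon> * (norm \<xi>)\<^sup>2) * (c \<xi> * cos (z \<bullet> \<xi>))) \<le> norm (L * exp (- \<epsilon> * (norm \<xi>)\<^sup>2))"
      by simp
  qed measurable
  have T_sum: "exp (- \<epsilon> * (norm \<xi>)\<^sup>2) * (c \<xi> * ?T \<xi>)
      = (\<Sum>i<N. \<Sum>j<N. a i * a j * (exp (- \<epsilon> * (norm \<xi>)\<^sup>2) * (c \<xi> * cos ((x i - x j) \<bullet> \<xi>))))" for \<epsilon> \<xi>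
    unfolding trig_form_def sum_distrib_left by (intro sum.cong refl) (simp only: mult_ac)
  have Sint: "integrable lborel (\<lambda>\<xi>. exp (- \<epsilon> * (norm \<xi>)\<^sup>2) * (c \<xi> * ?T \<xi>))" if "\<epsilon> > 0" for \<epsilon>
    unfolding T_sum by (intro Bochner_Integration.integrable_sum integrable_mult_right gc that)
  have S1: "S 1 > 0"
  proof (rule ccontr)
    assume "\<not> S 1 > 0"
    moreover have nn: "exp (- 1 * (norm \<xi>)\<^sup>2) * (c \<xi> * ?T \<xi>) \<ge> 0" for \<xi>
      using c0 trig_form_nonneg by (intro mult_nonneg_nonneg) auto
    then have "S 1 \<ge> 0" unfolding S_def by (intro Bochner_Integration.integral_nonneg)
    ultimately have "S 1 = 0" by simp
    then have "AE \<xi> in lborel. exp (- 1 * (norm \<xi>)\<^sup>2) * (c \<xi> * ?T \<xi>) = 0"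
      unfolding S_def using nn by (subst (asm) integral_nonneg_eq_0_iff_AE[OF Sint]) auto
    then have "AE \<xi> in lborel. \<xi> \<notin> {\<xi>. norm \<xi> < r \<and> 0 < ?T \<xi>}"
      by (rule eventually_mono) (use r(2) in force)
    moreover have "open {\<xi>. norm \<xi> < r \<and> 0 < ?T \<xi>}"
      by (intro open_Collect_conj open_Collect_less continuous_intros continuous_on_trig_form)
    ultimately have "{\<xi>. norm \<xi> < r \<and> 0 < ?T \<xi>} = {}" by (intro open_AE_imp)
    then have "?T \<xi> = 0" if "norm \<xi> < r" for \<xi>
      using that trig_form_nonneg[of N a x \<xi>] by force
    then have "?T \<xi> = 0" for \<xi> by (rule trig_form_eq_0[OF r(1)])
    then show False using trig_form_not_identically_0[OF inj] a by blast
  qed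
  have S_mono: "S \<epsilon> \<ge> S 1" if "0 < \<epsilon>" "\<epsilon> \<le> 1" for \<epsilon>
    unfolding S_def
  proof (intro integral_mono Sint mult_right_mono)
    fix \<xi> :: 'a
    show "0 \<le> c \<xi> * ?T \<xi>" using c0 trig_form_nonneg by (intro mult_nonneg_nonneg)
    have "\<epsilon> * (norm \<xi>)\<^sup>2 \<le> 1 * (norm \<xi>)\<^sup>2" using that by (intro mult_right_mono) auto
    then show "exp (- 1 * (norm \<xi>)\<^sup>2) \<le> exp (- \<epsilon> * (norm \<xi>)\<^sup>2)" by simp
  qed (use that in auto)
  define B where "B \<epsilon> z = (LINT u|lborel. V (z + (2 * sqrt \<epsilon>) *\<^sub>R u) * exp (- 1 * (norm u)\<^sup>2))" for \<epsilon> z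
  have mollify: "(LINT \<xi>|lborel. exp (- \<epsilon> * (norm \<xi>)\<^sup>2) * (c \<xi> * cos (z \<bullet> \<xi>))) = C * 2 ^ DIM('a) * B \<epsilon> z"
    if e: "\<epsilon> > 0" for \<epsilon> z
  proof -
    let ?f = "\<lambda>\<xi> y. V y * (exp (- \<epsilon> * (norm \<xi>)\<^sup>2) * cos ((z - y) \<bullet> \<xi>))"
    have "exp (- \<epsilon> * (norm \<xi>)\<^sup>2) * (c \<xi> * cos (z \<bullet> \<xi>)) = (LINT y|lborel. ?f \<xi> y)" for \<xi>
    proof -
      have odd: "(LINT y|lborel. V y * sin (\<xi> \<bullet> y)) = 0"
        by (rule integral_odd_eq_0) (simp_all add: even)
      have "(LINT y|lborel. ?f \<xi> y) = (LINT y|lborel. exp (- \<epsilon> * (norm \<xi>)\<^sup>2) * (cos (z \<bullet> \<xi>) * (V y * cos (\<xi> \<bullet> y))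
          + sin (z \<bullet> \<xi>) * (V y * sin (\<xi> \<bullet> y))))"
        by (intro Bochner_Integration.integral_cong refl)
          (simp add: inner_diff_left cos_diff inner_commute[of \<xi>] algebra_simps)
      also have "\<dots> = exp (- \<epsilon> * (norm \<xi>)\<^sup>2) * (cos (z \<bullet> \<xi>) * c \<xi> + sin (z \<bullet> \<xi>) * 0)"
        unfolding odd[symmetric] c_def using Vcos Vsin
        by (simp add: Bochner_Integration.integral_add)
      finally show ?thesis by (simp add: mult_ac)
    qed
    then have "(LINT \<xi>|lborel. exp (- \<epsilon> * (norm \<xi>)\<^sup>2) * (c \<xi> * cos (z \<bullet> \<xi>))) = (LINT \<xi>|lborel. LINT y|lborel. ?f \<xi> y)"
      by simp
    also have "\<dots> = (LINT y|lborel. LINT \<xi>|lborel. ?f \<xi> y)"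
    proof (rule fubini_lborel)
      show "(\<lambda>(\<xi>, y). ?f \<xi> y) \<in> borel_measurable (lborel \<Otimes>\<^sub>M lborel)" by measurable
      have "(\<integral>\<^sup>+y. \<integral>\<^sup>+\<xi>. ennreal \<bar>?f \<xi> y\<bar> \<partial>lborel \<partial>lborel)
          \<le> (\<integral>\<^sup>+y. \<integral>\<^sup>+\<xi>. ennreal (norm (V y)) * ennreal (norm (exp (- \<epsilon> * (norm (\<xi> :: 'a))\<^sup>2))) \<partial>lborel \<partial>lborel)"
        by (intro nn_integral_mono) (auto simp: abs_mult ennreal_mult[symmetric] intro!: ennreal_leI mult_left_mono mult_left_le)
      also have "\<dots> = (\<integral>\<^sup>+y. ennreal (norm (V y)) \<partial>lborel) * (\<integral>\<^sup>+\<xi>. ennreal (norm (exp (- \<epsilon> * (norm (\<xi> :: 'a))\<^sup>2))) \<partial>lborel)"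
        by (subst nn_integral_cmult, measurable) (subst nn_integral_multc, measurable)
      also have "\<dots> < \<infinity>"
        using Vint gint[OF e] unfolding integrable_iff_bounded by (simp add: ennreal_mult_less_top)
      finally show "(\<integral>\<^sup>+y. \<integral>\<^sup>+\<xi>. ennreal \<bar>?f \<xi> y\<bar> \<partial>lborel \<partial>lborel) < \<infinity>" .
    qed
    also have "\<dots> = (LINT y|lborel. V y * (C / \<epsilon> powr (real DIM('a) / 2) * exp (- (norm (z - y))\<^sup>2 / (4 * \<epsilon>))))"
    proof (intro Bochner_Integration.integral_cong refl)
      fix y
      have "(LINT \<xi>|lborel. ?f \<xi> y) = V y * (LINT \<xi>|lborel. exp (- \<epsilon> * (norm \<xi>)\<^sup>2) * cos ((z - y) \<bullet> \<xi>))"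
        by (rule Bochner_Integration.integral_mult_right_zero)
      then show "(LINT \<xi>|lborel. ?f \<xi> y) = V y * (C / \<epsilon> powr (real DIM('a) / 2) * exp (- (norm (z - y))\<^sup>2 / (4 * \<epsilon>)))"
        using ft[OF e] by (simp only:)
    qed
    also have "\<dots> = \<bar>2 * sqrt \<epsilon>\<bar> ^ DIM('a) * (LINT u|lborel. V (z + (2 * sqrt \<epsilon>) *\<^sub>R u) *
        (C / \<epsilon> powr (real DIM('a) / 2) * exp (- (norm (z - (z + (2 * sqrt \<epsilon>) *\<^sub>R u)))\<^sup>2 / (4 * \<epsilon>))))"
      using e by (intro lborel_integral_affine) auto
    also have "\<dots> = \<bar>2 * sqrt \<epsilon>\<bar> ^ DIM('a) * (LINT u|lborel. C / \<epsilon> powr (real DIM('a) / 2) *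
        (V (z + (2 * sqrt \<epsilon>) *\<^sub>R u) * exp (- 1 * (norm u)\<^sup>2)))"
    proof -
      have "(norm (z - (z + (2 * sqrt \<epsilon>) *\<^sub>R u)))\<^sup>2 = 4 * \<epsilon> * (norm u)\<^sup>2" for u
        using e by (simp add: power_mult_distrib)
      then show ?thesis using e by (simp add: mult_ac)
    qed
    also have "\<dots> = \<bar>2 * sqrt \<epsilon>\<bar> ^ DIM('a) * (C / \<epsilon> powr (real DIM('a) / 2)) * B \<epsilon> z"
      unfolding B_def by (subst Bochner_Integration.integral_mult_right_zero) simp
    also have "\<bar>2 * sqrt \<epsilon>\<bar> ^ DIM('a) * (C / \<epsilon> powr (real DIM('a) / 2)) = C * 2 ^ DIM('a)"
    proof -
      have "sqrt \<epsilon> ^ DIM('a) = \<epsilon> powr (real DIM('a) / 2)"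
        using e by (simp add: powr_realpow[symmetric] powr_half_sqrt[symmetric] powr_powr)
      then show ?thesis using e by (simp add: power_mult_distrib)
    qed
    finally show ?thesis .
  qed
  have S_eq: "S \<epsilon> = C * 2 ^ DIM('a) * (\<Sum>i<N. \<Sum>j<N. a i * a j * B \<epsilon> (x i - x j))" if "\<epsilon> > 0" for \<epsilon>
  proof -
    have "S \<epsilon> = (\<Sum>i<N. \<Sum>j<N. a i * a j * (LINT \<xi>|lborel. exp (- \<epsilon> * (norm \<xi>)\<^sup>2) * (c \<xi> * cos ((x i - x j) \<bullet> \<xi>))))"
      unfolding S_def T_sum using gc[OF that] by (simp add: Bochner_Integration.integral_sum)
    also have "\<dots> = (\<Sum>i<N. \<Sum>j<N. a i * a j * (C * 2 ^ DIM('a) * B \<epsilon> (x i - x j)))"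
      by (simp only: mollify[OF that])
    also have "\<dots> = C * 2 ^ DIM('a) * (\<Sum>i<N. \<Sum>j<N. a i * a j * B \<epsilon> (x i - x j))"
      unfolding sum_distrib_left by (intro sum.cong refl) (simp only: mult_ac)
    finally show ?thesis .
  qed
  define Z where "Z = (LINT u|lborel. exp (- 1 * (norm (u :: 'a))\<^sup>2))"
  have Z: "Z > 0" using ft[of 1 0] C by (simp add: Z_def)
  have B_lim: "(\<lambda>m. B (1 / real (Suc m)) z) \<longlonglongrightarrow> V z * Z" for z
  proof -
    have "(\<lambda>m. B (1 / real (Suc m)) z) \<longlonglongrightarrow> (LINT u|lborel. V z * exp (- 1 * (norm (u :: 'a))\<^sup>2))"
      unfolding B_def
    proof (rule integral_dominated_convergence[where w = "\<lambda>u::'a. M * exp (- 1 * (norm u)\<^sup>2)"])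
      show "integrable lborel (\<lambda>u::'a. M * exp (- 1 * (norm u)\<^sup>2))" using gint[of 1] by simp
      have M: "M \<ge> 0" using bdd[of 0] by simp
      show "AE u in lborel. norm (V (z + (2 * sqrt (1 / real (Suc m))) *\<^sub>R u) * exp (- 1 * (norm u)\<^sup>2))
          \<le> M * exp (- 1 * (norm u)\<^sup>2)" for m
        using bdd by (intro AE_I2) (simp add: abs_mult)
      have "(\<lambda>m. V (z + (2 * sqrt (1 / real (Suc m))) *\<^sub>R u) * exp (- 1 * (norm u)\<^sup>2)) \<longlonglongrightarrow> V z * exp (- 1 * (norm u)\<^sup>2)" for u
      proof (intro tendsto_mult tendsto_const cont)
        have "(\<lambda>m. 1 / real (Suc m)) \<longlonglongrightarrow> 0" by (rule LIMSEQ_Suc[OF lim_1_over_n])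
        then have "(\<lambda>m. z + (2 * sqrt (1 / real (Suc m))) *\<^sub>R u) \<longlonglongrightarrow> z + (2 * sqrt 0) *\<^sub>R u"
          by (intro tendsto_intros)
        then show "(\<lambda>m. z + (2 * sqrt (1 / real (Suc m))) *\<^sub>R u) \<longlonglongrightarrow> z" by simp
      qed
      then show "AE u in lborel. (\<lambda>m. V (z + (2 * sqrt (1 / real (Suc m))) *\<^sub>R u) * exp (- 1 * (norm u)\<^sup>2)) \<longlonglongrightarrow> V z * exp (- 1 * (norm u)\<^sup>2)"
        by simp
    qed measurable
    then show ?thesis unfolding Z_def by simp
  qed
  have S_eq': "S (1 / real (Suc m)) = C * 2 ^ DIM('a) * (\<Sum>i<N. \<Sum>j<N. a i * a j * B (1 / real (Suc m)) (x i - x j))" for m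
    by (rule S_eq) simp
  have "(\<lambda>m. S (1 / real (Suc m))) \<longlonglongrightarrow> C * 2 ^ DIM('a) * (\<Sum>i<N. \<Sum>j<N. a i * a j * (V (x i - x j) * Z))"
    unfolding S_eq' by (intro tendsto_mult tendsto_sum B_lim tendsto_const)
  moreover have "\<exists>m0. \<forall>m\<ge>m0. S 1 \<le> S (1 / real (Suc m))" by (auto intro!: S_mono)
  ultimately have "S 1 \<le> C * 2 ^ DIM('a) * (\<Sum>i<N. \<Sum>j<N. a i * a j * (V (x i - x j) * Z))"
    by (rule LIMSEQ_le_const)
  also have "\<dots> = C * 2 ^ DIM('a) * Z * (\<Sum>i<N. \<Sum>j<N. a i * a j * V (x i - x j))"
    unfolding sum_distrib_left by (intro sum.cong refl) (simp only: mult_ac)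
  finally have "0 < C * 2 ^ DIM('a) * Z * (\<Sum>i<N. \<Sum>j<N. a i * a j * V (x i - x j))" using S1 by simp
  moreover have "C * 2 ^ DIM('a) * Z > 0" using C Z by simp
  ultimately show ?thesis by (rule zero_less_mult_pos)
qed

section \<open>The parameter regions and the theorem\<close>

text \<open>With \<mu> = 2 ka + 1 - nu, the two upper bounds for \<alpha> in the regions are \<mu> \<le> nu and \<mu> \<le> 1/2, the
  bound (\<lambda> - 3/2)/2 for n = 1 is \<mu> \<le> 0, and the lower bounds ensure ka > -1.\<close>

lemma param_region_conditions:
  assumes "(la, al) \<in> param_region n" "n \<ge> 1"
  defines "nu \<equiv> real n / 2 + la" and "ka \<equiv> al + real n / 2"
  shows "la > -1" "nu > - 1 / 2" "ka > -1" "ka \<le> (max 0 (min nu (1 / 2)) + nu - 1) / 2" "al \<le> la"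
proof -
  have *: "la > -1 \<and> nu > - 1 / 2 \<and> ka > -1 \<and> ka \<le> (max 0 (min nu (1 / 2)) + nu - 1) / 2"
  proof (cases "n = 1")
    case True
    then consider "la > -1" "- 3 / 2 < al" "al \<le> (la - 3 / 2) / 2"
      | "la > - 1 / 2" "(la - 3 / 2) / 2 < al" "al \<le> la - 1 / 2" "al \<le> (la - 1) / 2"
      using assms(1) by (auto simp: param_region_def)
    then show ?thesis
    proof cases
      case 1
      have "max 0 (min nu (1 / 2)) \<ge> 0" by simp
      with 1 True show ?thesis unfolding nu_def ka_def by simp
    next
      case 2
      with True have "nu > 0" by (simp add: nu_def)
      then have "max 0 (min nu (1 / 2)) = min nu (1 / 2)" by simp
      with 2 True show ?thesis unfolding nu_def ka_def by (simp add: min_def)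
    qed
  next
    case False
    then have n: "real n \<ge> 2" using assms(2) by simp
    have 1: "la > -1" "- (real n + 2) / 2 < al" "al \<le> la - 1 / 2" "al \<le> (la - (real n + 1) / 2) / 2"
      using assms(1) False by (auto simp: param_region_def)
    then have "nu > 0" using n by (simp add: nu_def)
    then have "max 0 (min nu (1 / 2)) = min nu (1 / 2)" by simp
    with 1 n show ?thesis unfolding nu_def ka_def by (simp add: min_def field_simps)
  qed
  then show "la > -1" "nu > - 1 / 2" "ka > -1" "ka \<le> (max 0 (min nu (1 / 2)) + nu - 1) / 2" by auto
  have "(max 0 (min nu (1 / 2)) + nu - 1) / 2 \<le> nu" using * by (simp add: max_def min_def)
  then show "al \<le> la" using * by (simp add: nu_def ka_def)
qed

text \<open>The sine part of the integrand is odd.\<close>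

lemma fourier_transform_even:
  fixes V :: "real ^ 'n \<Rightarrow> real"
  assumes [measurable]: "V \<in> borel_measurable borel" and Vint: "integrable lborel V" and even: "\<And>x. V (- x) = V x"
  shows "fourier_transform V \<xi> = complex_of_real (LINT x|lborel. V x * cos (\<xi> \<bullet> x))"
proof -
  have Vcos: "integrable lborel (\<lambda>x. V x * cos (\<xi> \<bullet> x))" and Vsin: "integrable lborel (\<lambda>x. V x * sin (\<xi> \<bullet> x))"
    by (rule Bochner_Integration.integrable_bound[OF Vint]; auto simp: abs_mult mult_left_le)+
  have odd: "(LINT x|lborel. V x * sin (\<xi> \<bullet> x)) = 0"
    by (rule integral_odd_eq_0) (simp_all add: even)
  have "exp (- \<i> * complex_of_real t) = complex_of_real (cos t) - \<i> * complex_of_real (sin t)" for t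
    by (simp add: exp_eq_polar complex_eq_iff)
  then have "complex_of_real (V x) * exp (- \<i> * complex_of_real (\<xi> \<bullet> x))
      = complex_of_real (V x * cos (\<xi> \<bullet> x)) - \<i> * complex_of_real (V x * sin (\<xi> \<bullet> x))" for x
    by (simp only:) (simp add: algebra_simps)
  then have "fourier_transform V \<xi> = (LINT x|lborel. complex_of_real (V x * cos (\<xi> \<bullet> x)) - \<i> * complex_of_real (V x * sin (\<xi> \<bullet> x)))"
    unfolding fourier_transform_def by (simp only:)
  also have "\<dots> = (LINT x|lborel. complex_of_real (V x * cos (\<xi> \<bullet> x))) - (LINT x|lborel. \<i> * complex_of_real (V x * sin (\<xi> \<bullet> x)))"
    using Vcos Vsin by (intro Bochner_Integration.integral_diff integrable_mult_right integrable_of_real)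
  also have "\<dots> = complex_of_real (LINT x|lborel. V x * cos (\<xi> \<bullet> x)) - \<i> * complex_of_real (LINT x|lborel. V x * sin (\<xi> \<bullet> x))"
    by (simp only: Bochner_Integration.integral_mult_right_zero integral_complex_of_real)
  finally show ?thesis using odd by simp
qed

lemma W_fun_uminus: "W_fun la al de rh (- x) = W_fun la al de rh x"
  by (simp add: W_fun_def)

lemma weighted_bess_integral_pos:
  assumes de: "de > 0" and rh: "rh \<ge> 0" and ka: "ka > -1" and nu: "nu \<ge> - 1 / 2"
  shows "(LINT t|lborel. t powr ka * cutoff de rh t * indicator {0<..} t * bess nu (t * 0)) > 0" (is "?I > 0")
proof (rule ccontr)
  assume neg: "\<not> ?I > 0"
  have b0: "bess nu 0 > 0" using nu by (intro bess_0_pos) auto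
  have int: "integrable lborel (\<lambda>t. t powr ka * cutoff de rh t * indicator {0<..} t * bess nu (t * 0))"
    by (intro weighted_bess_integrable assms) auto
  have nn: "t powr ka * cutoff de rh t * indicator {0<..} t * bess nu (t * 0) \<ge> 0" for t using b0 by simp
  then have "?I \<ge> 0" by (intro Bochner_Integration.integral_nonneg)
  with neg have "?I = 0" by simp
  then have "AE t in lborel. t powr ka * cutoff de rh t * indicator {0<..} t * bess nu (t * 0) = 0"
    using nn by (subst (asm) integral_nonneg_eq_0_iff_AE[OF int]) auto
  then have "AE t in lborel. t \<notin> {0<..<1::real}"
  proof (rule eventually_mono)
    fix t assume z: "t powr ka * cutoff de rh t * indicator {0<..} t * bess nu (t * 0) = 0"
    show "t \<notin> {0<..<1::real}"
    proof
      assume "t \<in> {0<..<1::real}"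
      then have "cutoff de rh t > 0" "t powr ka > 0" "indicator {0<..} t = (1 :: real)"
        using cutoff_pos[OF de, of t rh] by auto
      with z b0 show False by simp
    qed
  qed
  then have "{0<..<1::real} = {}" by (intro open_AE_imp) auto
  moreover have "1 / 2 \<in> {0<..<1::real}" by simp
  ultimately show False by blast
qed

theorem theorem5p3:
  fixes la al de rh :: real
    and W :: "real ^ 'n \<Rightarrow> ennreal"
  assumes "de > 0" and "rh \<ge> 0"
    and "(la, al) \<in> param_region CARD('n)"
    and "W = W_fun la al de rh"
  shows "(\<integral>\<^sup>+ x. W x \<partial>lborel) < \<infinity> \<and>
         (\<forall>\<xi>. fourier_transform (\<lambda>x. enn2real (W x)) \<xi> \<in> \<real>\<^sub>\<ge>\<^sub>0) \<and>
         (\<exists>\<xi>. fourier_transform (\<lambda>x. enn2real (W x)) \<xi> \<noteq> 0) \<and>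
         induces_pos_def_matrices W"
proof -
  note de = assms(1) and rh = assms(2)
  have "CARD('n) \<ge> 1" by (simp add: Suc_leI)
  note cond = param_region_conditions[OF assms(3) this]
  have nu: "real CARD('n) / 2 + la \<ge> - 1 / 2" using cond(2) by simp
  let ?nu = "real CARD('n) / 2 + la" and ?ka = "al + real CARD('n) / 2"
  let ?J = "\<lambda>R. LINT t|lborel. t powr ?ka * cutoff de rh t * indicator {0<..} t * bess ?nu (t * R)"
  obtain C where C: "C > 0" and fin: "(\<integral>\<^sup>+x. W_fun la al de rh (x :: real ^ 'n) \<partial>lborel) < \<infinity>"
    and ft: "\<And>\<xi> :: real ^ 'n. (LINT x|lborel. enn2real (W_fun la al de rh x) * cos (\<xi> \<bullet> x)) = C * ?J ((norm \<xi>)\<^sup>2)"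
    by (rule W_fun_cos_transform[OF de rh cond(1,3) nu]) blast
  define V where "V x = enn2real (W x)" for x
  have W_meas [measurable]: "W \<in> borel_measurable borel" by (simp add: assms(4))
  have V_meas [measurable]: "V \<in> borel_measurable borel" unfolding V_def[abs_def] by measurable
  have Wfin: "(\<integral>\<^sup>+x. W x \<partial>lborel) < \<infinity>" using fin by (simp add: assms(4))
  have V0: "V x \<ge> 0" for x by (simp add: V_def)
  have even: "W (- x) = W x" "V (- x) = V x" for x by (simp_all add: V_def assms(4) W_fun_uminus)
  have Vint: "integrable lborel V"
  proof (rule integrableI_bounded)
    have "ennreal (norm (V x)) \<le> W x" for x using V0[of x] unfolding V_def by (cases "W x") auto
    then have "(\<integral>\<^sup>+x. ennreal (norm (V x)) \<partial>lborel) \<le> (\<integral>\<^sup>+x. W x \<partial>lborel)" by (intro nn_integral_mono)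
    then show "(\<integral>\<^sup>+x. ennreal (norm (V x)) \<partial>lborel) < \<infinity>" using Wfin by (rule le_less_trans)
  qed measurable
  have cosV: "(LINT x|lborel. V x * cos (\<xi> \<bullet> x)) = C * ?J ((norm \<xi>)\<^sup>2)" for \<xi>
    using ft by (simp add: V_def assms(4))
  have nonneg: "(LINT x|lborel. V x * cos (\<xi> \<bullet> x)) \<ge> 0" for \<xi>
    unfolding cosV using C weighted_bess_integral_nonneg[OF de rh cond(3,2,4), of "(norm \<xi>)\<^sup>2"] by simp
  have "(LINT x|lborel. V x * cos (0 \<bullet> x)) > 0"
    unfolding cosV using C weighted_bess_integral_pos[OF de rh cond(3) nu] by simp
  then have pos: "(LINT x|lborel. V x) > 0" by simp
  have FT: "fourier_transform (\<lambda>x. enn2real (W x)) \<xi> = complex_of_real (LINT x|lborel. V x * cos (\<xi> \<bullet> x))" for \<xi>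
    using fourier_transform_even[OF V_meas Vint even(2)] by (simp add: V_def[abs_def])
  have Wfinite: "W x < \<infinity>" if "x \<noteq> 0" for x
    unfolding assms(4) by (rule W_fun_finite[OF de rh cond(1,5) that])
  have "induces_pos_def_matrices W"
  proof (cases "W 0 < \<infinity>")
    \<comment> \<open>A finite value at the origin makes W bounded and continuous.\<close>
    case True
    then have WV: "W = (\<lambda>x. ennreal (V x))"
      using Wfinite unfolding V_def by (metis ennreal_enn2real infinity_ennreal_def)
    have le: "V x \<le> V 0" for x
      unfolding V_def using W_fun_le_0[OF de rh cond(5), of x] True by (intro enn2real_mono) (auto simp: assms(4))
    have cont: "(\<lambda>i. V (ys i)) \<longlonglongrightarrow> V y" if "ys \<longlonglongrightarrow> y" for ys y
    proof -
      have "(\<lambda>i. W (ys i)) \<longlonglongrightarrow> W y"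
        using W_fun_tendsto[OF de rh cond(5) _ that] True by (simp add: assms(4))
      then have "(\<lambda>i. ennreal (V (ys i))) \<longlonglongrightarrow> ennreal (V y)" by (simp add: WV[symmetric] fun_cong[OF WV, symmetric])
      then show ?thesis by (rule tendsto_ennrealD) (auto simp: V0)
    qed
    have bdd: "\<bar>V y\<bar> \<le> V 0" for y using le V0 by simp
    have sym: "V (x i - x j) = V (x j - x i)" for x :: "nat \<Rightarrow> real ^ 'n" and i j
      using even(2)[of "x i - x j"] by simp
    show ?thesis
      unfolding WV induces_pos_def_matrices_ennreal[of V, OF V0]
      using quadratic_form_pos_of_cos_transform[OF V_meas Vint even(2) bdd cont nonneg pos] sym
      by (intro allI impI conjI) auto
  next
    \<comment> \<open>An infinite diagonal makes the quadratic form infinite, as the other entries are finite.\<close>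
    case False
    then have W0: "W 0 = \<infinity>" by (simp add: less_top[symmetric])
    have off: "\<bar>enn2ereal (W x)\<bar> \<noteq> \<infinity>" if "x \<noteq> 0" for x
      using Wfinite[OF that] by (cases "W x") (auto simp: enn2ereal_ennreal)
    show ?thesis
      unfolding induces_pos_def_matrices_def pos_def_matrix_def
    proof (intro allI impI conjI)
      fix N and x :: "nat \<Rightarrow> real ^ 'n" assume inj: "inj_on x {..<N}"
      show "enn2ereal (W (x i - x j)) = enn2ereal (W (x j - x i))" for i j
        using even(1)[of "x i - x j"] by simp
      show "enn2ereal (W (x i - x i)) \<noteq> - \<infinity>" for i by (simp add: W0)
      show "\<bar>enn2ereal (W (x i - x j))\<bar> \<noteq> \<infinity>" if "i < N" "j < N" "i \<noteq> j" for i j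
        using that inj by (intro off) (auto dest: inj_onD)
      fix c :: "nat \<Rightarrow> real" assume "\<exists>i<N. c i \<noteq> 0"
      then obtain i where i: "i < N" "c i \<noteq> 0" by blast
      have "0 < (c i)\<^sup>2" using i by simp
      then have "ereal (c i * c i) * enn2ereal (W (x i - x i)) = \<infinity>"
        using i by (simp add: W0 power2_eq_square)
      then have "(\<Sum>j<N. ereal (c i * c j) * enn2ereal (W (x i - x j))) = \<infinity>"
        using i by (subst sum_Pinfty) auto
      then have "(\<Sum>i<N. \<Sum>j<N. ereal (c i * c j) * enn2ereal (W (x i - x j))) = \<infinity>"
        using i by (subst sum_Pinfty) auto
      then show "0 < (\<Sum>i<N. \<Sum>j<N. ereal (c i * c j) * enn2ereal (W (x i - x j)))" by simp
    qed
  qed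
  moreover have "fourier_transform (\<lambda>x. enn2real (W x)) 0 \<noteq> 0" unfolding FT using pos by simp
  moreover have "\<forall>\<xi>. fourier_transform (\<lambda>x. enn2real (W x)) \<xi> \<in> \<real>\<^sub>\<ge>\<^sub>0"
    unfolding FT using nonneg by simp
  ultimately show ?thesis using Wfin by blast
qed

end
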